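(* Let $k\ge1$ be an integer, let $\kappa$ be a $C^\infty$ function germ at $0\in\mathbb{R}$, let $\theta(s)=\int_0^s\kappa(u)\,du$ with Taylor expansion $\sum_{i\ge1}\theta_i s^i/i!$, and let $\phi_3(s)=\int_0^s \frac{u^2}{2}\,(\cos\theta(u),\sin\theta(u))\,du$. (i) $\phi_3$ defines an $E_{6k}$ singularity at $0$ if and only if $$( * )\qquad \theta_i=0 \text{ for all } i\ge1,\ i\not\equiv0\bmod3,\ i<3k-2;\qquad \theta_{3k-2}\ne0.$$ Under the assumption $( * )$, $\phi_3$ is $\mathcal A$-equivalent at $0$ to (ia) $(t^3,t^{3k+1}+\varepsilon_p t^{3(k+p)+2})$ if $\theta_{3(k+j)-1}=0$ for $0\le j<p$ and $\theta_{3(k+p)-1}\ne0$, where $p$ is an integer with $0\le p\le k-2$; moreover $\varepsilon_p$ is the sign of $\theta_{3(k+p)-1}/\theta_{3k-2}$ when $p$ is odd; (ib) $(t^3,t^{3k+1})$ if $\theta_{3(k+j)-1}=0$ for $0\le j\le k-2$. (ii) $\phi_3$ defines an $E_{6k+2}$ singularity at $0$ if and only if $$( ** )\qquad \theta_i=0 \text{ for all } i\ge1,\ i\not\equiv0\bmod3,\ i<3k-1;\qquad \theta_{3k-1}\ne0.$$ Under the assumption $( ** )$, $\phi_3$ is $\mathcal A$-equivalent at $0$ to (iia) $(t^3,t^{3k+2}+\varepsilon_{p+1}t^{3(k+p)+4})$ if $\theta_{3(k+j)+1}=0$ for $0\le j<p$ and $\theta_{3(k+p)+1}\ne0$, where $p$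 is an integer with $0\le p\le k-2$; moreover $\varepsilon_{p+1}$ is the sign of $\theta_{3(k+p)+1}/\theta_{3k-1}$ when $p+1$ is odd; (iib) $(t^3,t^{3k+2})$ if $\theta_{3(k+j)+1}=0$ for $0\le j\le k-2$.
   Context: Two $C^\infty$ map germs $f,g:(\mathbb{R},0)\to(\mathbb{R}^2,0)$ are $\mathcal A$-equivalent if there are diffeomorphism germs $h$ of $(\mathbb{R},0)$ and $\psi$ of $(\mathbb{R}^2,0)$ with $f\circ h=\psi\circ g$. Convention: $\varepsilon_p=1$ if $p$ is even, and $\varepsilon_p\in\{1,-1\}$ if $p$ is odd. A map germ $(\mathbb{R},0)\to(\mathbb{R}^2,0)$ defines an $E_{6k}$ singularity at $0$ if it is $\mathcal A$-equivalent to $(t^3,t^{3k+1}+\varepsilon_p t^{3(k+p)+2})$ for some $0\le p\le k-2$ and some admissible sign $\varepsilon_p$, or to $(t^3,t^{3k+1})$. It defines an $E_{6k+2}$ singularity at $0$ if it is $\mathcal A$-equivalent to $(t^3,t^{3k+2}+\varepsilon_{p+1}t^{3(k+p)+4})$ for some $0\le p\le k-2$ and some admissible sign $\varepsilon_{p+1}$, or to $(t^3,t^{3k+2})$. *)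

theory Defs
  imports "HOL-Analysis.Analysis"
begin

text \<open>
  A germ at \<open>0\<close> is represented by a total function; values far from \<open>0\<close> are irrelevant, and
  equalities of germs are stated with \<open>eventually _ (nhds 0)\<close>.
\<close>

text \<open>For open \<open>U\<close>, \<open>C_times n U f\<close> says that \<open>f\<close> is of class \<open>C\<^sup>n\<close> on \<open>U\<close>: on a
  finite-dimensional domain, a differentiable map is \<open>C\<^sup>n\<^sup>+\<^sup>1\<close> iff all its directional
  derivatives are \<open>C\<^sup>n\<close>.\<close>

primrec C_times ::
  "nat \<Rightarrow> 'a::euclidean_space set \<Rightarrow> ('a \<Rightarrow> 'b::euclidean_space) \<Rightarrow> bool" where
  "C_times 0 U f \<longleftrightarrow> continuous_on U f"
| "C_times (Suc n) U f \<longleftrightarrow>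
     (\<forall>x\<in>U. f differentiable (at x)) \<and>
     (\<forall>v. C_times n U (\<lambda>x. frechet_derivative f (at x) v))"

definition smooth_on ::
  "'a::euclidean_space set \<Rightarrow> ('a \<Rightarrow> 'b::euclidean_space) \<Rightarrow> bool" where
  "smooth_on U f \<longleftrightarrow> (\<forall>n. C_times n U f)"

definition smooth_germ :: "('a::euclidean_space \<Rightarrow> 'b::euclidean_space) \<Rightarrow> bool" where
  "smooth_germ f \<longleftrightarrow> (\<exists>U. open U \<and> 0 \<in> U \<and> smooth_on U f)"

definition smooth_map_germ :: "('a::euclidean_space \<Rightarrow> 'b::euclidean_space) \<Rightarrow> bool" where
  "smooth_map_germ f \<longleftrightarrow> smooth_germ f \<and> f 0 = 0"

definition diffeo_germ :: "('a::euclidean_space \<Rightarrow> 'a) \<Rightarrow> bool" where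
  "diffeo_germ f \<longleftrightarrow> f 0 = 0 \<and>
     (\<exists>U V g. open U \<and> open V \<and> 0 \<in> U \<and> f ` U = V \<and> g ` V = U \<and>
        (\<forall>x\<in>U. g (f x) = x) \<and> (\<forall>y\<in>V. f (g y) = y) \<and>
        smooth_on U f \<and> smooth_on V g)"

definition A_equivalent :: "(real \<Rightarrow> real \<times> real) \<Rightarrow> (real \<Rightarrow> real \<times> real) \<Rightarrow> bool" where
  "A_equivalent f g \<longleftrightarrow> smooth_map_germ f \<and> smooth_map_germ g \<and>
     (\<exists>(h :: real \<Rightarrow> real) (\<psi> :: real \<times> real \<Rightarrow> real \<times> real).
        diffeo_germ h \<and> diffeo_germ \<psi> \<and> eventually (\<lambda>t. f (h t) = \<psi> (g t)) (nhds 0))"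

definition admissible_sign :: "nat \<Rightarrow> real \<Rightarrow> bool" where
  "admissible_sign p \<epsilon> \<longleftrightarrow> (if even p then \<epsilon> = 1 else \<epsilon> \<in> {1, -1})"

text \<open>The bound \<open>p \<le> k - 2\<close> is written \<open>p + 2 \<le> k\<close>, so that no \<open>p\<close> qualifies
  when \<open>k = 1\<close> (subtraction on \<open>nat\<close> truncates).\<close>

definition E6k_singularity :: "nat \<Rightarrow> (real \<Rightarrow> real \<times> real) \<Rightarrow> bool" where
  "E6k_singularity k f \<longleftrightarrow>
     (\<exists>p \<epsilon>. p + 2 \<le> k \<and> admissible_sign p \<epsilon> \<and>
        A_equivalent f (\<lambda>t. (t ^ 3, t ^ (3*k+1) + \<epsilon> * t ^ (3*(k+p)+2)))) \<or>
     A_equivalent f (\<lambda>t. (t ^ 3, t ^ (3*k+1)))"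

definition E6k2_singularity :: "nat \<Rightarrow> (real \<Rightarrow> real \<times> real) \<Rightarrow> bool" where
  "E6k2_singularity k f \<longleftrightarrow>
     (\<exists>p \<epsilon>. p + 2 \<le> k \<and> admissible_sign (p+1) \<epsilon> \<and>
        A_equivalent f (\<lambda>t. (t ^ 3, t ^ (3*k+2) + \<epsilon> * t ^ (3*(k+p)+4)))) \<or>
     A_equivalent f (\<lambda>t. (t ^ 3, t ^ (3*k+2)))"

definition theta :: "(real \<Rightarrow> real) \<Rightarrow> real \<Rightarrow> real" where
  "theta \<kappa> s = (LBINT u=0..s. \<kappa> u)"

text \<open>The coefficient of \<open>s\<^sup>i / i!\<close> in the Taylor expansion of \<open>theta \<kappa>\<close> at \<open>0\<close>.\<close>

definition theta_coeff :: "(real \<Rightarrow> real) \<Rightarrow> nat \<Rightarrow> real" where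
  "theta_coeff \<kappa> i = (deriv ^^ i) (theta \<kappa>) 0"

definition phi3 :: "(real \<Rightarrow> real) \<Rightarrow> real \<Rightarrow> real \<times> real" where
  "phi3 \<kappa> s = (LBINT u=0..s. (u\<^sup>2 / 2) *\<^sub>R (cos (theta \<kappa> u), sin (theta \<kappa> u)))"

definition star_condition :: "nat \<Rightarrow> (real \<Rightarrow> real) \<Rightarrow> bool" where
  "star_condition k \<kappa> \<longleftrightarrow>
     (\<forall>i. 1 \<le> i \<and> i mod 3 \<noteq> 0 \<and> i < 3*k-2 \<longrightarrow> theta_coeff \<kappa> i = 0) \<and>
     theta_coeff \<kappa> (3*k-2) \<noteq> 0"

definition double_star_condition :: "nat \<Rightarrow> (real \<Rightarrow> real) \<Rightarrow> bool" where
  "double_star_condition k \<kappa> \<longleftrightarrow>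
     (\<forall>i. 1 \<le> i \<and> i mod 3 \<noteq> 0 \<and> i < 3*k-1 \<longrightarrow> theta_coeff \<kappa> i = 0) \<and>
     theta_coeff \<kappa> (3*k-1) \<noteq> 0"

end

theory Submission
  imports Defs
begin

text \<open>
  Write \<open>m = 3k - 2\<close> or \<open>m = 3k - 1\<close> and \<open>q = m + 3\<close>. Taking the cube root of six times the first
  component of \<open>\<phi>\<^sub>3\<close> as parameter turns the curve into \<open>(t\<^sup>3/6, Y(t))\<close>. Below degree \<open>2m\<close>, the
  Taylor coefficients at indices not divisible by 3 behave like derivations, so the first nonzero
  ones of \<open>Y\<close> are positive multiples of those of \<open>\<theta>\<close>, shifted by 3.

  By Borel's theorem \<open>Y(t) = a(t\<^sup>3) + t\<^sup>q b(t\<^sup>3) + t\<^sup>N c(t\<^sup>3)\<close> with smooth \<open>a, b, c\<close>; coordinate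
  changes in the target remove \<open>a\<close> and normalise \<open>b\<close> to 1. If \<open>c(0) \<noteq> 0\<close>, a substitution
  \<open>t \<mapsto> t u(t\<^sup>3)\<close> makes \<open>c\<close> constant, explicitly. If all coefficients below the last gap
  \<open>2q - 3\<close> of the semigroup generated by 3 and \<open>q\<close> vanish, a polynomial substitution removes that
  one as well, and everything of higher order is a smooth function of \<open>(t\<^sup>3, t\<^sup>q)\<close>.

  Conversely, the least order not divisible by 3 of a smooth function along the curve is invariant
  under \<open>\<A>\<close>-equivalence, and it equals \<open>q\<close>.
\<close>

text \<open>The bound 2m has one source: an index in the class of 2m modulo 3 can be the sum of two
  indices in the class of m, and at nonzero coefficients each of these is at least m. Below 2m no
  such product occurs. At 2m itself the coefficient of the curve is no longer linear in theta, but
  the corresponding exponent 2m + 3 = 2q - 3 is the Frobenius number of 3 and q, whose term can be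
  removed. This is why p stops at k - 2.

  A sign survives exactly when N - q is even: replacing t by t u multiplies the second term,
  relative to the first, by u^(N - q), which takes both signs only for odd N - q. Since N - q is 3p
  + 1 or 3p + 2, this is the parity rule for the signs.

  The obstacle is that germs are smooth, not analytic, and a series determines its germ only up to
  flat functions. Each reduction therefore has to end in an exact identity of germs with an explicit
  diffeomorphism. Flat remainders do no harm because they are themselves smooth functions of
  t^3.\<close>

unbundle fps_syntax
unbundle no vec_syntax

section \<open>Smooth maps\<close>

lemma C_times_cong:
  assumes "open U" "\<And>x. x \<in> U \<Longrightarrow> f x = g x" "C_times n U f"
  shows "C_times n U g"
  using assms(2,3)
proof (induction n arbitrary: f g)
  case 0
  then show ?case by (simp cong: continuous_on_cong)
next
  case (Suc n)
  have der: "(g has_derivative frechet_derivative f (at x)) (at x)" if "x \<in> U" for x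
  proof (rule has_derivative_transform_within_open[OF _ assms(1) that])
    show "(f has_derivative frechet_derivative f (at x)) (at x)"
      using Suc.prems(2) that by (simp add: frechet_derivative_works)
  qed (use Suc.prems(1) in auto)
  have "C_times n U (\<lambda>x. frechet_derivative g (at x) v)" for v
  proof (rule Suc.IH)
    show "C_times n U (\<lambda>x. frechet_derivative f (at x) v)" using Suc.prems(2) by simp
    show "frechet_derivative f (at x) v = frechet_derivative g (at x) v" if "x \<in> U" for x
      using frechet_derivative_at[OF der[OF that]] by simp
  qed
  then show ?case using der by (auto simp: differentiable_def)
qed

text \<open>Any family \<open>f'\<close> of derivatives may stand in for
  \<open>frechet_derivative\<close>, with which it agrees on \<open>U\<close> by uniqueness; the
  closure lemmas below can then differentiate by the usual rules.\<close>

lemma C_times_SucI: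
  assumes "open U" "\<And>x. x \<in> U \<Longrightarrow> (f has_derivative f' x) (at x)"
    "\<And>v. C_times n U (\<lambda>x. f' x v)"
  shows "C_times (Suc n) U f"
proof -
  have "C_times n U (\<lambda>x. frechet_derivative f (at x) v)" for v
    by (rule C_times_cong[OF assms(1) _ assms(3)[of v]])
       (simp add: frechet_derivative_at[OF assms(2), symmetric])
  then show ?thesis using assms(2) by (auto simp: differentiable_def)
qed

lemma C_times_SucD:
  assumes "C_times (Suc n) U f" "x \<in> U"
  shows "(f has_derivative frechet_derivative f (at x)) (at x)"
  using assms by (simp add: frechet_derivative_works)

lemma C_times_Suc_imp:
  assumes "C_times (Suc n) U f"
  shows "C_times n U f"
  using assms
proof (induction n arbitrary: f)
  case 0
  then have "isCont f x" if "x \<in> U" for x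
    using that differentiable_imp_continuous_within[of f x UNIV] by simp
  then show ?case by (simp add: continuous_at_imp_continuous_on)
next
  case (Suc n)
  have "C_times n U (\<lambda>x. frechet_derivative f (at x) v)" for v
    by (rule Suc.IH) (use Suc.prems in simp)
  then show ?case using Suc.prems by simp
qed

lemma C_times_subset:
  assumes "C_times n U f" "V \<subseteq> U"
  shows "C_times n V f"
  using assms by (induction n arbitrary: f) (auto intro: continuous_on_subset)

lemma C_times_const: "open U \<Longrightarrow> C_times n U (\<lambda>x. c)"
proof (induction n arbitrary: c)
  case (Suc n)
  show ?case
    by (rule C_times_SucI[where f' = "\<lambda>x v. 0"]) (use Suc in \<open>auto intro!: derivative_eq_intros\<close>)
qed simp

lemma C_times_linear:
  assumes "open U" "bounded_linear L"
  shows "C_times n U L"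
proof (cases n)
  case 0
  then show ?thesis using assms linear_continuous_on by auto
next
  case (Suc m)
  show ?thesis unfolding Suc
    by (rule C_times_SucI[where f' = "\<lambda>x. L"])
       (use assms bounded_linear_imp_has_derivative in \<open>auto intro: C_times_const\<close>)
qed

lemma C_times_bounded_linear:
  assumes "open U" "bounded_linear L" "C_times n U f"
  shows "C_times n U (\<lambda>x. L (f x))"
  using assms(3)
proof (induction n arbitrary: f)
  case 0
  then show ?case using assms(2) by (auto intro: bounded_linear.continuous_on)
next
  case (Suc n)
  show ?case
    by (rule C_times_SucI[OF assms(1) bounded_linear.has_derivative[OF assms(2) C_times_SucD[OF Suc.prems]]])
       (use Suc in auto)
qed

lemma C_times_add:
  assumes "open U" "C_times n U f" "C_times n U g"
  shows "C_times n U (\<lambda>x. f x + g x)"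
  using assms(2,3)
proof (induction n arbitrary: f g)
  case 0
  then show ?case by (auto intro: continuous_intros)
next
  case (Suc n)
  show ?case
    by (rule C_times_SucI[OF assms(1) has_derivative_add[OF C_times_SucD[OF Suc.prems(1)] C_times_SucD[OF Suc.prems(2)]]])
       (use Suc in auto)
qed

lemma C_times_sum:
  assumes "open U" "\<And>i. i \<in> I \<Longrightarrow> C_times n U (f i)"
  shows "C_times n U (\<lambda>x. \<Sum>i\<in>I. f i x)"
  using assms(2)
  by (induction I rule: infinite_finite_induct) (auto intro: C_times_const C_times_add assms(1))

lemma C_times_scaleR:
  assumes "open U" "C_times n U f" "C_times n U g"
  shows "C_times n U (\<lambda>x. f x *\<^sub>R g x)"
  using assms(2,3)
proof (induction n arbitrary: f g)
  case 0
  then show ?case by (auto intro: continuous_intros)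
next
  case (Suc n)
  show ?case
    by (rule C_times_SucI[OF assms(1) has_derivative_scaleR[OF C_times_SucD[OF Suc.prems(1)] C_times_SucD[OF Suc.prems(2)]]])
       (assumption, assumption, intro C_times_add[OF assms(1)] Suc.IH, use Suc.prems C_times_Suc_imp in auto)
qed

lemma C_times_compose:
  assumes "open U" "open V" "g ` U \<subseteq> V" "C_times n V f" "C_times n U g"
  shows "C_times n U (\<lambda>x. f (g x))"
  using assms(4,5)
proof (induction n arbitrary: f)
  case 0
  then show ?case using assms(3) by (auto intro: continuous_on_compose2)
next
  case (Suc n)
  let ?F = "\<lambda>y. frechet_derivative f (at y)" and ?G = "\<lambda>x. frechet_derivative g (at x)"
  \<comment> \<open>The inner derivative feeds a moving direction into \<open>?F (g x)\<close>,
    whereas the induction hypothesis concerns fixed directions. Expanding in \<open>Basis\<close>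
    separates the two: scalar coefficients times \<open>?F (g x) b\<close>.\<close>
  have eq: "?F (g x) (?G x v) = (\<Sum>b\<in>Basis. (?G x v \<bullet> b) *\<^sub>R ?F (g x) b)" if "x \<in> U" for x v
  proof -
    have "linear (?F (g x))"
      using C_times_SucD[OF Suc.prems(1), of "g x"] that assms(3)
      by (auto intro: has_derivative_linear)
    then show ?thesis
      by (subst euclidean_representation[of "?G x v", symmetric])
         (simp only: linear_sum linear_cmul)
  qed
  show ?case
  proof (rule C_times_SucI[OF assms(1), where f' = "\<lambda>x v. ?F (g x) (?G x v)"])
    show "((\<lambda>x. f (g x)) has_derivative (\<lambda>v. ?F (g x) (?G x v))) (at x)" if "x \<in> U" for x
      by (rule has_derivative_compose[OF C_times_SucD[OF Suc.prems(2) that]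
          C_times_SucD[OF Suc.prems(1)]]) (use that assms(3) in auto)
    fix v
    have "C_times n U (\<lambda>x. \<Sum>b\<in>Basis. (?G x v \<bullet> b) *\<^sub>R ?F (g x) b)"
    proof (intro C_times_sum[OF assms(1)] C_times_scaleR[OF assms(1)])
      fix b :: 'b
      show "C_times n U (\<lambda>x. ?G x v \<bullet> b)"
        by (rule C_times_bounded_linear[OF assms(1) bounded_linear_inner_left])
           (use Suc.prems in simp)
      show "C_times n U (\<lambda>x. ?F (g x) b)"
        by (rule Suc.IH[of "\<lambda>y. ?F y b"]) (use Suc.prems C_times_Suc_imp in auto)
    qed
    then show "C_times n U (\<lambda>x. ?F (g x) (?G x v))"
      by (rule C_times_cong[OF assms(1), rotated]) (simp add: eq)
  qed
qed

lemma smooth_on_subset: "smooth_on U f \<Longrightarrow> V \<subseteq> U \<Longrightarrow> smooth_on V f"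
  by (auto simp: smooth_on_def intro: C_times_subset)

lemma smooth_on_cong:
  "open U \<Longrightarrow> (\<And>x. x \<in> U \<Longrightarrow> f x = g x) \<Longrightarrow> smooth_on U f \<Longrightarrow> smooth_on U g"
  by (auto simp: smooth_on_def intro: C_times_cong)

lemma smooth_on_continuous: "smooth_on U f \<Longrightarrow> continuous_on U f"
  using C_times.simps(1) by (metis smooth_on_def)

lemma smooth_on_const: "open U \<Longrightarrow> smooth_on U (\<lambda>x. c)"
  by (simp add: smooth_on_def C_times_const)

lemma smooth_on_linear: "open U \<Longrightarrow> bounded_linear L \<Longrightarrow> smooth_on U L"
  by (simp add: smooth_on_def C_times_linear)

lemma smooth_on_add:
  "open U \<Longrightarrow> smooth_on U f \<Longrightarrow> smooth_on U g \<Longrightarrow> smooth_on U (\<lambda>x. f x + g x)"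
  by (simp add: smooth_on_def C_times_add)

lemma smooth_on_scaleR:
  "open U \<Longrightarrow> smooth_on U f \<Longrightarrow> smooth_on U g \<Longrightarrow> smooth_on U (\<lambda>x. f x *\<^sub>R g x)"
  by (simp add: smooth_on_def C_times_scaleR)

lemma smooth_on_mult:
  fixes f g :: "'a::euclidean_space \<Rightarrow> real"
  shows "open U \<Longrightarrow> smooth_on U f \<Longrightarrow> smooth_on U g \<Longrightarrow> smooth_on U (\<lambda>x. f x * g x)"
  using smooth_on_scaleR[of U f g] by simp

lemma smooth_on_compose:
  "open U \<Longrightarrow> open V \<Longrightarrow> g ` U \<subseteq> V \<Longrightarrow> smooth_on V f \<Longrightarrow> smooth_on U g \<Longrightarrow> smooth_on U (\<lambda>x. f (g x))"
  by (auto simp: smooth_on_def intro: C_times_compose)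

lemma smooth_on_frechet:
  assumes "smooth_on U f"
  shows "x \<in> U \<Longrightarrow> (f has_derivative frechet_derivative f (at x)) (at x)"
    and "smooth_on U (\<lambda>x. frechet_derivative f (at x) v)"
proof -
  have *: "C_times (Suc n) U f" for n using assms by (simp only: smooth_on_def)
  show "x \<in> U \<Longrightarrow> (f has_derivative frechet_derivative f (at x)) (at x)"
    by (rule C_times_SucD[OF *])
  show "smooth_on U (\<lambda>x. frechet_derivative f (at x) v)"
    using * by (simp add: smooth_on_def)
qed

lemma smooth_on_deriv:
  fixes f :: "real \<Rightarrow> real"
  assumes "open U" "smooth_on U f"
  shows "x \<in> U \<Longrightarrow> (f has_field_derivative deriv f x) (at x)" and "smooth_on U (deriv f)"
proof -
  have fd: "(f has_field_derivative frechet_derivative f (at x) 1) (at x)" if "x \<in> U" for x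
  proof -
    have d: "(f has_derivative frechet_derivative f (at x)) (at x)"
      using smooth_on_frechet(1)[OF assms(2) that] .
    then have "linear (frechet_derivative f (at x))" by (rule has_derivative_linear)
    then have "frechet_derivative f (at x) v = frechet_derivative f (at x) 1 * v" for v
      using linear_cmul[of "frechet_derivative f (at x)" v 1] by simp
    then have "frechet_derivative f (at x) = (*) (frechet_derivative f (at x) 1)" by blast
    then show ?thesis using d unfolding has_field_derivative_def by simp
  qed
  show "x \<in> U \<Longrightarrow> (f has_field_derivative deriv f x) (at x)"
    using fd DERIV_imp_deriv by metis
  show "smooth_on U (deriv f)"
    by (rule smooth_on_cong[OF assms(1) _ smooth_on_frechet(2)[OF assms(2), of 1]])
       (use fd DERIV_imp_deriv in metis)
qed

text \<open>If every member of \<open>P\<close> has a derivative in \<open>P\<close>, one induction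
  reaches all orders. The set is an invariant to be guessed: for \<open>inverse\<close> the
  multiples of its powers, below also parameter integrals and functions of
  \<open>root 3 x\<close>.\<close>

lemma smooth_on_coinduct:
  fixes f :: "real \<Rightarrow> real"
  assumes "open U" "P f"
    and step: "\<And>f. P f \<Longrightarrow> \<exists>f'. P f' \<and> (\<forall>x\<in>U. (f has_field_derivative f' x) (at x))"
  shows "smooth_on U f"
proof -
  have "C_times n U f" if "P f" for n f
    using that
  proof (induction n arbitrary: f)
    case 0
    from step[OF this] obtain f' where "\<forall>x\<in>U. (f has_field_derivative f' x) (at x)" by blast
    then show ?case
      by (auto intro!: continuous_at_imp_continuous_on DERIV_isCont)
  next
    case (Suc n)
    from step[OF this(2)] obtain f'
      where f': "P f'" "\<And>x. x \<in> U \<Longrightarrow> (f has_field_derivative f' x) (at x)" by blast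
    show ?case
    proof (rule C_times_SucI[OF assms(1), where f' = "\<lambda>x v. v *\<^sub>R f' x"])
      show "(f has_derivative (\<lambda>v. v *\<^sub>R f' x)) (at x)" if "x \<in> U" for x
        using f'(2)[OF that] by (simp add: has_field_derivative_def mult_commute_abs)
      show "C_times n U (\<lambda>x. v *\<^sub>R f' x)" for v
        by (rule C_times_bounded_linear[OF assms(1) bounded_linear_scaleR_right Suc.IH[OF f'(1)]])
    qed
  qed
  then show ?thesis using assms(2) by (simp add: smooth_on_def)
qed

lemma smooth_on_antideriv:
  fixes f :: "real \<Rightarrow> 'a::euclidean_space"
  assumes "open U" "\<And>x. x \<in> U \<Longrightarrow> (f has_vector_derivative f' x) (at x)" "smooth_on U f'"
  shows "smooth_on U f"
  unfolding smooth_on_def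
proof
  fix n
  have "C_times (Suc n) U f"
  proof (rule C_times_SucI[OF assms(1), where f' = "\<lambda>x v. v *\<^sub>R f' x"])
    show "(f has_derivative (\<lambda>v. v *\<^sub>R f' x)) (at x)" if "x \<in> U" for x
      using assms(2)[OF that] by (simp add: has_vector_derivative_def)
    show "C_times n U (\<lambda>x. v *\<^sub>R f' x)" for v
      by (rule C_times_bounded_linear[OF assms(1) bounded_linear_scaleR_right])
         (use assms(3) in \<open>simp add: smooth_on_def\<close>)
  qed
  then show "C_times n U f" by (rule C_times_Suc_imp)
qed

lemma smooth_on_exp: "open U \<Longrightarrow> smooth_on U (exp :: real \<Rightarrow> real)"
  by (rule smooth_on_coinduct[where P = "\<lambda>f. f = exp"]) (auto intro!: derivative_eq_intros)

lemma smooth_on_trig: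
  "open U \<Longrightarrow> smooth_on U (\<lambda>x::real. a * sin x + b * cos x)"
proof (rule smooth_on_coinduct[where P = "\<lambda>f. \<exists>a b. f = (\<lambda>x::real. a * sin x + b * cos x)"])
  fix f :: "real \<Rightarrow> real"
  assume "\<exists>a b. f = (\<lambda>x. a * sin x + b * cos x)"
  then obtain a b where f: "f = (\<lambda>x. a * sin x + b * cos x)" by blast
  have "(f has_field_derivative - b * sin x + a * cos x) (at x)" for x
    unfolding f by (auto intro!: derivative_eq_intros)
  then show "\<exists>f'. (\<exists>a b. f' = (\<lambda>x. a * sin x + b * cos x)) \<and> (\<forall>x\<in>U. (f has_field_derivative f' x) (at x))"
    by (intro exI[of _ "\<lambda>x. - b * sin x + a * cos x"]) blast
qed auto

lemma smooth_on_sin: "open U \<Longrightarrow> smooth_on U (sin :: real \<Rightarrow> real)"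
  and smooth_on_cos: "open U \<Longrightarrow> smooth_on U (cos :: real \<Rightarrow> real)"
  using smooth_on_trig[of U 1 0] smooth_on_trig[of U 0 1] by simp_all

lemma smooth_on_inverse: "smooth_on (- {0}) (inverse :: real \<Rightarrow> real)"
proof (rule smooth_on_coinduct[where P = "\<lambda>f. \<exists>c n. f = (\<lambda>x::real. c * inverse x ^ Suc n)"])
  show "\<exists>c n. inverse = (\<lambda>x::real. c * inverse x ^ Suc n)"
    by (intro exI[of _ 1] exI[of _ 0]) auto
  fix f :: "real \<Rightarrow> real"
  assume "\<exists>c n. f = (\<lambda>x::real. c * inverse x ^ Suc n)"
  then obtain c n where f: "f = (\<lambda>x. c * inverse x ^ Suc n)" by blast
  have "(f has_field_derivative (- c * Suc n) * inverse x ^ Suc (Suc n)) (at x)" if "x \<in> -{0}" for x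
  proof -
    have "((\<lambda>x. inverse x ^ Suc n) has_field_derivative
        (1 + of_nat n) * (- (inverse x ^ Suc (Suc 0)) * inverse x ^ n)) (at x)"
      by (rule DERIV_power_Suc[OF DERIV_inverse]) (use that in simp)
    from DERIV_cmult[OF this, of c] show ?thesis
      unfolding f by (simp add: algebra_simps)
  qed
  then show "\<exists>f'. (\<exists>c n. f' = (\<lambda>x. c * inverse x ^ Suc n)) \<and> (\<forall>x\<in>-{0}. (f has_field_derivative f' x) (at x))"
    by (intro exI[of _ "\<lambda>x. (- c * Suc n) * inverse x ^ Suc (Suc n)"]) blast
qed auto

lemma smooth_on_ln: "smooth_on {0<..} (ln :: real \<Rightarrow> real)"
proof (rule smooth_on_antideriv)
  show "(ln has_vector_derivative inverse x) (at x)" if "x \<in> {0<..}" for x :: real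
    using that DERIV_ln[of x] by (simp add: has_real_derivative_iff_has_vector_derivative)
  show "smooth_on {0<..} (inverse :: real \<Rightarrow> real)"
    by (rule smooth_on_subset[OF smooth_on_inverse]) auto
qed auto

section \<open>Smooth germs\<close>

lemma smooth_germ_cong:
  assumes "smooth_germ f" "eventually (\<lambda>x. f x = g x) (nhds 0)"
  shows "smooth_germ g"
proof -
  obtain U where U: "open U" "0 \<in> U" "smooth_on U f" using assms(1) by (auto simp: smooth_germ_def)
  obtain V where V: "open V" "0 \<in> V" "\<And>x. x \<in> V \<Longrightarrow> f x = g x"
    using assms(2) by (auto simp: eventually_nhds)
  have "smooth_on (U \<inter> V) g"
    by (rule smooth_on_cong[OF _ _ smooth_on_subset[OF U(3)]]) (use U V in auto)
  then show ?thesis using U V unfolding smooth_germ_def by (intro exI[of _ "U \<inter> V"]) auto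
qed

lemma smooth_germ_const: "smooth_germ (\<lambda>x. c)"
  unfolding smooth_germ_def by (intro exI[of _ UNIV]) (auto intro: smooth_on_const)

lemma smooth_germ_linear: "bounded_linear L \<Longrightarrow> smooth_germ L"
  unfolding smooth_germ_def by (intro exI[of _ UNIV]) (auto intro: smooth_on_linear)

lemma smooth_germ_ident: "smooth_germ (\<lambda>x. x)"
  by (intro smooth_germ_linear bounded_linear_ident)

lemma smooth_germ_binop:
  assumes "\<And>U. open U \<Longrightarrow> smooth_on U f \<Longrightarrow> smooth_on U g \<Longrightarrow> smooth_on U h"
    and "smooth_germ f" "smooth_germ g"
  shows "smooth_germ h"
proof -
  obtain U where U: "open U" "0 \<in> U" "smooth_on U f" using assms(2) by (auto simp: smooth_germ_def)
  obtain V where V: "open V" "0 \<in> V" "smooth_on V g" using assms(3) by (auto simp: smooth_germ_def)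
  have "smooth_on (U \<inter> V) h"
    by (rule assms(1)) (use U V smooth_on_subset in \<open>auto intro: smooth_on_subset\<close>)
  then show ?thesis using U V unfolding smooth_germ_def by (intro exI[of _ "U \<inter> V"]) auto
qed

lemma smooth_germ_add: "smooth_germ f \<Longrightarrow> smooth_germ g \<Longrightarrow> smooth_germ (\<lambda>x. f x + g x)"
  by (rule smooth_germ_binop[OF smooth_on_add])

lemma smooth_germ_scaleR: "smooth_germ f \<Longrightarrow> smooth_germ g \<Longrightarrow> smooth_germ (\<lambda>x. f x *\<^sub>R g x)"
  by (rule smooth_germ_binop[OF smooth_on_scaleR])

lemma smooth_germ_mult:
  fixes f g :: "'a::euclidean_space \<Rightarrow> real"
  shows "smooth_germ f \<Longrightarrow> smooth_germ g \<Longrightarrow> smooth_germ (\<lambda>x. f x * g x)"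
  by (rule smooth_germ_binop[OF smooth_on_mult])

lemma smooth_germ_continuous: "smooth_germ f \<Longrightarrow> isCont f 0"
  by (auto simp: smooth_germ_def continuous_on_eq_continuous_at dest: smooth_on_continuous)

lemma smooth_germ_tendsto:
  assumes "smooth_germ f"
  shows "filterlim f (nhds (f 0)) (nhds 0)"
  using smooth_germ_continuous[OF assms] by (simp add: isCont_def tendsto_at_iff_tendsto_nhds)

lemma smooth_germ_compose_on:
  assumes "smooth_on V f" "open V" "g 0 \<in> V" "smooth_germ g"
  shows "smooth_germ (\<lambda>x. f (g x))"
proof -
  obtain U where U: "open U" "0 \<in> U" "smooth_on U g" using assms(4) by (auto simp: smooth_germ_def)
  have op: "open (U \<inter> g -` V)"
    using continuous_open_preimage[OF smooth_on_continuous[OF U(3)] U(1) assms(2)] .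
  have "smooth_on (U \<inter> g -` V) (\<lambda>x. f (g x))"
    by (rule smooth_on_compose[OF op assms(2) _ assms(1) smooth_on_subset[OF U(3)]]) auto
  then show ?thesis using op U assms(3) unfolding smooth_germ_def
    by (intro exI[of _ "U \<inter> g -` V"]) auto
qed

lemma smooth_germ_compose:
  assumes "smooth_germ f" "smooth_germ g" "g 0 = 0"
  shows "smooth_germ (\<lambda>x. f (g x))"
  using assms smooth_germ_compose_on[of _ f g] by (auto simp: smooth_germ_def)

lemma smooth_germ_bounded_linear:
  "bounded_linear L \<Longrightarrow> smooth_germ f \<Longrightarrow> smooth_germ (\<lambda>x. L (f x))"
  using smooth_germ_compose_on[OF smooth_on_linear[OF open_UNIV]] by blast

lemma smooth_germ_minus: "smooth_germ f \<Longrightarrow> smooth_germ (\<lambda>x. - f x)"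
  by (rule smooth_germ_bounded_linear[OF bounded_linear_minus[OF bounded_linear_ident]])

lemma smooth_germ_diff: "smooth_germ f \<Longrightarrow> smooth_germ g \<Longrightarrow> smooth_germ (\<lambda>x. f x - g x)"
  using smooth_germ_add[OF _ smooth_germ_minus, of f g] by simp

lemma smooth_germ_power:
  fixes f :: "'a::euclidean_space \<Rightarrow> real"
  shows "smooth_germ f \<Longrightarrow> smooth_germ (\<lambda>x. f x ^ n)"
  by (induction n) (auto intro: smooth_germ_const smooth_germ_mult)

lemma smooth_germ_fst: "smooth_germ f \<Longrightarrow> smooth_germ (\<lambda>x. fst (f x))"
  by (rule smooth_germ_bounded_linear[OF bounded_linear_fst])

lemma smooth_germ_snd: "smooth_germ f \<Longrightarrow> smooth_germ (\<lambda>x. snd (f x))"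
  by (rule smooth_germ_bounded_linear[OF bounded_linear_snd])

lemma smooth_germ_Pair:
  fixes f :: "'a::euclidean_space \<Rightarrow> 'b::euclidean_space" and g :: "'a \<Rightarrow> 'c::euclidean_space"
  assumes "smooth_germ f" "smooth_germ g"
  shows "smooth_germ (\<lambda>x. (f x, g x))"
proof -
  have "smooth_germ (\<lambda>x. (f x, 0 :: 'c))"
    by (rule smooth_germ_bounded_linear[OF bounded_linear_Pair[OF bounded_linear_ident bounded_linear_zero] assms(1)])
  moreover have "smooth_germ (\<lambda>x. (0 :: 'b, g x))"
    by (rule smooth_germ_bounded_linear[OF bounded_linear_Pair[OF bounded_linear_zero bounded_linear_ident] assms(2)])
  ultimately have "smooth_germ (\<lambda>x. (f x, 0) + (0, g x))"
    by (rule smooth_germ_add)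
  then show ?thesis by simp
qed

lemma smooth_germ_inverse:
  fixes f :: "'a::euclidean_space \<Rightarrow> real"
  shows "smooth_germ f \<Longrightarrow> f 0 \<noteq> 0 \<Longrightarrow> smooth_germ (\<lambda>x. inverse (f x))"
  by (rule smooth_germ_compose_on[OF smooth_on_inverse]) auto

lemma smooth_germ_divide:
  fixes f g :: "'a::euclidean_space \<Rightarrow> real"
  shows "smooth_germ f \<Longrightarrow> smooth_germ g \<Longrightarrow> g 0 \<noteq> 0 \<Longrightarrow> smooth_germ (\<lambda>x. f x / g x)"
  unfolding divide_inverse by (intro smooth_germ_mult smooth_germ_inverse)

lemma smooth_germ_exp:
  fixes f :: "'a::euclidean_space \<Rightarrow> real"
  shows "smooth_germ f \<Longrightarrow> smooth_germ (\<lambda>x. exp (f x))"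
  by (rule smooth_germ_compose_on[OF smooth_on_exp[OF open_UNIV]]) auto

lemma smooth_germ_ln:
  fixes f :: "'a::euclidean_space \<Rightarrow> real"
  shows "smooth_germ f \<Longrightarrow> f 0 > 0 \<Longrightarrow> smooth_germ (\<lambda>x. ln (f x))"
  by (rule smooth_germ_compose_on[OF smooth_on_ln]) auto

lemmas smooth_germ_intros = smooth_germ_const smooth_germ_ident smooth_germ_add smooth_germ_mult
  smooth_germ_minus smooth_germ_diff smooth_germ_power smooth_germ_fst smooth_germ_snd
  smooth_germ_Pair smooth_germ_divide smooth_germ_inverse smooth_germ_exp smooth_germ_ln

lemma smooth_germ_real_ball:
  assumes "smooth_germ (f :: real \<Rightarrow> 'b::euclidean_space)"
  obtains r where "r > 0" "smooth_on (ball 0 r) f"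
  using assms unfolding smooth_germ_def by (metis open_contains_ball smooth_on_subset)

lemma smooth_germ_deriv:
  fixes f :: "real \<Rightarrow> real"
  assumes "smooth_germ f"
  shows "smooth_germ (deriv f)"
    and "eventually (\<lambda>x. (f has_field_derivative deriv f x) (at x)) (nhds 0)"
    and "(f has_field_derivative deriv f 0) (at 0)"
proof -
  obtain U where U: "open U" "0 \<in> U" "smooth_on U f" using assms(1) by (auto simp: smooth_germ_def)
  show "smooth_germ (deriv f)" using smooth_on_deriv(2)[OF U(1,3)] U by (auto simp: smooth_germ_def)
  show "eventually (\<lambda>x. (f has_field_derivative deriv f x) (at x)) (nhds 0)"
    using smooth_on_deriv(1)[OF U(1,3)] U by (auto simp: eventually_nhds)
  show "(f has_field_derivative deriv f 0) (at 0)"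
    using smooth_on_deriv(1)[OF U(1,3,2)] .
qed

lemma smooth_germ_antideriv:
  fixes f :: "real \<Rightarrow> 'a::euclidean_space"
  assumes "smooth_germ f'" "eventually (\<lambda>x. (f has_vector_derivative f' x) (at x)) (nhds 0)"
  shows "smooth_germ f"
proof -
  obtain U where U: "open U" "0 \<in> U" "smooth_on U f'" using assms(1) by (auto simp: smooth_germ_def)
  obtain V where V: "open V" "0 \<in> V" "\<And>x. x \<in> V \<Longrightarrow> (f has_vector_derivative f' x) (at x)"
    using assms(2) by (auto simp: eventually_nhds)
  have "smooth_on (U \<inter> V) f"
    by (rule smooth_on_antideriv[where f' = f']) (use U V in \<open>auto intro: smooth_on_subset\<close>)
  then show ?thesis using U V unfolding smooth_germ_def by (intro exI[of _ "U \<inter> V"]) auto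
qed


section \<open>Diffeomorphism germs and \<open>\<A>\<close>-equivalence\<close>

lemma smooth_on_bounded_linear:
  "open U \<Longrightarrow> bounded_linear L \<Longrightarrow> smooth_on U f \<Longrightarrow> smooth_on U (\<lambda>x. L (f x))"
  by (simp add: smooth_on_def C_times_bounded_linear)

lemma diffeo_germI:
  assumes "f 0 = 0" "open U" "open V" "0 \<in> U" "f ` U = V" "g ` V = U"
    "\<And>x. x \<in> U \<Longrightarrow> g (f x) = x" "\<And>y. y \<in> V \<Longrightarrow> f (g y) = y" "smooth_on U f" "smooth_on V g"
  shows "diffeo_germ f"
  unfolding diffeo_germ_def
  by (intro conjI exI[of _ U] exI[of _ V] exI[of _ g] ballI) (fact assms | simp add: assms(7,8))+

lemma diffeo_germ_ident: "diffeo_germ (\<lambda>x. x)"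
  by (rule diffeo_germI[of _ UNIV UNIV "\<lambda>x. x"])
    (use smooth_on_linear[OF open_UNIV bounded_linear_ident] in simp_all)

text \<open>The inverse function theorem supplies a C^1 local inverse \<open>g\<close>. Smoothness
  is bootstrapped from the fact that the derivative of \<open>g\<close> at \<open>y\<close> is
  \<open>E (g y)\<close>, where \<open>E x\<close> inverts the derivative of \<open>f\<close> at
  \<open>x\<close>. With \<open>E\<close> given as a smooth family, inversion of operators never has
  to be differentiated.\<close>

lemma diffeo_germ_inverse_function:
  fixes f :: "'a::euclidean_space \<Rightarrow> 'a"
  assumes U: "open U" "0 \<in> U" "smooth_on U f" and f0: "f 0 = 0"
    and E: "\<And>v. smooth_on U (\<lambda>x. E x v)" "\<And>x. x \<in> U \<Longrightarrow> linear (E x)"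
      "\<And>x v. x \<in> U \<Longrightarrow> E x (frechet_derivative f (at x) v) = v"
  shows "diffeo_germ f"
proof -
  let ?D = "\<lambda>x. frechet_derivative f (at x)"
  define f' where "f' = (\<lambda>x. Blinfun (?D x))"
  have bl: "bounded_linear (?D x)" if "x \<in> U" for x
    using smooth_on_frechet(1)[OF U(3) that] by (rule has_derivative_bounded_linear)
  have f': "blinfun_apply (f' x) = ?D x" if "x \<in> U" for x
    unfolding f'_def using bl[OF that] by (rule bounded_linear_Blinfun_apply)
  have blE: "bounded_linear (E 0)" using E(2)[OF U(2)] by (simp add: linear_conv_bounded_linear)
  have d: "(f has_derivative blinfun_apply (f' x)) (at x)" if "x \<in> U" for x
    using smooth_on_frechet(1)[OF U(3) that] f'[OF that] by simp
  have cont: "continuous_on U f'"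
  proof (rule continuous_on_blinfun_componentwise)
    fix i :: 'a
    have "continuous_on U (\<lambda>x. ?D x i)"
      by (rule smooth_on_continuous[OF smooth_on_frechet(2)[OF U(3)]])
    then show "continuous_on U (\<lambda>x. blinfun_apply (f' x) i)"
      by (simp add: f' cong: continuous_on_cong)
  qed
  have inv: "Blinfun (E 0) o\<^sub>L f' 0 = id_blinfun"
    by (rule blinfun_eqI) (simp add: bounded_linear_Blinfun_apply[OF blE] f'[OF U(2)] E(3)[OF U(2)])
  from inverse_function_theorem[OF U(1) d cont U(2) inv]
  obtain U' V g g' where g: "open U'" "U' \<subseteq> U" "0 \<in> U'" "open V" "homeomorphism U' V f g"
    "\<And>y. y \<in> V \<Longrightarrow> (g has_derivative (g' y)) (at y)"
    "\<And>y. y \<in> V \<Longrightarrow> g' y = inv (blinfun_apply (f' (g y)))"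
    "\<And>y. y \<in> V \<Longrightarrow> bij (blinfun_apply (f' (g y)))" by metis
  have gV: "g y \<in> U" if "y \<in> V" for y
    using that g(2,5) by (auto simp: homeomorphism_def)
  \<comment> \<open>The theorem describes the derivative of \<open>g\<close> by \<open>inv\<close>;
    the left inverse property of \<open>E\<close> identifies it with \<open>E (g y)\<close>.\<close>
  have dg: "(g has_derivative E (g y)) (at y)" if "y \<in> V" for y
  proof -
    have "g' y w = E (g y) w" for w
    proof -
      have bij: "bij (?D (g y))" using g(8)[OF that] f'[OF gV[OF that]] by simp
      then obtain v where v: "w = ?D (g y) v" by (metis bij_pointE)
      then show ?thesis using g(7)[OF that] f'[OF gV[OF that]] E(3)[OF gV[OF that]] bij
        by (simp add: bij_is_inj)
    qed
    then show ?thesis using g(6)[OF that] by (metis ext)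
  qed
  \<comment> \<open>If \<open>g\<close> is C^n, so is its derivative \<open>E (g y) v\<close>, hence
    \<open>g\<close> is C^(n+1).\<close>
  have "C_times n V g" for n
  proof (induction n)
    case 0
    then show ?case using g(5) by (simp add: homeomorphism_def)
  next
    case (Suc n)
    show ?case
    proof (rule C_times_SucI[OF g(4) dg])
      show "C_times n V (\<lambda>y. E (g y) v)" for v
        by (rule C_times_compose[OF g(4) U(1) _ _ Suc, where f = "\<lambda>x. E x v"])
           (use gV E(1) in \<open>auto simp: smooth_on_def\<close>)
    qed
  qed
  then have sg: "smooth_on V g" by (simp add: smooth_on_def)
  show ?thesis
    by (rule diffeo_germI[OF f0 g(1,4,3) _ _ _ _ smooth_on_subset[OF U(3) g(2)] sg])
       (use g(5) in \<open>auto simp: homeomorphism_def\<close>)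
qed

lemma diffeo_germ_real:
  fixes f :: "real \<Rightarrow> real"
  assumes "smooth_germ f" "f 0 = 0" "deriv f 0 \<noteq> 0"
  shows "diffeo_germ f"
proof -
  obtain U where U: "open U" "0 \<in> U" "smooth_on U f" using assms(1) by (auto simp: smooth_germ_def)
  define W where "W = U \<inter> deriv f -` (- {0})"
  have W: "open W" "0 \<in> W" "W \<subseteq> U"
    using continuous_open_preimage[OF smooth_on_continuous[OF smooth_on_deriv(2)[OF U(1,3)]] U(1), of "-{0}"]
      U assms(3) by (auto simp: W_def)
  have sd: "smooth_on W (deriv f)" by (rule smooth_on_subset[OF smooth_on_deriv(2)[OF U(1,3)] W(3)])
  show ?thesis
  proof (rule diffeo_germ_inverse_function[OF W(1,2) smooth_on_subset[OF U(3) W(3)] assms(2),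
        where E = "\<lambda>x v. inverse (deriv f x) * v"])
    show "smooth_on W (\<lambda>x. inverse (deriv f x) * v)" for v
      by (rule smooth_on_mult[OF W(1) smooth_on_compose[OF W(1) _ _ smooth_on_inverse sd]
          smooth_on_const[OF W(1)]]) (auto simp: W_def)
    show "linear (\<lambda>v. inverse (deriv f x) * v)" for x
      by (simp add: linear_times)
    fix x v assume x: "x \<in> W"
    then have "(f has_derivative (*) (deriv f x)) (at x)"
      using smooth_on_deriv(1)[OF U(1,3)] W(3) unfolding has_field_derivative_def by blast
    from frechet_derivative_at[OF this, symmetric] x
    show "inverse (deriv f x) * frechet_derivative f (at x) v = v" by (simp add: W_def)
  qed
qed

lemma diffeo_germ_plane:
  fixes f :: "real \<times> real \<Rightarrow> real \<times> real"
  assumes "smooth_germ f" "f 0 = 0"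
    and der: "(f has_derivative (\<lambda>v. (a * fst v + b * snd v, c * fst v + d * snd v))) (at 0)"
    and det: "a * d - b * c \<noteq> 0"
  shows "diffeo_germ f"
proof -
  obtain U where U: "open U" "0 \<in> U" "smooth_on U f" using assms(1) by (auto simp: smooth_germ_def)
  let ?D = "\<lambda>x. frechet_derivative f (at x)"
  define p q r s where "p x = fst (?D x (1,0))" and "q x = fst (?D x (0,1))"
    and "r x = snd (?D x (1,0))" and "s x = snd (?D x (0,1))" for x
  note pqrs = p_def q_def r_def s_def
  define \<Delta> where "\<Delta> x = p x * s x + (- 1) * (q x * r x)" for x
  have sm: "smooth_on U p" "smooth_on U q" "smooth_on U r" "smooth_on U s"
    unfolding pqrs
    by (rule smooth_on_bounded_linear[OF U(1) bounded_linear_fst smooth_on_frechet(2)[OF U(3)]]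
        smooth_on_bounded_linear[OF U(1) bounded_linear_snd smooth_on_frechet(2)[OF U(3)]])+
  have s\<Delta>: "smooth_on U \<Delta>"
    unfolding \<Delta>_def by (intro smooth_on_add smooth_on_mult smooth_on_const U sm)
  have \<Delta>0: "\<Delta> 0 \<noteq> 0"
    using det unfolding \<Delta>_def pqrs frechet_derivative_at[OF der, symmetric] by simp
  define W where "W = U \<inter> \<Delta> -` (- {0})"
  have W: "open W" "0 \<in> W" "W \<subseteq> U"
    using continuous_open_preimage[OF smooth_on_continuous[OF s\<Delta>] U(1), of "-{0}"]
      U \<Delta>0 by (auto simp: W_def)
  note smW = sm[THEN smooth_on_subset, OF W(3)] s\<Delta>[THEN smooth_on_subset, OF W(3)]
  have i\<Delta>: "smooth_on W (\<lambda>x. inverse (\<Delta> x))"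
    by (rule smooth_on_compose[OF W(1) _ _ smooth_on_inverse smW(5)]) (auto simp: W_def)
  \<comment> \<open>\<open>E\<close> is Cramer's rule for the Jacobian with rows \<open>p, q\<close>
    and \<open>r, s\<close>; on \<open>W\<close> its determinant \<open>\<Delta>\<close> does not
    vanish.\<close>
  show ?thesis
  proof (rule diffeo_germ_inverse_function[OF W(1,2) smooth_on_subset[OF U(3) W(3)] assms(2),
        where E = "\<lambda>x v. inverse (\<Delta> x) *\<^sub>R ((s x * fst v + (- 1) * (q x * snd v)) *\<^sub>R (1, 0)
          + (p x * snd v + (- 1) * (r x * fst v)) *\<^sub>R (0, 1))"])
    show "smooth_on W (\<lambda>x. inverse (\<Delta> x) *\<^sub>R ((s x * fst v + (- 1) * (q x * snd v)) *\<^sub>R (1, 0)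
          + (p x * snd v + (- 1) * (r x * fst v)) *\<^sub>R (0, 1)))" for v
      by (intro smooth_on_scaleR smooth_on_add smooth_on_mult smooth_on_const smW i\<Delta> W(1))
    show "linear (\<lambda>v. inverse (\<Delta> x) *\<^sub>R ((s x * fst v + (- 1) * (q x * snd v)) *\<^sub>R (1, 0)
          + (p x * snd v + (- 1) * (r x * fst v)) *\<^sub>R (0, 1)))" for x
      by (auto intro!: linearI simp: algebra_simps)
    fix x v assume x: "x \<in> W"
    have "linear (?D x)"
      using smooth_on_frechet(1)[OF U(3), of x] x W(3) by (auto intro: has_derivative_linear)
    then have "?D x (fst v *\<^sub>R (1,0) + snd v *\<^sub>R (0,1)) = fst v *\<^sub>R ?D x (1,0) + snd v *\<^sub>R ?D x (0,1)"
      by (simp only: linear_add linear_cmul)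
    moreover have "fst v *\<^sub>R (1,0) + snd v *\<^sub>R (0,1) = v" by (simp add: prod_eq_iff)
    ultimately have D: "?D x v = (fst v * p x + snd v * q x, fst v * r x + snd v * s x)"
      by (simp add: prod_eq_iff pqrs)
    have "\<Delta> x \<noteq> 0" using x by (simp add: W_def)
    then show "inverse (\<Delta> x) *\<^sub>R ((s x * fst (?D x v) + (- 1) * (q x * snd (?D x v))) *\<^sub>R (1, 0)
          + (p x * snd (?D x v) + (- 1) * (r x * fst (?D x v))) *\<^sub>R (0, 1)) = v"
      unfolding D by (simp add: prod_eq_iff field_simps) (simp add: \<Delta>_def algebra_simps)
  qed
qed

section \<open>Inverses and composites of diffeomorphism germs; \<open>A_equivalent\<close> as an
  equivalence relation\<close>

lemma diffeo_germ_smooth: "diffeo_germ f \<Longrightarrow> smooth_germ f"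
  by (auto simp: diffeo_germ_def smooth_germ_def)

lemma diffeo_germ_zero: "diffeo_germ f \<Longrightarrow> f 0 = 0"
  by (simp add: diffeo_germ_def)

lemma diffeo_germ_inverse:
  assumes "diffeo_germ f"
  obtains g where "diffeo_germ g" "eventually (\<lambda>x. g (f x) = x) (nhds 0)"
    "eventually (\<lambda>x. f (g x) = x) (nhds 0)"
proof -
  obtain U V g where f: "f 0 = 0" "open U" "open V" "0 \<in> U" "f ` U = V" "g ` V = U"
    "\<And>x. x\<in>U \<Longrightarrow> g (f x) = x" "\<And>y. y\<in>V \<Longrightarrow> f (g y) = y" "smooth_on U f" "smooth_on V g"
    using assms unfolding diffeo_germ_def by blast
  have 0: "0 \<in> V" "g 0 = 0" using f(1,4,5,7) by force+
  have "diffeo_germ g"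
    by (rule diffeo_germI[OF 0(2) f(3,2) 0(1) f(6,5) f(8,7,10,9)])
  moreover have "eventually (\<lambda>x. g (f x) = x) (nhds 0)" "eventually (\<lambda>x. f (g x) = x) (nhds 0)"
    using f(2-4,7,8) 0 by (auto simp: eventually_nhds)
  ultimately show ?thesis using that by blast
qed

lemma diffeo_germ_compose:
  assumes "diffeo_germ f" "diffeo_germ h"
  shows "diffeo_germ (\<lambda>x. f (h x))"
proof -
  obtain U V g where f: "f 0 = 0" "open U" "open V" "0 \<in> U" "f ` U = V" "g ` V = U"
    "\<And>x. x\<in>U \<Longrightarrow> g (f x) = x" "\<And>y. y\<in>V \<Longrightarrow> f (g y) = y" "smooth_on U f" "smooth_on V g"
    using assms(1) unfolding diffeo_germ_def by blast
  obtain X Y k where h: "h 0 = 0" "open X" "open Y" "0 \<in> X" "h ` X = Y" "k ` Y = X"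
    "\<And>x. x\<in>X \<Longrightarrow> k (h x) = x" "\<And>y. y\<in>Y \<Longrightarrow> h (k y) = y" "smooth_on X h" "smooth_on Y k"
    using assms(2) unfolding diffeo_germ_def by blast
  have op: "open (X \<inter> h -` U)" "open (V \<inter> g -` Y)"
    using continuous_open_preimage[OF smooth_on_continuous[OF h(9)] h(2) f(2)]
      continuous_open_preimage[OF smooth_on_continuous[OF f(10)] f(3) h(3)] .
  have im: "(\<lambda>x. f (h x)) ` (X \<inter> h -` U) = V \<inter> g -` Y" "(\<lambda>y. k (g y)) ` (V \<inter> g -` Y) = X \<inter> h -` U"
  proof -
    show "(\<lambda>x. f (h x)) ` (X \<inter> h -` U) = V \<inter> g -` Y"
    proof (intro equalityI subsetI)
      fix y assume "y \<in> V \<inter> g -` Y"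
      then have "y = f (h (k (g y)))" "k (g y) \<in> X \<inter> h -` U" using f h by auto
      then show "y \<in> (\<lambda>x. f (h x)) ` (X \<inter> h -` U)" by blast
    qed (use f h in auto)
    show "(\<lambda>y. k (g y)) ` (V \<inter> g -` Y) = X \<inter> h -` U"
    proof (intro equalityI subsetI)
      fix x assume "x \<in> X \<inter> h -` U"
      then have "x = k (g (f (h x)))" "f (h x) \<in> V \<inter> g -` Y" using f h by auto
      then show "x \<in> (\<lambda>y. k (g y)) ` (V \<inter> g -` Y)" by blast
    qed (use f h in auto)
  qed
  have "smooth_on (X \<inter> h -` U) (\<lambda>x. f (h x))"
    by (rule smooth_on_compose[OF op(1) f(2) _ f(9) smooth_on_subset[OF h(9)]]) auto
  moreover have "smooth_on (V \<inter> g -` Y) (\<lambda>x. k (g x))"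
    by (rule smooth_on_compose[OF op(2) h(3) _ h(10) smooth_on_subset[OF f(10)]]) auto
  ultimately show ?thesis
    by (intro diffeo_germI[OF _ op _ im]) (use f(1,4,7,8) h(1,4,7,8) in auto)
qed

lemma diffeo_germ_tendsto: "diffeo_germ f \<Longrightarrow> filterlim f (nhds 0) (nhds 0)"
  using smooth_germ_tendsto[OF diffeo_germ_smooth] diffeo_germ_zero by metis

lemma A_equivalent_sym:
  assumes "A_equivalent f g"
  shows "A_equivalent g f"
proof -
  obtain h \<psi> where *: "smooth_map_germ f" "smooth_map_germ g" "diffeo_germ h" "diffeo_germ \<psi>"
      and eq: "eventually (\<lambda>t. f (h t) = \<psi> (g t)) (nhds 0)"
    using assms unfolding A_equivalent_def by blast
  obtain h' where h': "diffeo_germ h'" "eventually (\<lambda>x. h (h' x) = x) (nhds 0)"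
    using diffeo_germ_inverse[OF *(3)] by blast
  obtain \<psi>' where \<psi>': "diffeo_germ \<psi>'" "eventually (\<lambda>x. \<psi>' (\<psi> x) = x) (nhds 0)"
    using diffeo_germ_inverse[OF *(4)] by blast
  have "filterlim g (nhds 0) (nhds 0)"
    using *(2) smooth_germ_tendsto[of g] by (simp add: smooth_map_germ_def)
  then have "filterlim (\<lambda>t. g (h' t)) (nhds 0) (nhds 0)"
    using diffeo_germ_tendsto[OF h'(1)] filterlim_compose by blast
  from eventually_compose_filterlim[OF \<psi>'(2) this]
    eventually_compose_filterlim[OF eq diffeo_germ_tendsto[OF h'(1)]] h'(2)
  have "eventually (\<lambda>t. g (h' t) = \<psi>' (f t)) (nhds 0)"
    by eventually_elim metis
  then show ?thesis unfolding A_equivalent_def using * h'(1) \<psi>'(1) by blast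
qed

lemma A_equivalent_trans:
  assumes "A_equivalent f g" "A_equivalent g k"
  shows "A_equivalent f k"
proof -
  obtain h \<psi> where *: "smooth_map_germ f" "diffeo_germ h" "diffeo_germ \<psi>"
      and eq: "eventually (\<lambda>t. f (h t) = \<psi> (g t)) (nhds 0)"
    using assms(1) unfolding A_equivalent_def by blast
  obtain h' \<psi>' where **: "smooth_map_germ k" "diffeo_germ h'" "diffeo_germ \<psi>'"
      and eq': "eventually (\<lambda>t. g (h' t) = \<psi>' (k t)) (nhds 0)"
    using assms(2) unfolding A_equivalent_def by blast
  have "eventually (\<lambda>t. f (h (h' t)) = \<psi> (\<psi>' (k t))) (nhds 0)"
    using eventually_compose_filterlim[OF eq diffeo_germ_tendsto[OF **(2)]] eq'
    by eventually_elim simp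
  then show ?thesis unfolding A_equivalent_def
    using *(1) **(1) diffeo_germ_compose[OF *(2) **(2)] diffeo_germ_compose[OF *(3) **(3)] by blast
qed

text \<open>A change of coordinates in the target alone. Smoothness of \<open>g\<close> comes from
  the germ identity, so a reduction has to check it only for its starting curve.\<close>

lemma A_equivalent_left:
  assumes "smooth_map_germ f" "diffeo_germ \<psi>" "eventually (\<lambda>t. g t = \<psi> (f t)) (nhds 0)"
  shows "A_equivalent f g"
proof -
  have f: "smooth_germ f" "f 0 = 0" using assms(1) by (auto simp: smooth_map_germ_def)
  have "smooth_map_germ g"
    unfolding smooth_map_germ_def
  proof
    show "smooth_germ g"
      by (rule smooth_germ_cong[OF smooth_germ_compose[OF diffeo_germ_smooth[OF assms(2)] f]])
         (use assms(3) in eventually_elim, simp)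
    show "g 0 = 0" using eventually_nhds_x_imp_x[OF assms(3)] f(2) diffeo_germ_zero[OF assms(2)] by simp
  qed
  then have "A_equivalent g f"
    unfolding A_equivalent_def using assms diffeo_germ_ident
    by (intro conjI exI[of _ "\<lambda>x. x"] exI[of _ \<psi>]) auto
  then show ?thesis by (rule A_equivalent_sym)
qed

lemma A_equivalent_right:
  assumes "smooth_map_germ f" "diffeo_germ h" "eventually (\<lambda>t. g t = f (h t)) (nhds 0)"
  shows "A_equivalent f g"
proof -
  have f: "smooth_germ f" "f 0 = 0" using assms(1) by (auto simp: smooth_map_germ_def)
  have "smooth_map_germ g"
    unfolding smooth_map_germ_def
  proof
    show "smooth_germ g"
      by (rule smooth_germ_cong[OF smooth_germ_compose[OF f(1) diffeo_germ_smooth[OF assms(2)]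
              diffeo_germ_zero[OF assms(2)]]])
         (use assms(3) in eventually_elim, simp)
    show "g 0 = 0" using eventually_nhds_x_imp_x[OF assms(3)] f(2) diffeo_germ_zero[OF assms(2)] by simp
  qed
  moreover have "eventually (\<lambda>t. f (h t) = g t) (nhds 0)"
    using assms(3) by eventually_elim simp
  ultimately show ?thesis
    unfolding A_equivalent_def using assms diffeo_germ_ident
    by (intro conjI exI[of _ h] exI[of _ "\<lambda>x. x"]) auto
qed

section \<open>Taylor series of smooth germs\<close>

text \<open>Passing to formal series turns identities of germs into algebra in
  \<open>real fps\<close>: it respects sums, products, derivatives and composition of smooth germs,
  and it forgets exactly the flat ones.\<close>

definition taylor :: "(real \<Rightarrow> real) \<Rightarrow> real fps" where
  "taylor f = Abs_fps (\<lambda>n. (deriv ^^ n) f 0 / fact n)"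

lemma taylor_nth: "taylor f $ n = (deriv ^^ n) f 0 / fact n"
  by (simp add: taylor_def)

lemma taylor_0 [simp]: "taylor f $ 0 = f 0"
  by (simp add: taylor_nth)

lemma taylor_1 [simp]: "taylor f $ Suc 0 = deriv f 0"
  by (simp add: taylor_nth)

text \<open>The next derivative at \<open>z\<close> depends on values near \<open>z\<close>, so the
  induction carries equality on a neighbourhood and not only at \<open>z\<close>.\<close>

lemma higher_deriv_ev_cong:
  fixes f g :: "real \<Rightarrow> real"
  assumes "eventually (\<lambda>x. f x = g x) (nhds z)"
  shows "eventually (\<lambda>x. (deriv ^^ n) f x = (deriv ^^ n) g x) (nhds z)"
proof (induction n)
  case (Suc n)
  have "eventually (\<lambda>y. eventually (\<lambda>x. (deriv ^^ n) f x = (deriv ^^ n) g x) (nhds y)) (nhds z)"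
    using Suc by (simp add: eventually_eventually)
  then show ?case by eventually_elim (auto intro: deriv_cong_ev)
qed (use assms in simp)

lemma taylor_cong:
  assumes "eventually (\<lambda>x. f x = g x) (nhds 0)"
  shows "taylor f = taylor g"
  using eventually_nhds_x_imp_x[OF higher_deriv_ev_cong[OF assms]] by (simp add: taylor_def)

lemma taylor_Suc: "taylor f $ Suc n = taylor (deriv f) $ n / Suc n"
  by (simp add: taylor_nth funpow_Suc_right del: funpow.simps)

lemma taylor_deriv: "taylor (deriv f) = fps_deriv (taylor f)"
  by (rule fps_ext) (simp add: taylor_Suc)

lemma deriv_ev_eq:
  fixes f :: "real \<Rightarrow> real"
  assumes "eventually (\<lambda>x. (f has_field_derivative f' x) (at x)) F"
  shows "eventually (\<lambda>x. deriv f x = f' x) F"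
  using assms by eventually_elim (rule DERIV_imp_deriv)

lemma taylor_antideriv:
  assumes "eventually (\<lambda>x. (f has_field_derivative f' x) (at x)) (nhds 0)"
  shows "fps_deriv (taylor f) = taylor f'"
  using taylor_cong[OF deriv_ev_eq[OF assms]] by (simp add: taylor_deriv)

lemma taylor_const [simp]: "taylor (\<lambda>x. c) = fps_const c"
proof -
  have "(deriv ^^ n) (\<lambda>x. 0) = (\<lambda>x. 0 :: real)" for n
    by (induction n) auto
  then have "(deriv ^^ n) (\<lambda>x. c) 0 = (if n = 0 then c else 0)" for n
    by (cases n) (simp_all add: funpow_Suc_right del: funpow.simps)
  then show ?thesis by (intro fps_ext) (simp add: taylor_nth)
qed

lemma taylor_ident [simp]: "taylor (\<lambda>x. x) = fps_X"
proof (rule fps_ext)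
  fix n
  have "deriv (\<lambda>x::real. x) = (\<lambda>x. 1)" by auto
  then show "taylor (\<lambda>x. x) $ n = fps_X $ n"
    by (cases n) (simp_all add: taylor_Suc)
qed

lemma taylor_add:
  assumes "smooth_germ f" "smooth_germ g"
  shows "taylor (\<lambda>x. f x + g x) = taylor f + taylor g"
proof (rule fps_ext)
  fix n
  show "taylor (\<lambda>x. f x + g x) $ n = (taylor f + taylor g) $ n"
    using assms
  proof (induction n arbitrary: f g)
    case (Suc n)
    have "eventually (\<lambda>x. ((\<lambda>x. f x + g x) has_field_derivative deriv f x + deriv g x) (at x)) (nhds 0)"
      using smooth_germ_deriv(2)[OF Suc.prems(1)] smooth_germ_deriv(2)[OF Suc.prems(2)]
      by eventually_elim (rule DERIV_add)
    from taylor_cong[OF deriv_ev_eq[OF this]] Suc show ?case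
      by (simp add: taylor_Suc smooth_germ_deriv(1) add_divide_distrib)
  qed simp
qed

lemma taylor_mult:
  assumes "smooth_germ f" "smooth_germ g"
  shows "taylor (\<lambda>x. f x * g x) = taylor f * taylor g"
proof (rule fps_ext)
  fix n
  show "taylor (\<lambda>x. f x * g x) $ n = (taylor f * taylor g) $ n"
    using assms
  proof (induction n arbitrary: f g)
    case (Suc n)
    have "eventually (\<lambda>x. ((\<lambda>x. f x * g x) has_field_derivative deriv f x * g x + f x * deriv g x) (at x)) (nhds 0)"
      using smooth_germ_deriv(2)[OF Suc.prems(1)] smooth_germ_deriv(2)[OF Suc.prems(2)]
      by eventually_elim (rule DERIV_cong[OF DERIV_mult], auto)
    from taylor_cong[OF deriv_ev_eq[OF this]] Suc
    have "taylor (deriv (\<lambda>x. f x * g x)) $ n = (taylor (deriv f) * taylor g + taylor f * taylor (deriv g)) $ n"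
      by (simp add: taylor_add smooth_germ_deriv(1) smooth_germ_mult)
    also have "\<dots> = fps_deriv (taylor f * taylor g) $ n"
      by (simp add: taylor_deriv add.commute)
    finally show ?case by (simp add: taylor_Suc del: fps_deriv_mult)
  qed simp
qed

lemma taylor_cmult: "smooth_germ f \<Longrightarrow> taylor (\<lambda>x. c * f x) = fps_const c * taylor f"
  by (simp add: taylor_mult smooth_germ_const)

lemma taylor_minus: "smooth_germ f \<Longrightarrow> taylor (\<lambda>x. - f x) = - taylor f"
  using taylor_cmult[of f "- 1"] by (simp add: fps_const_neg[symmetric] del: fps_const_neg)

lemma taylor_diff:
  "smooth_germ f \<Longrightarrow> smooth_germ g \<Longrightarrow> taylor (\<lambda>x. f x - g x) = taylor f - taylor g"
  using taylor_add[OF _ smooth_germ_minus, of f g] by (simp add: taylor_minus)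

lemma taylor_power: "smooth_germ f \<Longrightarrow> taylor (\<lambda>x. f x ^ n) = taylor f ^ n"
  by (induction n) (simp_all add: taylor_mult smooth_germ_power)

lemma smooth_germ_sum:
  "(\<And>i. i \<in> I \<Longrightarrow> smooth_germ (f i)) \<Longrightarrow> smooth_germ (\<lambda>x. \<Sum>i\<in>I. f i x)"
  by (induction I rule: infinite_finite_induct) (auto intro: smooth_germ_const smooth_germ_add)

lemma taylor_sum:
  "(\<And>i. i \<in> I \<Longrightarrow> smooth_germ (f i)) \<Longrightarrow> taylor (\<lambda>x. \<Sum>i\<in>I. f i x) = (\<Sum>i\<in>I. taylor (f i))"
  by (induction I rule: infinite_finite_induct) (auto simp: taylor_add smooth_germ_sum)

subsection \<open>Division by powers of the variable\<close>

text \<open>Hadamard's lemma: the difference quotient equals the integral of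
  \<open>deriv f (s * \<tau>)\<close> over \<tau> in [0,1]. Integrals of
  \<open>\<tau> ^ j * F (s * \<tau>)\<close> with smooth \<open>F\<close> are closed under
  differentiation in \<open>s\<close>, which gives smoothness also at 0.\<close>

lemma smooth_quotient_on:
  assumes "r > 0" "smooth_on (ball 0 r) f"
  obtains g :: "real \<Rightarrow> real" where "smooth_on (ball 0 r) g" "\<And>t. f t = f 0 + t * g t"
proof -
  define g where "g t = (if t = 0 then deriv f 0 else (f t - f 0) / t)" for t
  define P where "P h \<longleftrightarrow> (\<exists>j F. smooth_on (ball 0 r) F \<and>
      h = (\<lambda>s. integral (cbox 0 1) (\<lambda>\<tau>::real. \<tau> ^ j * F (s * \<tau>))))" for h :: "real \<Rightarrow> real"
  have in_ball: "s * \<tau> \<in> ball 0 r" if "s \<in> ball 0 r" "\<tau> \<in> cbox 0 1" for s \<tau> :: real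
  proof -
    have "\<bar>s * \<tau>\<bar> \<le> \<bar>s\<bar> * 1" unfolding abs_mult by (rule mult_left_mono) (use that in auto)
    then show ?thesis using that by auto
  qed
  have cont: "continuous_on (ball 0 r \<times> cbox 0 1) (\<lambda>(s, \<tau>). \<tau> ^ j * F (s * \<tau>))"
    if "smooth_on (ball 0 r) F" for F :: "real \<Rightarrow> real" and j
    unfolding case_prod_beta
    by (intro continuous_intros continuous_on_compose2[OF smooth_on_continuous[OF that]])
       (use in_ball in auto)
  have "smooth_on (ball 0 r) (\<lambda>s. integral (cbox 0 1) (\<lambda>\<tau>::real. \<tau> ^ 0 * deriv f (s * \<tau>)))"
  proof (rule smooth_on_coinduct[where P = P])
    show "P (\<lambda>s. integral (cbox 0 1) (\<lambda>\<tau>. \<tau> ^ 0 * deriv f (s * \<tau>)))"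
      unfolding P_def using smooth_on_deriv(2)[OF open_ball assms(2)] by blast
    fix h assume "P h"
    then obtain j F where F: "smooth_on (ball 0 r) F"
      and h: "h = (\<lambda>s. integral (cbox 0 1) (\<lambda>\<tau>::real. \<tau> ^ j * F (s * \<tau>)))"
      unfolding P_def by blast
    have F': "smooth_on (ball 0 r) (deriv F)" by (rule smooth_on_deriv(2)[OF open_ball F])
    have "(h has_field_derivative integral (cbox 0 1) (\<lambda>\<tau>. \<tau> ^ Suc j * deriv F (s * \<tau>))) (at s)"
      if s: "s \<in> ball 0 r" for s
    proof -
      have "(h has_field_derivative integral (cbox 0 1) (\<lambda>\<tau>. \<tau> ^ Suc j * deriv F (s * \<tau>))) (at s within ball 0 r)"
        unfolding h
      proof (rule leibniz_rule_field_derivative[where fx = "\<lambda>s \<tau>. \<tau> ^ Suc j * deriv F (s * \<tau>)"])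
        fix x t :: real assume xt: "x \<in> ball 0 r" "t \<in> cbox 0 1"
        have "((\<lambda>x. F (x * t)) has_field_derivative deriv F (x * t) * t) (at x)"
          by (rule DERIV_chain2[where f = F and g = "\<lambda>x. x * t" and x = x, OF smooth_on_deriv(1)[OF open_ball F in_ball[OF xt]]])
             (auto intro!: derivative_eq_intros)
        then have "((\<lambda>x. t ^ j * F (x * t)) has_field_derivative t ^ j * (deriv F (x * t) * t)) (at x)"
          by (rule DERIV_cmult)
        then show "((\<lambda>x. t ^ j * F (x * t)) has_field_derivative t ^ Suc j * deriv F (x * t)) (at x within ball 0 r)"
          by (simp add: algebra_simps has_field_derivative_at_within)
      next
        fix x :: real assume x: "x \<in> ball 0 r"
        have "continuous_on (cbox 0 1) (\<lambda>\<tau>. \<tau> ^ j * F (x * \<tau>))"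
          by (rule continuous_on_compose2[OF cont[OF F], of _ "\<lambda>\<tau>. (x, \<tau>)", simplified])
             (use x in \<open>auto intro!: continuous_intros\<close>)
        then show "(\<lambda>\<tau>. \<tau> ^ j * F (x * \<tau>)) integrable_on cbox 0 1"
          by (rule integrable_continuous)
      next
        show "continuous_on (ball 0 r \<times> cbox 0 1) (\<lambda>(s, \<tau>). \<tau> ^ Suc j * deriv F (s * \<tau>))"
          by (rule cont[OF F'])
      qed (use s in auto)
      then show ?thesis using at_within_open[OF s open_ball] by simp
    qed
    then show "\<exists>f'. P f' \<and> (\<forall>x\<in>ball 0 r. (h has_field_derivative f' x) (at x))"
      using F' unfolding P_def by blast
  qed auto
  then have "smooth_on (ball 0 r) g"
  proof (rule smooth_on_cong[OF open_ball, rotated])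
    fix s :: real assume s: "s \<in> ball 0 r"
    have "((\<lambda>\<tau>. s * deriv f (s * \<tau>)) has_integral f (s * 1) - f (s * 0)) {0..1}"
    proof (rule fundamental_theorem_of_calculus)
      fix \<tau> :: real assume \<tau>: "\<tau> \<in> {0..1}"
      have "((\<lambda>\<tau>. f (s * \<tau>)) has_field_derivative deriv f (s * \<tau>) * s) (at \<tau>)"
        by (rule DERIV_chain2[where f = f and g = "\<lambda>\<tau>. s * \<tau>" and x = \<tau>, OF smooth_on_deriv(1)[OF open_ball assms(2) in_ball[OF s]]])
           (use \<tau> in \<open>auto intro!: derivative_eq_intros\<close>)
      then show "((\<lambda>\<tau>. f (s * \<tau>)) has_vector_derivative s * deriv f (s * \<tau>)) (at \<tau> within {0..1})"
        by (simp add: has_real_derivative_iff_has_vector_derivative mult.commute has_vector_derivative_at_within)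
    qed auto
    then have "s * integral {0..1} (\<lambda>\<tau>. deriv f (s * \<tau>)) = f s - f 0"
      by (simp add: has_integral_iff)
    then show "integral (cbox 0 1) (\<lambda>\<tau>. \<tau> ^ 0 * deriv f (s * \<tau>)) = g s"
      by (cases "s = 0") (simp_all add: g_def field_simps)
  qed
  moreover have "f t = f 0 + t * g t" for t by (simp add: g_def)
  ultimately show ?thesis using that by blast
qed

lemma smooth_ball_germ: "r > 0 \<Longrightarrow> smooth_on (ball 0 r) f \<Longrightarrow> smooth_germ f"
  by (auto simp: smooth_germ_def intro!: exI[of _ "ball 0 r"])

lemma taylor_X_mult: "smooth_germ g \<Longrightarrow> taylor (\<lambda>t. t * g t) = fps_X * taylor g"
  by (simp add: taylor_mult smooth_germ_ident)

lemma taylor_X_power_mult: "smooth_germ g \<Longrightarrow> taylor (\<lambda>t. t ^ n * g t) = fps_X ^ n * taylor g"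
  by (simp add: taylor_mult smooth_germ_power smooth_germ_ident taylor_power)

text \<open>The ball stays the same because functions of the cube root are differentiated again and
  again on one interval, each time with a division by t^2.\<close>

lemma smooth_factor_on:
  assumes "r > 0" "smooth_on (ball 0 r) f" "\<And>i. i < n \<Longrightarrow> taylor f $ i = 0"
  obtains g :: "real \<Rightarrow> real" where "smooth_on (ball 0 r) g" "\<And>t. f t = t ^ n * g t"
    "\<And>i. taylor g $ i = taylor f $ (i + n)"
proof -
  have "\<exists>g :: real \<Rightarrow> real. smooth_on (ball 0 r) g \<and> (\<forall>t. f t = t ^ n * g t) \<and> (\<forall>i. taylor g $ i = taylor f $ (i + n))"
    using assms(3)
  proof (induction n)
    case 0
    then show ?case using assms(2) by auto
  next
    case (Suc n)
    then obtain g where g: "smooth_on (ball 0 r) g" "\<And>t. f t = t ^ n * g t"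
      "\<And>i. taylor g $ i = taylor f $ (i + n)" by force
    obtain k where k: "smooth_on (ball 0 r) k" "\<And>t. g t = g 0 + t * k t"
      using smooth_quotient_on[OF assms(1) g(1)] by blast
    have "g 0 = 0" using g(3)[of 0] Suc.prems[of n] by simp
    with k(2) have gk: "g = (\<lambda>t. t * k t)" by auto
    have "taylor k $ i = taylor f $ (i + Suc n)" for i
      using g(3)[of "Suc i"] taylor_X_mult[OF smooth_ball_germ[OF assms(1) k(1)]] by (simp add: gk)
    moreover have "f t = t ^ Suc n * k t" for t using g(2)[of t] gk by simp
    ultimately show ?case using k(1) by blast
  qed
  then show ?thesis using that by blast
qed

lemma smooth_factor:
  assumes "smooth_germ f" "\<And>i. i < n \<Longrightarrow> taylor f $ i = 0"
  obtains g :: "real \<Rightarrow> real" where "smooth_germ g" "\<And>t. f t = t ^ n * g t"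
    "\<And>i. taylor g $ i = taylor f $ (i + n)"
proof -
  obtain r where r: "r > 0" "smooth_on (ball 0 r) f" using smooth_germ_real_ball[OF assms(1)] by blast
  show ?thesis using smooth_factor_on[OF r assms(2)] smooth_ball_germ[OF r(1)] that by metis
qed

lemma taylor_expansion:
  assumes "smooth_germ f"
  obtains R :: "real \<Rightarrow> real" where "smooth_germ R" "\<And>t. f t = (\<Sum>i<n. taylor f $ i * t ^ i) + t ^ n * R t"
proof -
  let ?p = "\<lambda>t. \<Sum>i<n. taylor f $ i * t ^ i"
  have sp: "smooth_germ ?p" by (intro smooth_germ_sum smooth_germ_intros)
  have "taylor ?p = (\<Sum>i<n. fps_const (taylor f $ i) * fps_X ^ i)"
    by (simp add: taylor_sum smooth_germ_intros taylor_cmult taylor_power)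
  then have tp: "taylor ?p $ j = taylor f $ j" if "j < n" for j
    using that by (simp add: fps_sum_nth if_distrib cong: if_cong)
  obtain R where "smooth_germ R" "\<And>t. f t - ?p t = t ^ n * R t"
    by (rule smooth_factor[of "\<lambda>t. f t - ?p t" n])
       (use assms sp tp in \<open>auto simp: taylor_diff smooth_germ_diff\<close>)
  then show ?thesis using that[of R] by (metis add.commute diff_add_cancel)
qed

text \<open>The coefficient at \<open>j\<close> needs only the polynomial part of \<open>f\<close>
  up to degree \<open>j\<close>: since \<open>g 0 = 0\<close>, the remainder becomes divisible by
  X^(j+1) after substitution.\<close>

lemma taylor_compose:
  assumes "smooth_germ f" "smooth_germ g" "g 0 = 0"
  shows "taylor (\<lambda>t. f (g t)) = taylor f oo taylor g"
proof (rule fps_ext)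
  fix j
  obtain R where R: "smooth_germ R" "\<And>t. f t = (\<Sum>i<Suc j. taylor f $ i * t ^ i) + t ^ Suc j * R t"
    using taylor_expansion[OF assms(1)] by blast
  have sR: "smooth_germ (\<lambda>t. R (g t))" by (rule smooth_germ_compose[OF R(1) assms(2,3)])
  have "taylor (\<lambda>t. f (g t)) = taylor (\<lambda>t. (\<Sum>i<Suc j. taylor f $ i * g t ^ i) + g t ^ Suc j * R (g t))"
    by (subst R(2)) (rule refl)
  also have "\<dots> = (\<Sum>i<Suc j. fps_const (taylor f $ i) * taylor g ^ i) + taylor g ^ Suc j * taylor (\<lambda>t. R (g t))"
    by (subst taylor_add taylor_sum taylor_mult taylor_power taylor_cmult;
        (intro smooth_germ_sum smooth_germ_intros assms sR)?)+ simp
  finally have *: "taylor (\<lambda>t. f (g t)) = \<dots>" .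
  have "taylor g ^ Suc j = fps_X ^ Suc j * (fps_shift 1 (taylor g)) ^ Suc j"
  proof -
    have "taylor g = fps_X * fps_shift 1 (taylor g)"
      by (rule fps_ext) (auto simp: assms(3))
    then show ?thesis by (metis power_mult_distrib)
  qed
  then have "(taylor g ^ Suc j * taylor (\<lambda>t. R (g t))) $ j = 0"
    by (simp only: mult.assoc fps_X_power_mult_nth) simp
  then show "taylor (\<lambda>t. f (g t)) $ j = (taylor f oo taylor g) $ j"
    unfolding * by (simp add: fps_sum_nth fps_compose_nth lessThan_Suc_atMost atLeast0AtMost del: power_Suc sum.lessThan_Suc)
qed

text \<open>Once the coefficients below \<open>i\<close> vanish, \<open>f t = t ^ i * g t\<close>,
  and the bound forces \<open>g\<close> to tend to 0 because \<open>i < r\<close>. The limit is the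
  coefficient at \<open>i\<close>.\<close>

lemma taylor_bigo:
  assumes "smooth_germ f" "eventually (\<lambda>t. \<bar>f t\<bar> \<le> K * \<bar>t\<bar> ^ r) (nhds 0)" "i < r"
  shows "taylor f $ i = 0"
  using assms(3)
proof (induction i rule: less_induct)
  case (less i)
  obtain g where g: "smooth_germ g" "\<And>t. f t = t ^ i * g t" "\<And>j. taylor g $ j = taylor f $ (j + i)"
    by (rule smooth_factor[OF assms(1), of i]) (use less in auto)
  have "eventually (\<lambda>t. norm (g t) \<le> K * \<bar>t\<bar> ^ (r - i)) (at 0)"
    using assms(2)[THEN filter_leD[OF at_within_le_nhds], of UNIV]
      eventually_neq_at_within[of 0 0 UNIV]
  proof eventually_elim
    case (elim t)
    then have "\<bar>t\<bar> ^ i * \<bar>g t\<bar> \<le> \<bar>t\<bar> ^ i * (K * \<bar>t\<bar> ^ (r - i))"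
      using less.prems by (simp add: g(2) abs_mult power_abs mult.left_commute power_add[symmetric])
    then show ?case using elim by simp
  qed
  moreover have "((\<lambda>t::real. K * \<bar>t\<bar> ^ (r - i)) \<longlongrightarrow> K * \<bar>0\<bar> ^ (r - i)) (at 0)"
    by (intro tendsto_intros)
  ultimately have "(g \<longlongrightarrow> 0) (at 0)"
    using less.prems Lim_null_comparison[of g "\<lambda>t. K * \<bar>t\<bar> ^ (r - i)" "at 0"] by (simp add: power_0_left)
  moreover have "(g \<longlongrightarrow> g 0) (at 0)"
    using smooth_germ_continuous[OF g(1)] by (simp add: isCont_def)
  ultimately have "g 0 = 0" using LIM_unique by blast
  then show ?case using g(3)[of 0] by simp
qed

subsection \<open>Smooth functions of the cube\<close>

text \<open>The derivative of \<open>g(x\<^sup>1\<^sup>/\<^sup>3)\<close> is \<open>G(x\<^sup>1\<^sup>/\<^sup>3)\<close> with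
  \<open>G(t) = g'(t)/(3t\<^sup>2)\<close>, and \<open>G\<close> satisfies the same hypothesis as \<open>g\<close>.\<close>

lemma smooth_on_cube_root:
  assumes "r > 0" "smooth_on (ball 0 r) g" "\<And>n. \<not> 3 dvd n \<Longrightarrow> taylor g $ n = 0"
  shows "smooth_on (ball 0 (r ^ 3)) (\<lambda>x. g (root 3 x))"
proof (rule smooth_on_coinduct[where P = "\<lambda>h. \<exists>g. smooth_on (ball 0 r) g \<and>
    (\<forall>n. \<not> 3 dvd n \<longrightarrow> taylor g $ n = 0) \<and> h = (\<lambda>x. g (root 3 x))"])
  fix h :: "real \<Rightarrow> real"
  assume "\<exists>g. smooth_on (ball 0 r) g \<and> (\<forall>n. \<not> 3 dvd n \<longrightarrow> taylor g $ n = 0) \<and> h = (\<lambda>x. g (root 3 x))"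
  then obtain g where g: "smooth_on (ball 0 r) g" "\<And>n. \<not> 3 dvd n \<Longrightarrow> taylor g $ n = 0"
    and h: "h = (\<lambda>x. g (root 3 x))" by blast
  have g': "smooth_on (ball 0 r) (deriv g)" by (rule smooth_on_deriv(2)[OF open_ball g(1)])
  have dvd: "3 dvd Suc i \<longleftrightarrow> i mod 3 = 2" "3 dvd i \<longleftrightarrow> i mod 3 = 0" for i :: nat by presburger+
  have tg': "taylor (deriv g) $ n = 0" if "\<not> 3 dvd Suc n" for n
    using g(2)[OF that] by (simp add: taylor_deriv)
  obtain G where G: "smooth_on (ball 0 r) G" "\<And>t. deriv g t = t ^ 2 * G t"
    "\<And>i. taylor G $ i = taylor (deriv g) $ (i + 2)"
    by (rule smooth_factor_on[OF assms(1) g', of 2]) (use tg' in \<open>auto simp: dvd\<close>)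
  \<comment> \<open>At 0 the root is not differentiable and the chain rule breaks down. There the
    difference quotient of \<open>h\<close> is \<open>k (root 3 y)\<close> with the \<open>k\<close>
    introduced next, and its limit \<open>k 0\<close> agrees with the expected value
    \<open>G 0 / 3\<close>.\<close>
  have tG: "taylor G $ n = 0" if "\<not> 3 dvd n" for n
    unfolding G(3) by (rule tg') (use that in presburger)
  obtain k where k: "smooth_germ k" "\<And>t. g t - g 0 = t ^ 3 * k t"
    "\<And>i. taylor k $ i = taylor (\<lambda>t. g t - g 0) $ (i + 3)"
    by (rule smooth_factor[of "\<lambda>t. g t - g 0" 3])
       (use smooth_ball_germ[OF assms(1) g(1)] g(2) in
         \<open>auto simp: taylor_diff smooth_germ_const smooth_germ_diff dvd\<close>)
  have k0: "k 0 = G 0 / 3"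
    using k(3)[of 0] G(3)[of 0] smooth_ball_germ[OF assms(1) g(1)]
    by (simp add: taylor_diff smooth_germ_const taylor_deriv eval_nat_numeral)
  have root_pow: "root 3 x ^ 3 = x" for x by (simp add: odd_real_root_pow)
  have root_ball: "root 3 x \<in> ball 0 r" if "x \<in> ball 0 (r ^ 3)" for x
  proof (rule ccontr)
    assume "root 3 x \<notin> ball 0 r"
    then have "r ^ 3 \<le> \<bar>root 3 x\<bar> ^ 3" using assms(1) by (intro power_mono) auto
    then show False using that root_pow[of x] by (simp add: power_abs[symmetric])
  qed
  have "(h has_field_derivative G (root 3 x) / 3) (at x)" if x: "x \<in> ball 0 (r ^ 3)" for x
  proof (cases "x = 0")
    case False
    have "(h has_field_derivative deriv g (root 3 x) * inverse (real 3 * root 3 x ^ (3 - Suc 0))) (at x)"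
      unfolding h
      by (rule DERIV_chain2[where f = g and g = "root 3" and x = x, OF smooth_on_deriv(1)[OF open_ball g(1) root_ball[OF x]] DERIV_odd_real_root])
         (use False in auto)
    then show ?thesis using False by (simp add: G(2) field_simps eval_nat_numeral)
  next
    case True
    have "((\<lambda>y. k (root 3 y)) \<longlongrightarrow> k (root 3 0)) (at 0)"
      using isCont_o2[OF isCont_real_root[of 0 3], of k] smooth_germ_continuous[OF k(1)]
      by (simp add: isCont_def)
    moreover have "(h y - h 0) / (y - 0) = k (root 3 y)" if "y \<noteq> 0" for y
      using k(2)[of "root 3 y"] that by (simp add: h root_pow)
    ultimately have "((\<lambda>y. (h y - h 0) / (y - 0)) \<longlongrightarrow> k 0) (at 0)"
      by (subst tendsto_cong[of _ "\<lambda>y. k (root 3 y)"]) (auto simp: eventually_at_filter)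
    then show ?thesis using True k0 by (simp add: has_field_derivative_iff)
  qed
  moreover have "smooth_on (ball 0 r) (\<lambda>t. (1/3) * G t)"
    by (intro smooth_on_mult smooth_on_const G(1) open_ball)
  moreover have "taylor (\<lambda>t. (1/3) * G t) $ n = 0" if "\<not> 3 dvd n" for n
    using tG[OF that] by (subst taylor_cmult[OF smooth_ball_germ[OF assms(1) G(1)]]) simp
  ultimately show "\<exists>f'. (\<exists>g. smooth_on (ball 0 r) g \<and> (\<forall>n. \<not> 3 dvd n \<longrightarrow> taylor g $ n = 0) \<and>
      f' = (\<lambda>x. g (root 3 x))) \<and> (\<forall>x\<in>ball 0 (r ^ 3). (h has_field_derivative f' x) (at x))"
    by (intro exI[of _ "\<lambda>x. (1/3) * G (root 3 x)"] conjI exI[of _ "\<lambda>x. (1/3) * G x"]) auto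
qed (use assms in auto)

lemma taylor_cube:
  assumes "smooth_germ a"
  shows "smooth_germ (\<lambda>t. a (t ^ 3))"
    "taylor (\<lambda>t. a (t ^ 3)) $ n = (if 3 dvd n then taylor a $ (n div 3) else 0)"
proof -
  have s: "smooth_germ (\<lambda>t::real. t ^ 3)" by (intro smooth_germ_intros)
  show "smooth_germ (\<lambda>t. a (t ^ 3))" by (rule smooth_germ_compose[OF assms s]) simp
  have "taylor (\<lambda>t. a (t ^ 3)) = taylor a oo fps_X ^ 3"
    using taylor_compose[OF assms s] by (simp add: taylor_power smooth_germ_ident)
  then have "taylor (\<lambda>t. a (t ^ 3)) $ n = (\<Sum>i = 0..n. if n = 3 * i then taylor a $ i else 0)"
    by (simp add: fps_compose_nth power_mult[symmetric] if_distrib cong: if_cong)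
  also have "\<dots> = (if 3 dvd n then taylor a $ (n div 3) else 0)"
  proof (cases "3 dvd n")
    case True
    then obtain m where m: "n = 3 * m" by auto
    have "(\<Sum>i = 0..n. if n = 3 * i then taylor a $ i else 0) = (\<Sum>i = 0..n. if i = m then taylor a $ i else 0)"
      by (rule sum.cong) (auto simp: m)
    then show ?thesis by (simp add: m)
  qed (auto intro!: sum.neutral)
  finally show "taylor (\<lambda>t. a (t ^ 3)) $ n = (if 3 dvd n then taylor a $ (n div 3) else 0)" .
qed

lemma smooth_germ_of_cube:
  assumes "smooth_germ g" "\<And>n. \<not> 3 dvd n \<Longrightarrow> taylor g $ n = 0"
  obtains a :: "real \<Rightarrow> real" where "smooth_germ a" "\<And>t. g t = a (t ^ 3)"
    "\<And>n. taylor a $ n = taylor g $ (3 * n)"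
proof -
  obtain r where r: "r > 0" "smooth_on (ball 0 r) g" using smooth_germ_real_ball[OF assms(1)] by blast
  define a where "a x = g (root 3 x)" for x
  have a: "smooth_germ a"
    unfolding a_def by (rule smooth_ball_germ[OF _ smooth_on_cube_root[OF r assms(2)]]) (use r in auto)
  have ga: "g = (\<lambda>t. a (t ^ 3))" by (auto simp: a_def odd_real_root_power_cancel)
  have "taylor a $ n = taylor g $ (3 * n)" for n
    using taylor_cube(2)[OF a, of "3 * n"] by (simp add: ga)
  then show ?thesis using that a ga by metis
qed

subsection \<open>Borel's theorem\<close>

lemma smooth_UNIV_deriv:
  fixes f :: "real \<Rightarrow> real"
  assumes "smooth_on UNIV f"
  shows "smooth_on UNIV ((deriv ^^ n) f)"
    and "((deriv ^^ n) f has_field_derivative (deriv ^^ Suc n) f x) (at x)"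
proof -
  show *: "smooth_on UNIV ((deriv ^^ n) f)" for n
    by (induction n) (use assms smooth_on_deriv(2)[OF open_UNIV] in auto)
  show "((deriv ^^ n) f has_field_derivative (deriv ^^ Suc n) f x) (at x)"
    using smooth_on_deriv(1)[OF open_UNIV *, of x n] by simp
qed

lemma higher_deriv_eqI:
  fixes D :: "nat \<Rightarrow> real \<Rightarrow> real"
  assumes "\<And>n x. (D n has_field_derivative D (Suc n) x) (at x)"
  shows "(deriv ^^ n) (D 0) = D n"
proof (induction n)
  case (Suc n)
  then show ?case using DERIV_imp_deriv[OF assms[of n]] by auto
qed simp

lemma smooth_on_UNIV_seqI:
  fixes D :: "nat \<Rightarrow> real \<Rightarrow> real"
  assumes "\<And>n x. (D n has_field_derivative D (Suc n) x) (at x)"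
  shows "smooth_on UNIV (D 0)"
  by (rule smooth_on_coinduct[where P = "\<lambda>f. \<exists>n. f = D n"]) (use assms in blast)+

text \<open>A bound over the whole line survives the substitution of L x for x, up to the factor L^k
  in the k-th derivative; this makes rescaled powers of \<open>sin\<close> usable without localising
  them.\<close>

definition bounded_derivs :: "(real \<Rightarrow> real) \<Rightarrow> bool" where
  "bounded_derivs f \<longleftrightarrow> smooth_on UNIV f \<and> (\<forall>k. \<exists>M. \<forall>x. \<bar>(deriv ^^ k) f x\<bar> \<le> M)"

lemma higher_deriv_add_UNIV:
  fixes f g :: "real \<Rightarrow> real"
  assumes "smooth_on UNIV f" "smooth_on UNIV g"
  shows "(deriv ^^ n) (\<lambda>x. f x + g x) = (\<lambda>x. (deriv ^^ n) f x + (deriv ^^ n) g x)"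
  using higher_deriv_eqI[of "\<lambda>n x. (deriv ^^ n) f x + (deriv ^^ n) g x" n]
    DERIV_add[OF smooth_UNIV_deriv(2)[OF assms(1)] smooth_UNIV_deriv(2)[OF assms(2)]]
  by simp

lemma bounded_derivs_deriv: "bounded_derivs f \<Longrightarrow> bounded_derivs (deriv f)"
  unfolding bounded_derivs_def
  by (auto intro: smooth_on_deriv(2)[OF open_UNIV])
     (metis comp_apply funpow_Suc_right)

lemma bounded_derivs_mult:
  assumes "bounded_derivs f" "bounded_derivs g"
  shows "bounded_derivs (\<lambda>x. f x * g x)"
proof -
  have "\<exists>M. \<forall>x. \<bar>(deriv ^^ k) (\<lambda>x. f x * g x) x\<bar> \<le> M" for k
    using assms
  proof (induction k arbitrary: f g)
    case 0
    obtain A where A: "\<And>x. \<bar>f x\<bar> \<le> A"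
      using 0(1) unfolding bounded_derivs_def by (metis funpow_0)
    obtain B where B: "\<And>x. \<bar>g x\<bar> \<le> B"
      using 0(2) unfolding bounded_derivs_def by (metis funpow_0)
    have "\<bar>f x * g x\<bar> \<le> A * B" for x
      unfolding abs_mult using A B abs_ge_zero order_trans by (intro mult_mono) blast+
    then show ?case by auto
  next
    case (Suc k)
    have sf: "smooth_on UNIV f" "smooth_on UNIV g"
      using Suc.prems by (auto simp: bounded_derivs_def)
    note sd = smooth_on_deriv[OF open_UNIV sf(1)] smooth_on_deriv[OF open_UNIV sf(2)]
    have "((\<lambda>x. f x * g x) has_field_derivative deriv f x * g x + f x * deriv g x) (at x)" for x
      by (rule DERIV_cong[OF DERIV_mult[OF sd(1) sd(3)]]) auto
    then have "deriv (\<lambda>x. f x * g x) = (\<lambda>x. deriv f x * g x + f x * deriv g x)"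
      using DERIV_imp_deriv by blast
    then have eq: "(deriv ^^ Suc k) (\<lambda>x. f x * g x) =
      (\<lambda>x. (deriv ^^ k) (\<lambda>x. deriv f x * g x) x + (deriv ^^ k) (\<lambda>x. f x * deriv g x) x)"
      by (simp add: funpow_Suc_right higher_deriv_add_UNIV smooth_on_mult sf sd del: funpow.simps)
    obtain A where A: "\<And>x. \<bar>(deriv ^^ k) (\<lambda>x. deriv f x * g x) x\<bar> \<le> A"
      using Suc.IH[OF bounded_derivs_deriv[OF Suc.prems(1)] Suc.prems(2)] by blast
    obtain B where B: "\<And>x. \<bar>(deriv ^^ k) (\<lambda>x. f x * deriv g x) x\<bar> \<le> B"
      using Suc.IH[OF Suc.prems(1) bounded_derivs_deriv[OF Suc.prems(2)]] by blast
    show ?case unfolding eq using A B abs_triangle_ineq add_mono order_trans by meson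
  qed
  then show ?thesis
    using assms by (auto simp: bounded_derivs_def smooth_on_mult)
qed

lemma bounded_derivs_sin: "bounded_derivs sin"
proof -
  define D where "D n x = sin (x + real n * (pi / 2))" for n :: nat and x :: real
  have D: "(D n has_field_derivative D (Suc n) x) (at x)" for n x
  proof -
    have shift: "sin (y + pi / 2) = cos y" for y :: real by (simp add: sin_add)
    have eq: "x + real (Suc n) * (pi / 2) = (x + real n * (pi / 2)) + pi / 2"
      by (simp add: algebra_simps)
    have "D (Suc n) x = cos (x + real n * (pi / 2))"
      unfolding D_def eq by (rule shift)
    then show ?thesis unfolding D_def by (auto intro!: derivative_eq_intros)
  qed
  have "sin = D 0" by (auto simp: D_def)
  moreover have "\<bar>D n x\<bar> \<le> 1" for n x by (simp add: D_def)
  ultimately show ?thesis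
    unfolding bounded_derivs_def using higher_deriv_eqI[of D, OF D] smooth_on_UNIV_seqI[of D, OF D] by metis
qed

lemma bounded_derivs_sin_power: "bounded_derivs (\<lambda>x. sin x ^ n)"
proof (induction n)
  case 0
  have "(deriv ^^ k) (\<lambda>x::real. 1) x = (if k = 0 then 1 else 0)" for k x
    using higher_deriv_eqI[of "\<lambda>k x::real. if k = 0 then 1 else 0" k] by simp
  then have "\<bar>(deriv ^^ k) (\<lambda>x::real. 1) x\<bar> \<le> 1" for k x by simp
  then show ?case
    unfolding bounded_derivs_def by (auto intro: smooth_on_const)
next
  case (Suc n)
  then show ?case using bounded_derivs_mult[OF bounded_derivs_sin] by simp
qed

text \<open>The term is \<open>c (sin(Lx)/L)\<^sup>n\<close> with \<open>L\<close> large. It needs no bump function; the price is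
  that it also has Taylor coefficients beyond \<open>n\<close>, which the later terms of the series correct.\<close>

lemma borel_term:
  obtains u :: "real \<Rightarrow> real" where "smooth_on UNIV u" "\<And>i. i < n \<Longrightarrow> taylor u $ i = 0"
    "taylor u $ n = c" "\<And>k x. k < n \<Longrightarrow> \<bar>(deriv ^^ k) u x\<bar> \<le> (1/2) ^ n"
proof -
  let ?h = "\<lambda>x::real. sin x ^ n"
  have h: "smooth_on UNIV ?h" using bounded_derivs_sin_power by (auto simp: bounded_derivs_def)
  obtain M where M: "\<And>k x. \<bar>(deriv ^^ k) ?h x\<bar> \<le> M k"
    using bounded_derivs_sin_power unfolding bounded_derivs_def by metis
  have M0: "M k \<ge> 0" for k using order_trans[OF abs_ge_zero M] .
  \<comment> \<open>For k < n the k-th derivative is at most |c| M(k) / L, since at least one factor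
    L remains in the denominator. \<open>L\<close> is large enough to bring this below (1/2)^n for
    all these k at once.\<close>
  define L where "L = 1 + \<bar>c\<bar> * 2 ^ n * (\<Sum>k<n. M k)"
  have L1: "L \<ge> 1" unfolding L_def using M0 by (simp add: sum_nonneg)
  define D where "D k x = (c / L ^ n) * (L ^ k * (deriv ^^ k) ?h (L * x))" for k x
  have D: "(D k has_field_derivative D (Suc k) x) (at x)" for k x
  proof -
    have "((\<lambda>x. (deriv ^^ k) ?h (L * x)) has_field_derivative (deriv ^^ Suc k) ?h (L * x) * L) (at x)"
      by (rule DERIV_chain2[where f = "(deriv ^^ k) ?h" and g = "\<lambda>x. L * x" and x = x,
            OF smooth_UNIV_deriv(2)[OF h]])
         (auto intro!: derivative_eq_intros)
    from DERIV_cmult[OF DERIV_cmult[OF this, of "L ^ k"], of "c / L ^ n"]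
    show ?thesis unfolding D_def by (simp add: mult_ac)
  qed
  have Dk: "(deriv ^^ k) (D 0) = D k" for k by (rule higher_deriv_eqI[of D, OF D])
  have sD: "smooth_on UNIV (D 0)" by (rule smooth_on_UNIV_seqI[of D, OF D])
  have sg: "smooth_germ (sin :: real \<Rightarrow> real)" unfolding smooth_germ_def
    by (intro exI[of _ UNIV]) (auto intro: smooth_on_sin)
  have dsin: "deriv sin 0 = (1 :: real)" using DERIV_imp_deriv[OF DERIV_sin[of 0]] by simp
  have th: "taylor ?h $ i = (if i = n then 1 else 0)" if "i \<le> n" for i
  proof -
    have "taylor ?h = taylor sin ^ n" using taylor_power[OF sg] .
    moreover have "taylor sin $ 0 = 0" by simp
    ultimately show ?thesis
      using startsby_zero_power_prefix[of "taylor sin" n] startsby_zero_power_nth_same[of "taylor sin" n] that dsin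
      by (auto simp: le_less)
  qed
  have tD: "taylor (D 0) $ i = (c / L ^ n) * (L ^ i * taylor ?h $ i)" for i
    by (simp add: taylor_nth Dk D_def)
  show ?thesis
  proof (rule that[of "D 0"])
    show "smooth_on UNIV (D 0)" by (rule sD)
    show "taylor (D 0) $ i = 0" if "i < n" for i using that by (simp add: tD th)
    show "taylor (D 0) $ n = c" using L1 by (simp add: tD th)
    fix k x assume k: "k < n"
    have "\<bar>(deriv ^^ k) (D 0) x\<bar> = (\<bar>c\<bar> / L ^ n) * (L ^ k * \<bar>(deriv ^^ k) ?h (L * x)\<bar>)"
      using L1 by (simp add: Dk D_def abs_mult)
    also have "\<dots> \<le> (\<bar>c\<bar> / L ^ n) * (L ^ (n - 1) * M k)"
    proof (rule mult_left_mono)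
      have "L ^ k \<le> L ^ (n - 1)" by (rule power_increasing) (use k L1 in auto)
      then show "L ^ k * \<bar>(deriv ^^ k) ?h (L * x)\<bar> \<le> L ^ (n - 1) * M k"
        by (rule mult_mono[OF _ M]) (use L1 in auto)
    qed (use L1 in simp)
    also have "\<dots> = \<bar>c\<bar> * M k / L"
    proof -
      have "L ^ n = L * L ^ (n - 1)" using k by (cases n) auto
      then show ?thesis using L1 by simp
    qed
    also have "\<dots> \<le> (1/2) ^ n"
    proof -
      have "M k \<le> (\<Sum>k<n. M k)" using k M0 by (intro member_le_sum) auto
      then have "\<bar>c\<bar> * 2 ^ n * M k \<le> L" unfolding L_def
        by (smt (verit) mult_left_mono abs_ge_zero zero_le_power mult_nonneg_nonneg)
      then show ?thesis using L1 by (simp add: field_simps power_one_over)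
    qed
    finally show "\<bar>(deriv ^^ k) (D 0) x\<bar> \<le> (1/2) ^ n" .
  qed
qed

theorem borel:
  fixes a :: "real fps"
  obtains f :: "real \<Rightarrow> real" where "smooth_on UNIV f" "taylor f = a"
proof -
  have "\<forall>n c. \<exists>u :: real \<Rightarrow> real. smooth_on UNIV u \<and> (\<forall>i<n. taylor u $ i = 0) \<and>
      taylor u $ n = c \<and> (\<forall>k<n. \<forall>x. \<bar>(deriv ^^ k) u x\<bar> \<le> (1/2) ^ n)"
    using borel_term by metis
  then obtain U :: "nat \<Rightarrow> real \<Rightarrow> real \<Rightarrow> real" where U: "\<And>n c. smooth_on UNIV (U n c)"
    "\<And>n c i. i < n \<Longrightarrow> taylor (U n c) $ i = 0" "\<And>n c. taylor (U n c) $ n = c"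
    "\<And>n c k x. k < n \<Longrightarrow> \<bar>(deriv ^^ k) (U n c) x\<bar> \<le> (1/2) ^ n" by metis
  \<comment> \<open>\<open>s n\<close> is the sum of the first \<open>n\<close> terms. The next term
    supplies the coefficient still missing at \<open>n\<close> after the earlier ones; all later
    terms have coefficient 0 there.\<close>
  define s where "s = rec_nat (\<lambda>x::real. 0::real) (\<lambda>n s x. s x + U n (a $ n - taylor s $ n) x)"
  define u where "u n = U n (a $ n - taylor (s n) $ n)" for n
  have s_Suc: "s 0 = (\<lambda>x. 0)" "s (Suc n) = (\<lambda>x. s n x + u n x)" for n
    by (simp_all add: s_def u_def)
  have su: "smooth_on UNIV (u n)" for n unfolding u_def by (rule U)
  have ss: "smooth_on UNIV (s n)" for n
    by (induction n) (simp_all add: s_Suc smooth_on_const smooth_on_add su)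
  have germ: "smooth_on UNIV f \<Longrightarrow> smooth_germ f" for f :: "real \<Rightarrow> real"
    by (auto simp: smooth_germ_def intro!: exI[of _ UNIV])
  have ts: "taylor (s (Suc n)) $ n = a $ n" for n
  proof -
    have "taylor (u n) $ n = a $ n - taylor (s n) $ n" by (simp add: u_def U(3))
    then show ?thesis by (simp add: s_Suc taylor_add germ ss su)
  qed
  have ts_sum: "taylor (s n) $ k = (\<Sum>m<n. taylor (u m) $ k)" for n k
    by (induction n) (simp_all add: s_Suc taylor_add germ ss su)
  have ubound: "\<bar>(deriv ^^ k) (u n) x\<bar> \<le> (1/2) ^ n" if "k < n" for n k x
    unfolding u_def using U(4)[OF that] .
  define D where "D k x = (\<Sum>n. (deriv ^^ k) (u n) x)" for k x
  have ev: "eventually (\<lambda>n. k < n) sequentially" for k :: nat by (rule eventually_gt_at_top)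
  \<comment> \<open>Differentiation term by term. For each order of derivative the bound (1/2)^n
    holds only from some \<open>n\<close> on, hence the eventual versions of the comparison
    tests.\<close>
  have D: "(D k has_field_derivative D (Suc k) x) (at x)" for k x
    unfolding D_def
  proof (rule has_field_derivative_series'(2)[where S = UNIV and ?x0.0 = 0])
    show "((deriv ^^ k) (u n) has_field_derivative (deriv ^^ Suc k) (u n) x) (at x within UNIV)" for n x
      using smooth_UNIV_deriv(2)[OF su] by simp
    have "uniform_limit UNIV (\<lambda>n x. \<Sum>i<n. (deriv ^^ Suc k) (u i) x) (\<lambda>x. \<Sum>i. (deriv ^^ Suc k) (u i) x) sequentially"
    proof (rule Weierstrass_m_test_ev)
      show "eventually (\<lambda>n. \<forall>x\<in>UNIV. norm ((deriv ^^ Suc k) (u n) x) \<le> (1/2) ^ n) sequentially"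
        using ev[of "Suc k"] by eventually_elim (use ubound in \<open>auto simp del: funpow.simps\<close>)
    qed (simp add: summable_geometric)
    then show "uniformly_convergent_on UNIV (\<lambda>n x. \<Sum>i<n. (deriv ^^ Suc k) (u i) x)"
      by (rule uniformly_convergentI)
    show "summable (\<lambda>n. (deriv ^^ k) (u n) 0)"
    proof (rule summable_comparison_test_ev)
      show "eventually (\<lambda>n. norm ((deriv ^^ k) (u n) 0) \<le> (1/2) ^ n) sequentially"
        using ev[of k] by eventually_elim (use ubound in auto)
    qed (simp add: summable_geometric)
  qed auto
  have "taylor (D 0) $ k = a $ k" for k
  proof -
    have "(deriv ^^ k) (u n) 0 = 0" if "n \<notin> {..<Suc k}" for n
      using U(2)[of k n] that by (auto simp: u_def taylor_nth)
    then have "D k 0 = (\<Sum>n<Suc k. (deriv ^^ k) (u n) 0)"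
      unfolding D_def by (intro suminf_finite) auto
    then have "taylor (D 0) $ k = (\<Sum>n<Suc k. taylor (u n) $ k)"
      by (simp add: taylor_nth higher_deriv_eqI[of D, OF D] sum_divide_distrib del: sum.lessThan_Suc)
    also have "\<dots> = a $ k" using ts_sum[of "Suc k" k] ts by simp
    finally show ?thesis .
  qed
  then have "taylor (D 0) = a" by (simp add: fps_eq_iff)
  then show ?thesis using that smooth_on_UNIV_seqI[of D, OF D] by blast
qed

section \<open>Residue classes modulo 3 and the splitting of a smooth germ\<close>

lemma double_mod_3:
  fixes m :: nat
  assumes "m mod 3 \<noteq> 0"
  shows "2 * m mod 3 \<noteq> 0" "m mod 3 \<noteq> 2 * m mod 3"
proof -
  have "m mod 3 = 1 \<or> m mod 3 = 2" using assms by presburger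
  moreover have "2 * m mod 3 = 2 * (m mod 3) mod 3" by (simp only: mod_mult_right_eq)
  ultimately show "2 * m mod 3 \<noteq> 0" "m mod 3 \<noteq> 2 * m mod 3" by auto
qed

lemma same_mod_3:
  fixes i n :: nat
  assumes "i mod 3 = n mod 3" "i \<le> n"
  obtains j where "n = i + 3 * j"
proof -
  have "3 dvd n - i" using assms mod_eq_dvd_iff_nat[of i n 3] by simp
  then obtain j where "n - i = 3 * j" by (rule dvdE)
  then have "n = i + 3 * j" using assms(2) by simp
  then show ?thesis by (rule that)
qed

lemma mod_3_cases:
  fixes m n :: nat
  assumes "m mod 3 \<noteq> 0"
  shows "n mod 3 = 0 \<or> n mod 3 = m mod 3 \<or> n mod 3 = 2 * m mod 3"
proof -
  have "m mod 3 = 1 \<or> m mod 3 = 2" using assms by presburger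
  moreover have "n mod 3 = 0 \<or> n mod 3 = 1 \<or> n mod 3 = 2" by presburger
  moreover have "2 * m mod 3 = 2 * (m mod 3) mod 3" by (simp only: mod_mult_right_eq)
  ultimately show ?thesis by auto
qed

text \<open>This replaces the Malgrange preparation theorem for the map \<open>t \<mapsto> t\<^sup>3\<close>.\<close>

lemma cubic_decomposition:
  fixes Y :: "real \<Rightarrow> real"
  assumes Y: "smooth_germ Y" and mods: "q mod 3 \<noteq> 0" "N mod 3 = 2 * q mod 3"
    and q: "\<And>i. i mod 3 = q mod 3 \<Longrightarrow> i < q \<Longrightarrow> taylor Y $ i = 0"
    and N: "\<And>i. i mod 3 = N mod 3 \<Longrightarrow> i < N \<Longrightarrow> taylor Y $ i = 0"
  obtains a b c where "smooth_germ a" "smooth_germ b" "smooth_germ c"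
    "\<And>t. Y t = a (t ^ 3) + t ^ q * b (t ^ 3) + t ^ N * c (t ^ 3)"
    "\<And>n. taylor a $ n = taylor Y $ (3 * n)" "b 0 = taylor Y $ q" "c 0 = taylor Y $ N"
proof -
  have cls: "\<exists>b. smooth_germ b \<and> smooth_germ (\<lambda>t. t ^ r * b (t ^ 3)) \<and> b 0 = taylor Y $ r \<and>
      (\<forall>n. taylor (\<lambda>t. t ^ r * b (t ^ 3)) $ n = (if n mod 3 = r mod 3 then taylor Y $ n else 0))"
    if r: "\<And>i. i mod 3 = r mod 3 \<Longrightarrow> i < r \<Longrightarrow> taylor Y $ i = 0" for r
  proof -
    \<comment> \<open>\<open>f\<close> realises the part of the series of \<open>Y\<close> in the
      class of \<open>r\<close>. After division by t^r only exponents divisible by 3 are left, so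
      the quotient is exactly a function of t^3.\<close>
    obtain f where f: "smooth_on UNIV f" "taylor f = Abs_fps (\<lambda>n. if n mod 3 = r mod 3 then taylor Y $ n else 0)"
      using borel by blast
    have sf: "smooth_germ f" using f(1) by (auto simp: smooth_germ_def intro!: exI[of _ UNIV])
    obtain g where g: "smooth_germ g" "\<And>t. f t = t ^ r * g t" "\<And>i. taylor g $ i = taylor f $ (i + r)"
      by (rule smooth_factor[OF sf, of r]) (use f(2) r in auto)
    have "taylor g $ n = 0" if "\<not> 3 dvd n" for n
    proof -
      have "(n + r) mod 3 \<noteq> r mod 3"
        using that by (metis mod_eq_dvd_iff_nat le_add2 add_diff_cancel_right')
      then show ?thesis by (simp add: g(3) f(2))
    qed
    then obtain b where b: "smooth_germ b" "\<And>t. g t = b (t ^ 3)" "\<And>n. taylor b $ n = taylor g $ (3 * n)"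
      using smooth_germ_of_cube[OF g(1)] by blast
    have "f = (\<lambda>t. t ^ r * b (t ^ 3))" using g(2) b(2) by auto
    then show ?thesis using b(1) sf f(2) b(3)[of 0] g(3)[of 0] by (intro exI[of _ b]) auto
  qed
  obtain b where b: "smooth_germ b" "smooth_germ (\<lambda>t. t ^ q * b (t ^ 3))" "b 0 = taylor Y $ q"
    "\<And>n. taylor (\<lambda>t. t ^ q * b (t ^ 3)) $ n = (if n mod 3 = q mod 3 then taylor Y $ n else 0)"
    using cls[of q] q by blast
  obtain c where c: "smooth_germ c" "smooth_germ (\<lambda>t. t ^ N * c (t ^ 3))" "c 0 = taylor Y $ N"
    "\<And>n. taylor (\<lambda>t. t ^ N * c (t ^ 3)) $ n = (if n mod 3 = N mod 3 then taylor Y $ n else 0)"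
    using cls[of N] N by blast
  \<comment> \<open>Only exponents divisible by 3 remain in the series of \<open>?A\<close>, and it
    also absorbs the flat difference between \<open>Y\<close> and the realised parts. Being smooth
    with such a series, it is exactly \<open>a (t ^ 3)\<close>.\<close>
  let ?A = "\<lambda>t. Y t - t ^ q * b (t ^ 3) - t ^ N * c (t ^ 3)"
  have sA: "smooth_germ ?A" by (intro smooth_germ_diff Y b c)
  have tA: "taylor ?A $ n = taylor Y $ n - (if n mod 3 = q mod 3 then taylor Y $ n else 0)
      - (if n mod 3 = N mod 3 then taylor Y $ n else 0)" for n
    by (simp add: taylor_diff smooth_germ_diff Y b c)
  have qN: "q mod 3 \<noteq> N mod 3" "N mod 3 \<noteq> 0"
    using double_mod_3[OF mods(1)] mods(2) by simp_all
  have "taylor ?A $ n = 0" if "\<not> 3 dvd n" for n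
  proof -
    have "n mod 3 = q mod 3 \<or> n mod 3 = N mod 3"
      using mod_3_cases[OF mods(1), of n] that mods(2) by (simp add: dvd_eq_mod_eq_0)
    then show ?thesis using qN unfolding tA by auto
  qed
  then obtain a where a: "smooth_germ a" "\<And>t. ?A t = a (t ^ 3)" "\<And>n. taylor a $ n = taylor ?A $ (3 * n)"
    using smooth_germ_of_cube[OF sA] by blast
  have "taylor a $ n = taylor Y $ (3 * n)" for n
    using mods(1) qN(2) unfolding a(3) tA by auto
  moreover have "Y t = a (t ^ 3) + t ^ q * b (t ^ 3) + t ^ N * c (t ^ 3)" for t
    using a(2)[of t] by simp
  ultimately show ?thesis using that a(1) b(1,3) c(1,3) by blast
qed

section \<open>Power series with gaps modulo 3\<close>

text \<open>\<open>m\<close> and \<open>M\<close> are lower bounds for the indices of nonzero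
  coefficients in the two nonzero classes. Doubling swaps these classes, so both residues of
  \<open>m\<close> are treated alike. \<open>M \<le> 2 * m\<close> makes the gaps stable under
  products, as two terms of index \<open>m\<close> produce one of index 2m.\<close>

locale cubic_gap =
  fixes m M :: nat
  assumes m_mod: "m mod 3 \<noteq> 0" and M_mod: "M mod 3 = 2 * m mod 3" and m_less: "m < M" and M_le: "M \<le> 2 * m"
begin

text \<open>The indices at which coefficients of a series with gaps vanish, and the indices at which
  taking the coefficient is a derivation on such series.\<close>

definition forced :: "nat \<Rightarrow> bool" where
  "forced n \<longleftrightarrow> n mod 3 = m mod 3 \<and> n < m \<or> n mod 3 = M mod 3 \<and> n < M"

definition adm :: "nat \<Rightarrow> bool" where
  "adm l \<longleftrightarrow> l mod 3 = m mod 3 \<and> l \<le> m \<or> l mod 3 = M mod 3 \<and> l \<le> M \<and> l < 2 * m"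

definition gap :: "real fps \<Rightarrow> bool" where
  "gap F \<longleftrightarrow> (\<forall>n. forced n \<longrightarrow> F $ n = 0)"

lemma mods: "m mod 3 = 1 \<and> M mod 3 = 2 \<or> m mod 3 = 2 \<and> M mod 3 = 1"
proof -
  have "m mod 3 = 1 \<or> m mod 3 = 2" using m_mod by presburger
  moreover have "M mod 3 = 2 * (m mod 3) mod 3" using M_mod by (simp add: mod_mult_right_eq)
  ultimately show ?thesis by auto
qed

lemma gapD: "gap F \<Longrightarrow> forced n \<Longrightarrow> F $ n = 0"
  by (simp add: gap_def)

lemma forced_adm: "forced n \<Longrightarrow> adm n"
  using M_le by (auto simp: forced_def adm_def)

lemma adm_pos:
  assumes "adm l"
  shows "0 < l"
proof (rule gr0I)
  assume "l = 0"
  then show False using assms mods by (auto simp: adm_def)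
qed

text \<open>If both summands lie in the class of \<open>m\<close>, their sum is below 2m, so one of
  them is below \<open>m\<close>. In every other case a summand in a nonzero class is smaller than
  the sum and thereby stays below the bound of its own class.\<close>

lemma adm_sum:
  assumes "adm (i + j)" "0 < i" "0 < j"
  shows "forced i \<or> forced j"
proof -
  have pos: "i < i + j" "j < i + j" using assms(2,3) by simp_all
  have zero: "(i + j) mod 3 = j mod 3" if "i mod 3 = 0"
    using mod_add_left_eq[of i 3 j] that by simp
  have one: "j mod 3 = m mod 3" if "i mod 3 = m mod 3" "(i + j) mod 3 = M mod 3"
  proof -
    have "i mod 3 = 1 \<Longrightarrow> (i + j) mod 3 = 2 \<Longrightarrow> j mod 3 = 1"
      "i mod 3 = 2 \<Longrightarrow> (i + j) mod 3 = 1 \<Longrightarrow> j mod 3 = 2" by presburger+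
    then show ?thesis using mods that by metis
  qed
  have "i mod 3 = 0 \<or> i mod 3 = 1 \<or> i mod 3 = 2" by presburger
  then consider "i mod 3 = 0" | "i mod 3 = m mod 3" | "i mod 3 = M mod 3" using mods by metis
  then show ?thesis
  proof cases
    case 1
    then have "forced j"
      using assms(1) zero less_le_trans[OF pos(2)] unfolding adm_def forced_def by metis
    then show ?thesis ..
  next
    case 2
    have "i + j < 2 * m \<Longrightarrow> i < m \<or> j < m" by linarith
    then show ?thesis
      using assms(1) one 2 less_le_trans[OF pos(1)] unfolding adm_def forced_def by metis
  next
    case 3
    then have "forced i"
      using assms(1) less_le_trans[OF pos(1)] m_less less_trans unfolding adm_def forced_def by metis
    then show ?thesis ..
  qed
qed

text \<open>By \<open>adm_sum\<close> each inner term of the Cauchy product has a vanishing factor,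
  so only the two end terms remain.\<close>

lemma gap_mult_nth:
  assumes "gap F" "gap G" "adm l"
  shows "(F * G) $ l = F $ 0 * G $ l + F $ l * G $ 0"
proof -
  have z: "F $ i * G $ (l - i) = 0" if "0 < i" "i < l" for i
    using adm_sum[of i "l - i"] that assms gapD by fastforce
  have "(F * G) $ l = (\<Sum>i\<in>{0, l}. F $ i * G $ (l - i))"
    unfolding fps_mult_nth
  proof (rule sum.mono_neutral_right)
    show "\<forall>i\<in>{0..l} - {0, l}. F $ i * G $ (l - i) = 0"
    proof
      fix i assume "i \<in> {0..l} - {0, l}"
      then have "0 < i" "i < l" by auto
      then show "F $ i * G $ (l - i) = 0" by (rule z)
    qed
  qed auto
  then show ?thesis using adm_pos[OF assms(3)] by simp
qed

lemma gap_const: "gap (fps_const c)"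
  using adm_pos forced_adm by (fastforce simp: gap_def)

lemma gap_mult: "gap F \<Longrightarrow> gap G \<Longrightarrow> gap (F * G)"
  unfolding gap_def[of "F * G"] by (simp add: gap_mult_nth forced_adm gapD)

lemma gap_power: "gap F \<Longrightarrow> gap (F ^ n)"
  using gap_const[of 1] by (induction n) (simp_all add: gap_mult)

text \<open>As \<open>G\<close> has no constant term, the derivation rule kills its powers from the
  second on; only the linear term of \<open>F\<close> is seen.\<close>

lemma gap_compose_nth:
  assumes "gap G" "G $ 0 = 0" "adm l"
  shows "(F oo G) $ l = F $ 1 * G $ l"
proof -
  have pow: "(G ^ i) $ l = 0" if "i \<noteq> 1" for i
  proof (cases "i < 2")
    case True
    then show ?thesis using that adm_pos[OF assms(3)] by (cases i) auto
  next
    case False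
    then obtain j where j: "i = Suc (Suc j)" by (metis add_2_eq_Suc le_add_diff_inverse not_less)
    have "(G * G ^ Suc j) $ l = 0"
      by (subst gap_mult_nth[OF assms(1) gap_power[OF assms(1)] assms(3)]) (simp add: assms(2))
    then show ?thesis by (simp add: j)
  qed
  have "(F oo G) $ l = (\<Sum>i\<in>{0..l}. if i = 1 then F $ 1 * G $ l else 0)"
    unfolding fps_compose_nth by (rule sum.cong) (auto simp: pow)
  then show ?thesis using adm_pos[OF assms(3)] by simp
qed

lemma gap_compose: "gap G \<Longrightarrow> G $ 0 = 0 \<Longrightarrow> gap (F oo G)"
  unfolding gap_def[of "F oo G"] by (simp add: gap_compose_nth forced_adm gapD)

text \<open>\<open>fps_X * U\<close> has coefficient 1 at X and so in general violates
  \<open>gap\<close>, which rules out \<open>gap_compose_nth\<close>. Instead each term V_i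
  (U^i)_(l-i) with 0 < i < l vanishes by \<open>adm_sum\<close>: either \<open>i\<close> is forced
  and induction gives V_i = 0, or l - i is forced. The gaps are assumed of the composite because in
  the application \<open>V\<close> is known only through it.\<close>

lemma gap_reparam:
  assumes U: "gap U" "U $ 0 = 1" and H: "gap (V oo (fps_X * U))" and "adm l"
  shows "V $ l = (V oo (fps_X * U)) $ l"
  using assms(4)
proof (induction l rule: less_induct)
  case (less l)
  let ?H = "V oo (fps_X * U)"
  have z: "V $ i * (U ^ i) $ (l - i) = 0" if i: "i < l" for i
  proof (cases "i = 0")
    case True
    then show ?thesis using i by simp
  next
    case False
    then have "forced i \<or> forced (l - i)"
      using adm_sum[of i "l - i"] i less.prems by simp
    then show ?thesis
    proof
      assume f: "forced i"
      then show ?thesis using less.IH[OF i forced_adm[OF f]] gapD[OF H f] by simp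
    next
      assume "forced (l - i)"
      then show ?thesis using gapD[OF gap_power[OF U(1)]] by simp
    qed
  qed
  have "?H $ l = (\<Sum>i=0..l. V $ i * (U ^ i) $ (l - i))"
    unfolding fps_compose_nth
    by (rule sum.cong) (auto simp: power_mult_distrib fps_X_power_mult_nth)
  also have "\<dots> = (\<Sum>i\<in>{l}. V $ i * (U ^ i) $ (l - i))"
  proof (rule sum.mono_neutral_right)
    show "\<forall>i\<in>{0..l} - {l}. V $ i * (U ^ i) $ (l - i) = 0"
    proof
      fix i assume "i \<in> {0..l} - {l}"
      then have "i < l" by auto
      then show "V $ i * (U ^ i) $ (l - i) = 0" by (rule z)
    qed
  qed auto
  finally show ?case using U(2) by (simp add: fps_power_zeroth_eq_one)
qed

end

section \<open>The curve \<open>\<phi>\<^sub>3\<close>\<close>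

lemma interval_integral_germ:
  fixes f :: "real \<Rightarrow> 'a::euclidean_space"
  assumes "smooth_germ f"
  shows "eventually (\<lambda>s. ((\<lambda>s. LBINT u=0..s. f u) has_vector_derivative f s) (at s)) (nhds 0)"
    and "smooth_germ (\<lambda>s. LBINT u=0..s. f u)"
proof -
  obtain r where r: "r > 0" "smooth_on (ball 0 r) f" using smooth_germ_real_ball[OF assms] by blast
  have "((\<lambda>s. LBINT u=0..s. f u) has_vector_derivative f s) (at s)" if "s \<in> ball 0 (r/2)" for s
  proof -
    have c: "continuous_on {-(r/2)..r/2} f"
      by (rule continuous_on_subset[OF smooth_on_continuous[OF r(2)]]) (use r(1) in auto)
    have "((\<lambda>s. LBINT u=ereal 0..s. f u) has_vector_derivative f s) (at s within {-(r/2)..r/2})"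
      by (rule interval_integral_FTC2[OF _ _ c]) (use that r(1) in auto)
    moreover have "at s within {-(r/2)..r/2} = at s"
      by (rule at_within_Icc_at) (use that in \<open>auto simp: dist_real_def\<close>)
    ultimately show ?thesis by (simp only: zero_ereal_def)
  qed
  then show *: "eventually (\<lambda>s. ((\<lambda>s. LBINT u=0..s. f u) has_vector_derivative f s) (at s)) (nhds 0)"
    using r(1) by (auto simp: eventually_nhds intro!: exI[of _ "ball 0 (r/2)"])
  show "smooth_germ (\<lambda>s. LBINT u=0..s. f u)"
    by (rule smooth_germ_antideriv[OF assms *])
qed

lemma taylor_theta: "taylor (theta \<kappa>) $ n = theta_coeff \<kappa> n / fact n"
  by (simp add: taylor_nth theta_coeff_def)

lemma theta_smooth:
  assumes "smooth_germ \<kappa>"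
  shows "smooth_germ (theta \<kappa>)" "theta \<kappa> 0 = 0"
proof -
  have eq: "theta \<kappa> = (\<lambda>s. LBINT u=0..s. \<kappa> u)" by (auto simp: theta_def)
  show "smooth_germ (theta \<kappa>)" unfolding eq by (rule interval_integral_germ(2)[OF assms])
  show "theta \<kappa> 0 = 0" by (simp add: theta_def flip: zero_ereal_def)
qed

lemma smooth_germ_sin:
  fixes f :: "'a::euclidean_space \<Rightarrow> real"
  shows "smooth_germ f \<Longrightarrow> smooth_germ (\<lambda>x. sin (f x))"
  by (rule smooth_germ_compose_on[OF smooth_on_sin[OF open_UNIV]]) auto

lemma smooth_germ_cos:
  fixes f :: "'a::euclidean_space \<Rightarrow> real"
  shows "smooth_germ f \<Longrightarrow> smooth_germ (\<lambda>x. cos (f x))"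
  by (rule smooth_germ_compose_on[OF smooth_on_cos[OF open_UNIV]]) auto

text \<open>Integrating s^(n+2) / 2 gives s^(n+3) / (2 (n + 3)). The weights are positive, so gaps
  and signs of the coefficients pass from \<open>c\<close> to \<open>\<xi>\<close>.\<close>

lemma cubic_primitive:
  fixes x :: "real \<Rightarrow> real"
  assumes "smooth_germ c" "eventually (\<lambda>s. (x has_field_derivative s\<^sup>2 / 2 * c s) (at s)) (nhds 0)" "x 0 = 0"
  obtains \<xi> :: "real \<Rightarrow> real" where "smooth_germ \<xi>" "\<And>s. x s = s ^ 3 * \<xi> s"
    "\<And>n. taylor \<xi> $ n = taylor c $ n / (2 * (real n + 3))"
proof -
  have sc: "smooth_germ (\<lambda>s. s\<^sup>2 / 2 * c s)" by (intro smooth_germ_intros assms) auto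
  have sx: "smooth_germ x"
    by (rule smooth_germ_antideriv[OF sc])
       (use assms(2) in \<open>simp add: has_real_derivative_iff_has_vector_derivative\<close>)
  have eq: "(\<lambda>s. s\<^sup>2 / 2 * c s) = (\<lambda>s. s ^ 2 * ((1/2) * c s))" by (simp add: fun_eq_iff)
  have "taylor (\<lambda>s. s\<^sup>2 / 2 * c s) = fps_X ^ 2 * (fps_const (1/2) * taylor c)"
    unfolding eq taylor_X_power_mult[OF smooth_germ_mult[OF smooth_germ_const assms(1)]]
      taylor_cmult[OF assms(1)] ..
  then have d: "fps_deriv (taylor x) = fps_X ^ 2 * (fps_const (1/2) * taylor c)"
    using taylor_antideriv[OF assms(2)] by simp
  have nth: "real (Suc n) * taylor x $ Suc n = (if n < 2 then 0 else taylor c $ (n - 2) / 2)" for n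
    using arg_cong[OF d, of "\<lambda>F. F $ n"] by (simp add: fps_X_power_mult_nth)
  have z: "taylor x $ i = 0" if "i < 3" for i
    using nth[of "i - 1"] assms(3) that by (cases i) auto
  obtain \<xi> where \<xi>: "smooth_germ \<xi>" "\<And>s. x s = s ^ 3 * \<xi> s" "\<And>i. taylor \<xi> $ i = taylor x $ (i + 3)"
    using smooth_factor[OF sx, of 3] z by blast
  have "taylor \<xi> $ n = taylor c $ n / (2 * (real n + 3))" for n
    using nth[of "n + 2"] by (simp add: \<xi>(3) field_simps eval_nat_numeral)
  then show ?thesis using that \<xi> by blast
qed

lemma phi3_components:
  assumes "smooth_germ \<kappa>"
  obtains \<xi> \<zeta> :: "real \<Rightarrow> real" where "smooth_germ \<xi>" "smooth_germ \<zeta>"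
    "\<And>s. phi3 \<kappa> s = (s ^ 3 * \<xi> s, s ^ 3 * \<zeta> s)"
    "\<And>n. taylor \<xi> $ n = taylor (\<lambda>s. cos (theta \<kappa> s)) $ n / (2 * (real n + 3))"
    "\<And>n. taylor \<zeta> $ n = taylor (\<lambda>s. sin (theta \<kappa> s)) $ n / (2 * (real n + 3))"
proof -
  note th = theta_smooth[OF assms]
  let ?F = "\<lambda>u. (u\<^sup>2 / 2) *\<^sub>R (cos (theta \<kappa> u), sin (theta \<kappa> u))"
  have sF: "smooth_germ ?F"
    by (intro smooth_germ_scaleR smooth_germ_intros smooth_germ_cos smooth_germ_sin th) auto
  have phi: "phi3 \<kappa> = (\<lambda>s. LBINT u=0..s. ?F u)" by (auto simp: phi3_def)
  note der = interval_integral_germ(1)[OF sF, folded phi]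
  have p0: "phi3 \<kappa> 0 = 0" by (simp add: phi3_def flip: zero_ereal_def)
  have x: "eventually (\<lambda>s. ((\<lambda>s. fst (phi3 \<kappa> s)) has_field_derivative s\<^sup>2 / 2 * cos (theta \<kappa> s)) (at s)) (nhds 0)"
    using der
  proof eventually_elim
    case (elim s)
    from bounded_linear.has_vector_derivative[OF bounded_linear_fst elim]
    show ?case by (simp add: has_real_derivative_iff_has_vector_derivative)
  qed
  have y: "eventually (\<lambda>s. ((\<lambda>s. snd (phi3 \<kappa> s)) has_field_derivative s\<^sup>2 / 2 * sin (theta \<kappa> s)) (at s)) (nhds 0)"
    using der
  proof eventually_elim
    case (elim s)
    from bounded_linear.has_vector_derivative[OF bounded_linear_snd elim]
    show ?case by (simp add: has_real_derivative_iff_has_vector_derivative)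
  qed
  obtain \<xi> where \<xi>: "smooth_germ \<xi>" "\<And>s. fst (phi3 \<kappa> s) = s ^ 3 * \<xi> s"
      "\<And>n. taylor \<xi> $ n = taylor (\<lambda>s. cos (theta \<kappa> s)) $ n / (2 * (real n + 3))"
    using cubic_primitive[OF smooth_germ_cos[OF th(1)] x] p0 by auto
  obtain \<zeta> where \<zeta>: "smooth_germ \<zeta>" "\<And>s. snd (phi3 \<kappa> s) = s ^ 3 * \<zeta> s"
      "\<And>n. taylor \<zeta> $ n = taylor (\<lambda>s. sin (theta \<kappa> s)) $ n / (2 * (real n + 3))"
    using cubic_primitive[OF smooth_germ_sin[OF th(1)] y] p0 by auto
  have "phi3 \<kappa> s = (s ^ 3 * \<xi> s, s ^ 3 * \<zeta> s)" for s
    using \<xi>(2)[of s] \<zeta>(2)[of s] by (metis prod.collapse)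
  then show ?thesis using that \<xi> \<zeta> by blast
qed

context cubic_gap
begin

lemma gap_taylor_compose:
  assumes "smooth_germ f" "smooth_germ g" "g 0 = 0" "gap (taylor g)"
  shows "gap (taylor (\<lambda>x. f (g x)))" "adm l \<Longrightarrow> taylor (\<lambda>x. f (g x)) $ l = deriv f 0 * taylor g $ l"
  using assms gap_compose[of "taylor g" "taylor f"] gap_compose_nth[of "taylor g" l "taylor f"]
  by (simp_all add: taylor_compose)

text \<open>The new parameter s (6 \<xi>(s))^(1/3) is s times a unit with gaps. By
  \<open>gap_reparam\<close> it leaves the admissible coefficients untouched, and the cosine enters
  them only through its constant term.\<close>

lemma phi3_cubic_parameter:
  assumes \<kappa>: "smooth_germ \<kappa>" and gap: "gap (taylor (theta \<kappa>))"
  obtains h Y :: "real \<Rightarrow> real" where "diffeo_germ h" "smooth_germ Y"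
    "eventually (\<lambda>t. phi3 \<kappa> (h t) = (t ^ 3 / 6, Y t)) (nhds 0)"
    "\<And>n. n < 3 \<Longrightarrow> taylor Y $ n = 0"
    "\<And>l. adm l \<Longrightarrow> taylor Y $ (l + 3) = taylor (theta \<kappa>) $ l / (2 * (real l + 3))"
proof -
  note th = theta_smooth[OF \<kappa>]
  obtain \<xi> \<zeta> where \<xi>: "smooth_germ \<xi>" and \<zeta>: "smooth_germ \<zeta>"
    and phi: "\<And>s. phi3 \<kappa> s = (s ^ 3 * \<xi> s, s ^ 3 * \<zeta> s)"
    and t\<xi>: "\<And>n. taylor \<xi> $ n = taylor (\<lambda>s. cos (theta \<kappa> s)) $ n / (2 * (real n + 3))"
    and t\<zeta>: "\<And>n. taylor \<zeta> $ n = taylor (\<lambda>s. sin (theta \<kappa> s)) $ n / (2 * (real n + 3))"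
    using phi3_components[OF \<kappa>] by blast
  have gc: "gap (taylor (\<lambda>s. cos (theta \<kappa> s)))"
    by (rule gap_taylor_compose(1)[OF smooth_germ_cos[OF smooth_germ_ident] th gap])
  have gs: "gap (taylor (\<lambda>s. sin (theta \<kappa> s)))"
    by (rule gap_taylor_compose(1)[OF smooth_germ_sin[OF smooth_germ_ident] th gap])
  have dsin: "deriv sin 0 = (1 :: real)" using DERIV_imp_deriv[OF DERIV_sin[of 0]] by simp
  have sin_nth: "taylor (\<lambda>s. sin (theta \<kappa> s)) $ l = taylor (theta \<kappa>) $ l" if "adm l" for l
    using gap_taylor_compose(2)[OF smooth_germ_sin[OF smooth_germ_ident] th gap that] dsin by simp
  have \<xi>0: "\<xi> 0 = 1 / 6" and \<zeta>0: "\<zeta> 0 = 0"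
    using t\<xi>[of 0] t\<zeta>[of 0] th(2) by simp_all
  have g\<zeta>: "gap (taylor \<zeta>)" using gs by (auto simp: gap_def t\<zeta>)
  define v where "v s = 6 * \<xi> s - 1" for s
  have v: "smooth_germ v" "v 0 = 0" unfolding v_def by (auto intro!: smooth_germ_intros \<xi> simp: \<xi>0)
  have gv: "gap (taylor v)"
    unfolding gap_def
  proof (intro allI impI)
    fix n assume n: "forced n"
    then show "taylor v $ n = 0"
      using gapD[OF gc n] adm_pos[OF forced_adm[OF n]] unfolding v_def
      by (simp add: taylor_diff taylor_cmult smooth_germ_intros \<xi> t\<xi>)
  qed
  \<comment> \<open>As \<xi> 0 = 1/6, the series 1 + v of 6 \<xi> starts with 1. \<open>u\<close> is
    its cube root, written with \<open>exp\<close> and \<open>ln\<close> so as to be smooth by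
    composition, and \<open>w\<close> inverts the cube of \<open>u\<close>.\<close>
  define u where "u s = exp (ln (1 + v s) / 3)" for s
  define w where "w s = inverse (1 + v s)" for s
  have ser: "smooth_germ (\<lambda>z::real. exp (ln (1 + z) / 3))" "smooth_germ (\<lambda>z::real. inverse (1 + z))"
    by (auto intro!: smooth_germ_intros)
  have u: "smooth_germ u" "u 0 = 1" "gap (taylor u)"
    using smooth_germ_compose[OF ser(1) v] gap_taylor_compose(1)[OF ser(1) v gv] v(2)
    by (simp_all add: u_def[abs_def])
  have w: "smooth_germ w" "w 0 = 1" "gap (taylor w)"
    using smooth_germ_compose[OF ser(2) v] gap_taylor_compose(1)[OF ser(2) v gv] v(2)
    by (simp_all add: w_def[abs_def])
  have "eventually (\<lambda>s. v s > -1) (nhds 0)"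
    using order_tendstoD(1)[OF smooth_germ_tendsto[OF v(1)], of "-1"] v(2) by simp
  then have u3: "eventually (\<lambda>s. u s ^ 3 = 6 * \<xi> s \<and> u s ^ 3 * w s = 1) (nhds 0)"
  proof eventually_elim
    case (elim s)
    have "u s ^ 3 = exp (3 * (ln (1 + v s) / 3))"
      unfolding u_def using exp_of_nat_mult[of 3 "ln (1 + v s) / 3"] by simp
    also have "\<dots> = 1 + v s" using elim by simp
    finally show ?case using elim by (simp add: v_def w_def)
  qed
  define \<tau> where "\<tau> s = s * u s" for s
  have s\<tau>: "smooth_germ \<tau>" unfolding \<tau>_def by (intro smooth_germ_intros u)
  have t\<tau>: "taylor \<tau> = fps_X * taylor u" unfolding \<tau>_def by (rule taylor_X_mult[OF u(1)])
  have \<tau>0: "\<tau> 0 = 0" by (simp add: \<tau>_def)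
  have "deriv \<tau> 0 = 1" using arg_cong[OF t\<tau>, of "\<lambda>F. F $ 1"] u(2) by simp
  then have d\<tau>: "diffeo_germ \<tau>" by (intro diffeo_germ_real s\<tau> \<tau>0) simp
  obtain h where h: "diffeo_germ h" "eventually (\<lambda>x. h (\<tau> x) = x) (nhds 0)"
      "eventually (\<lambda>x. \<tau> (h x) = x) (nhds 0)"
    using diffeo_germ_inverse[OF d\<tau>] by blast
  note sh = diffeo_germ_smooth[OF h(1)] and h0 = diffeo_germ_zero[OF h(1)]
  define Y where "Y t = h t ^ 3 * \<zeta> (h t)" for t
  have s\<zeta>h: "smooth_germ (\<lambda>t. \<zeta> (h t))" by (rule smooth_germ_compose[OF \<zeta> sh h0])
  have sY: "smooth_germ Y" unfolding Y_def by (intro smooth_germ_intros sh s\<zeta>h)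
  obtain k where k: "smooth_germ k" "\<And>t. h t = t ^ 1 * k t"
    by (rule smooth_factor[OF sh, of 1]) (use h0 in auto)
  define V where "V t = k t ^ 3 * \<zeta> (h t)" for t
  have sV: "smooth_germ V" unfolding V_def by (intro smooth_germ_intros k s\<zeta>h)
  have YV: "Y = (\<lambda>t. t ^ 3 * V t)" by (auto simp: Y_def V_def k(2) power_mult_distrib)
  have sV\<tau>: "smooth_germ (\<lambda>s. V (\<tau> s))" by (rule smooth_germ_compose[OF sV s\<tau> \<tau>0])
  have "eventually (\<lambda>s. s ^ 3 * (u s ^ 3 * V (\<tau> s)) = s ^ 3 * \<zeta> s) (nhds 0)"
    using h(2)
  proof eventually_elim
    case (elim s)
    have "s ^ 3 * (u s ^ 3 * V (\<tau> s)) = Y (\<tau> s)" by (simp add: YV \<tau>_def power_mult_distrib)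
    also have "\<dots> = s ^ 3 * \<zeta> s" by (simp add: Y_def elim)
    finally show ?case .
  qed
  from taylor_cong[OF this]
  have "fps_X ^ 3 * (taylor (\<lambda>s. u s ^ 3) * taylor (\<lambda>s. V (\<tau> s))) = fps_X ^ 3 * taylor \<zeta>"
    by (simp add: taylor_X_power_mult taylor_mult smooth_germ_mult smooth_germ_power u sV\<tau> \<zeta>)
  then have e1: "taylor (\<lambda>s. u s ^ 3) * taylor (\<lambda>s. V (\<tau> s)) = taylor \<zeta>" by simp
  have "eventually (\<lambda>s. u s ^ 3 * w s = 1) (nhds 0)" using u3 by eventually_elim (rule conjunct2)
  from taylor_cong[OF this]
  have e2: "taylor (\<lambda>s. u s ^ 3) * taylor w = 1"
    by (simp add: taylor_mult smooth_germ_power u w)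
  \<comment> \<open>Y(\<tau>(s)) = s^3 \<zeta>(s) becomes u^3 (V o \<tau>) = \<zeta> once X^3 is
    cancelled from the series, and \<open>w\<close> inverts u^3.\<close>
  have VH: "taylor V oo (fps_X * taylor u) = taylor w * taylor \<zeta>"
  proof -
    have "taylor (\<lambda>s. V (\<tau> s)) = taylor w * taylor \<zeta>"
      using e1 e2 by (metis mult.assoc mult.commute mult_1)
    then show ?thesis using taylor_compose[OF sV s\<tau> \<tau>0] by (simp add: t\<tau>)
  qed
  have gH: "gap (taylor V oo (fps_X * taylor u))" unfolding VH by (rule gap_mult[OF w(3) g\<zeta>])
  have Vnth: "taylor V $ l = taylor \<zeta> $ l" if "adm l" for l
    using gap_reparam[OF u(3) _ gH that] gap_mult_nth[OF w(3) g\<zeta> that] u(2) w(2) \<zeta>0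
    by (simp add: VH)
  have tY: "taylor Y = fps_X ^ 3 * taylor V" unfolding YV by (rule taylor_X_power_mult[OF sV])
  show ?thesis
  proof (rule that[OF h(1) sY])
    show "eventually (\<lambda>t. phi3 \<kappa> (h t) = (t ^ 3 / 6, Y t)) (nhds 0)"
      using h(3) eventually_compose_filterlim[OF u3 diffeo_germ_tendsto[OF h(1)]]
    proof eventually_elim
      case (elim t)
      have "t ^ 3 = h t ^ 3 * u (h t) ^ 3" using elim(1) by (metis \<tau>_def power_mult_distrib)
      then show ?case using elim(2) by (simp add: phi Y_def)
    qed
    show "taylor Y $ n = 0" if "n < 3" for n using that by (simp add: tY fps_X_power_mult_nth)
    show "taylor Y $ (l + 3) = taylor (theta \<kappa>) $ l / (2 * (real l + 3))" if "adm l" for l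
      by (simp add: tY fps_X_power_mult_nth Vnth[OF that] t\<zeta> sin_nth[OF that])
  qed
qed

end

section \<open>Reduction to the normal forms\<close>

lemma has_derivative_smooth_comp:
  fixes a :: "real \<Rightarrow> real" and L :: "'a::euclidean_space \<Rightarrow> real"
  assumes "smooth_germ a" "bounded_linear L"
  shows "((\<lambda>p. a (L p)) has_derivative (\<lambda>v. deriv a 0 * L v)) (at 0)"
proof -
  have L0: "L 0 = 0" using assms(2) by (simp add: linear_simps)
  have "(a has_derivative (*) (deriv a 0)) (at (L 0))"
    using smooth_germ_deriv(3)[OF assms(1)] unfolding L0 has_field_derivative_def .
  from has_derivative_compose[OF bounded_linear_imp_has_derivative[OF assms(2)] this]
  show ?thesis by simp
qed

text \<open>Degree 2 in the second coordinate suffices for every target change below: along (t^3,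
  t^q) the powers 1, y, y^2 cover the three residue classes of exponents, and functions of t^3 serve
  as coefficients. The quadratic terms are invisible to the linear part at 0.\<close>

lemma diffeo_germ_quadratic:
  fixes \<alpha> \<beta> \<gamma> \<alpha>' \<beta>' \<gamma>' :: "real \<Rightarrow> real"
  assumes a: "smooth_germ \<alpha>" "smooth_germ \<beta>" "smooth_germ \<gamma>" "\<alpha> 0 = 0"
    and b: "smooth_germ \<alpha>'" "smooth_germ \<beta>'" "smooth_germ \<gamma>'" "\<alpha>' 0 = 0"
    and det: "deriv \<alpha> 0 * \<beta>' 0 - \<beta> 0 * deriv \<alpha>' 0 \<noteq> 0"
  shows "diffeo_germ (\<lambda>p. (\<alpha> (fst p) + \<beta> (fst p) * snd p + \<gamma> (fst p) * (snd p)\<^sup>2,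
    \<alpha>' (fst p) + \<beta>' (fst p) * snd p + \<gamma>' (fst p) * (snd p)\<^sup>2))"
proof (rule diffeo_germ_plane[where a = "deriv \<alpha> 0" and b = "\<beta> 0" and c = "deriv \<alpha>' 0" and d = "\<beta>' 0"])
  have comp: "smooth_germ (\<lambda>p :: real \<times> real. f (fst p))" if "smooth_germ f" for f :: "real \<Rightarrow> real"
    by (rule smooth_germ_compose[OF that smooth_germ_fst[OF smooth_germ_ident]]) simp
  show "smooth_germ (\<lambda>p. (\<alpha> (fst p) + \<beta> (fst p) * snd p + \<gamma> (fst p) * (snd p)\<^sup>2,
      \<alpha>' (fst p) + \<beta>' (fst p) * snd p + \<gamma>' (fst p) * (snd p)\<^sup>2))"
    by (intro smooth_germ_Pair smooth_germ_add smooth_germ_mult smooth_germ_power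
        smooth_germ_snd smooth_germ_ident comp a b)
  have der: "((\<lambda>p :: real \<times> real. f0 (fst p) + f1 (fst p) * snd p + f2 (fst p) * (snd p)\<^sup>2) has_derivative
      (\<lambda>v. deriv f0 0 * fst v + f1 0 * snd v)) (at 0)"
    if "smooth_germ f0" "smooth_germ f1" "smooth_germ f2" for f0 f1 f2 :: "real \<Rightarrow> real"
  proof -
    note d = has_derivative_smooth_comp[OF _ bounded_linear_fst]
    have snd: "(snd has_derivative snd) (at (0 :: real \<times> real))"
      by (rule bounded_linear_imp_has_derivative[OF bounded_linear_snd])
    from has_derivative_add[OF has_derivative_add[OF d[OF that(1)] has_derivative_mult[OF d[OF that(2)] snd]]
        has_derivative_mult[OF d[OF that(3)] has_derivative_mult[OF snd snd]]]
    show ?thesis by (simp add: power2_eq_square)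
  qed
  show "((\<lambda>p. (\<alpha> (fst p) + \<beta> (fst p) * snd p + \<gamma> (fst p) * (snd p)\<^sup>2,
      \<alpha>' (fst p) + \<beta>' (fst p) * snd p + \<gamma>' (fst p) * (snd p)\<^sup>2)) has_derivative
      (\<lambda>v. (deriv \<alpha> 0 * fst v + \<beta> 0 * snd v, deriv \<alpha>' 0 * fst v + \<beta>' 0 * snd v))) (at 0)"
    by (intro has_derivative_Pair der a b)
qed (use a b det in \<open>auto simp: zero_prod_def\<close>)

lemma smooth_germ_cube:
  fixes b :: "real \<Rightarrow> real"
  shows "smooth_germ b \<Longrightarrow> smooth_germ (\<lambda>t. b (t ^ 3))"
  by (rule taylor_cube(1))

lemma deriv_X_mult:
  fixes f :: "real \<Rightarrow> real"
  assumes "smooth_germ f"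
  shows "deriv (\<lambda>x. x * f x) 0 = f 0"
  using arg_cong[OF taylor_X_mult[OF assms], of "\<lambda>F. F $ 1"] by simp

lemma deriv_X_add:
  fixes f :: "real \<Rightarrow> real"
  assumes "smooth_germ f"
  shows "deriv (\<lambda>x. x + f x) 0 = 1 + deriv f 0"
  using arg_cong[OF taylor_add[OF smooth_germ_ident assms], of "\<lambda>F. F $ 1"] by simp

lemma smooth_map_germ_pair:
  assumes "smooth_germ x" "smooth_germ y" "x 0 = 0" "y 0 = 0"
  shows "smooth_map_germ (\<lambda>t. (x t, y t))"
  using assms by (simp add: smooth_map_germ_def smooth_germ_Pair zero_prod_def)

lemma A_equivalent_divide_unit:
  fixes b c :: "real \<Rightarrow> real"
  assumes "smooth_germ b" "smooth_germ c" "b 0 \<noteq> 0" "0 < q" "0 < N"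
  shows "A_equivalent (\<lambda>t. (t ^ 3, t ^ q * b (t ^ 3) + t ^ N * c (t ^ 3)))
    (\<lambda>t. (t ^ 3, t ^ q + t ^ N * (c (t ^ 3) / b (t ^ 3))))"
proof (rule A_equivalent_left)
  show "smooth_map_germ (\<lambda>t. (t ^ 3, t ^ q * b (t ^ 3) + t ^ N * c (t ^ 3)))"
    by (rule smooth_map_germ_pair) (use assms in \<open>auto intro!: smooth_germ_intros smooth_germ_cube simp: zero_power\<close>)
  let ?\<psi> = "\<lambda>p. (fst p + 0 * snd p + 0 * (snd p)\<^sup>2, 0 + inverse (b (fst p)) * snd p + 0 * (snd p)\<^sup>2)"
  show "diffeo_germ ?\<psi>"
    by (rule diffeo_germ_quadratic[where \<alpha> = "\<lambda>x. x" and \<beta> = "\<lambda>x. 0" and \<gamma> = "\<lambda>x. 0" and \<alpha>' = "\<lambda>x. 0"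
          and \<beta>' = "\<lambda>x. inverse (b x)" and \<gamma>' = "\<lambda>x. 0"])
       (use assms in \<open>auto intro!: smooth_germ_intros\<close>)
  have "filterlim (\<lambda>t::real. t ^ 3) (nhds 0) (nhds 0)"
    using smooth_germ_tendsto[OF smooth_germ_power[OF smooth_germ_ident], of 3] by simp
  moreover have "eventually (\<lambda>x. b x \<noteq> 0) (nhds 0)"
    using tendsto_imp_eventually_ne[OF smooth_germ_tendsto[OF assms(1)] assms(3)] .
  ultimately have "eventually (\<lambda>t. b (t ^ 3) \<noteq> 0) (nhds 0)"
    by (rule eventually_compose_filterlim[rotated])
  then show "eventually (\<lambda>t. (t ^ 3, t ^ q + t ^ N * (c (t ^ 3) / b (t ^ 3))) =
      ?\<psi> (t ^ 3, t ^ q * b (t ^ 3) + t ^ N * c (t ^ 3))) (nhds 0)"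
    by eventually_elim (simp add: field_simps)
qed

text \<open>Substituting \<open>t u(t\<^sup>3)\<close> for \<open>t\<close> and rescaling the target by \<open>x \<mapsto> x u(x)\<^sup>3\<close>,
  \<open>y \<mapsto> u(x)\<^sup>q y\<close> turns \<open>C\<close> into \<open>\<epsilon>\<close> when \<open>\<epsilon> u\<^sup>N\<^sup>-\<^sup>q = C\<close>.\<close>

lemma A_equivalent_binomial:
  fixes C :: "real \<Rightarrow> real"
  assumes C: "smooth_germ C" "C 0 \<noteq> 0" and q: "0 < q" "q < N"
    and \<epsilon>: "\<epsilon> = (if odd (N - q) then 1 else sgn (C 0))"
  shows "A_equivalent (\<lambda>t. (t ^ 3, t ^ q + t ^ N * C (t ^ 3))) (\<lambda>t. (t ^ 3, t ^ q + \<epsilon> * t ^ N))"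
proof -
  define d where "d = N - q"
  have d: "d > 0" "N = q + d" using q by (auto simp: d_def)
  \<comment> \<open>For odd \<open>d\<close> the sign of \<open>C 0\<close> goes into
    \<open>u\<close> through \<sigma>; for even \<open>d\<close> it stays in \<epsilon>, and
    \<sigma> is 1.\<close>
  define \<sigma> where "\<sigma> = (if odd d then sgn (C 0) else 1)"
  have \<sigma>: "\<sigma> \<noteq> 0" "\<epsilon> * \<sigma> ^ d * sgn (C 0) = 1"
    using C(2) unfolding \<epsilon> \<sigma>_def d_def[symmetric] by (auto simp: sgn_if)
  define u where "u x = \<sigma> * exp (ln (sgn (C 0) * C x) / d)" for x
  have pos: "sgn (C 0) * C 0 > 0" using C(2) by (simp add: sgn_if)
  have u: "smooth_germ u" unfolding u_def by (intro smooth_germ_intros C) (use d pos in auto)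
  have u0: "u 0 \<noteq> 0" using \<sigma> by (simp add: u_def)
  have "eventually (\<lambda>x. sgn (C 0) * C x > 0) (nhds 0)"
    using order_tendstoD(1)[OF smooth_germ_tendsto[OF smooth_germ_mult[OF smooth_germ_const C(1)]] pos] .
  then have ev: "eventually (\<lambda>x. \<epsilon> * u x ^ d = C x) (nhds 0)"
  proof eventually_elim
    case (elim x)
    have "exp (ln (sgn (C 0) * C x) / d) ^ d = exp (d * (ln (sgn (C 0) * C x) / d))"
      by (rule exp_of_nat_mult[symmetric])
    also have "\<dots> = sgn (C 0) * C x" using elim d(1) by simp
    finally have "\<epsilon> * u x ^ d = (\<epsilon> * \<sigma> ^ d * sgn (C 0)) * C x"
      by (simp add: u_def power_mult_distrib)
    then show ?case by (simp add: \<sigma>(2))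
  qed
  have "filterlim (\<lambda>t::real. t ^ 3) (nhds 0) (nhds 0)"
    using smooth_germ_tendsto[OF smooth_germ_power[OF smooth_germ_ident], of 3] by simp
  from eventually_compose_filterlim[OF ev this]
  have ev': "eventually (\<lambda>t. \<epsilon> * u (t ^ 3) ^ d = C (t ^ 3)) (nhds 0)" .
  define T where "T t = t * u (t ^ 3)" for t
  have uc: "smooth_germ (\<lambda>t. u (t ^ 3))" by (rule smooth_germ_cube[OF u])
  have T: "diffeo_germ T"
    unfolding T_def
    by (rule diffeo_germ_real) (use deriv_X_mult[OF uc] u0 in \<open>auto intro!: smooth_germ_intros uc\<close>)
  let ?f = "\<lambda>t. (t ^ 3, t ^ q + t ^ N * C (t ^ 3))" and ?g = "\<lambda>t::real. (t ^ 3, t ^ q + \<epsilon> * t ^ N)"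
  have f: "smooth_map_germ ?f"
    by (rule smooth_map_germ_pair) (use q in \<open>auto intro!: smooth_germ_intros smooth_germ_cube C simp: zero_power\<close>)
  have g: "smooth_map_germ ?g"
    by (rule smooth_map_germ_pair) (use q in \<open>auto intro!: smooth_germ_intros simp: zero_power\<close>)
  let ?\<psi> = "\<lambda>p. (fst p * u (fst p) ^ 3 + 0 * snd p + 0 * (snd p)\<^sup>2, 0 + u (fst p) ^ q * snd p + 0 * (snd p)\<^sup>2)"
  have su3: "smooth_germ (\<lambda>x. u x ^ 3)" by (intro smooth_germ_intros u)
  have "diffeo_germ ?\<psi>"
    by (rule diffeo_germ_quadratic[where \<alpha> = "\<lambda>x. x * u x ^ 3" and \<beta> = "\<lambda>x. 0" and \<gamma> = "\<lambda>x. 0"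
          and \<alpha>' = "\<lambda>x. 0" and \<beta>' = "\<lambda>x. u x ^ q" and \<gamma>' = "\<lambda>x. 0"])
       (use deriv_X_mult[OF su3] u0 in \<open>auto intro!: smooth_germ_intros u\<close>)
  moreover have "eventually (\<lambda>t. ?g (T t) = ?\<psi> (?f t)) (nhds 0)"
    using ev'
  proof eventually_elim
    case (elim t)
    show ?case
      by (simp add: T_def power_mult_distrib d(2) power_add elim[symmetric] algebra_simps)
  qed
  ultimately have "A_equivalent ?f (\<lambda>t. ?g (T t))" by (rule A_equivalent_left[OF f])
  moreover have "A_equivalent ?g (\<lambda>t. ?g (T t))" by (rule A_equivalent_right[OF g T]) simp
  ultimately show ?thesis by (blast intro: A_equivalent_trans A_equivalent_sym)
qed

text \<open>2q - 2 is the conductor of the semigroup generated by 3 and \<open>q\<close>: all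
  exponents from there on belong to it. In the class of \<open>q\<close> they start at q + 3 or
  later, whence the factor t^3 before \<open>b\<close>. Together with the vanishing of
  \<open>a 0\<close> and \<open>deriv a 0\<close>, this keeps such a remainder out of the linear
  part of a target change.\<close>

lemma high_order_decomposition:
  fixes f :: "real \<Rightarrow> real"
  assumes "smooth_germ f" "q mod 3 \<noteq> 0" "4 \<le> q"
  obtains a b c where "smooth_germ a" "smooth_germ b" "smooth_germ c" "a 0 = 0" "deriv a 0 = 0"
    "\<And>t. t ^ (2 * q - 2) * f t = a (t ^ 3) + (t ^ 3 * b (t ^ 3)) * t ^ q + c (t ^ 3) * (t ^ q)\<^sup>2"
proof -
  let ?g = "\<lambda>t. t ^ (2 * q - 2) * f t"
  have g: "smooth_germ ?g" by (intro smooth_germ_intros assms)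
  have tg: "taylor ?g $ i = 0" if "i < 2 * q - 2" for i
    using that by (simp add: taylor_X_power_mult assms(1) fps_X_power_mult_nth)
  have z1: "taylor ?g $ i = 0" if "i mod 3 = (q + 3) mod 3" "i < q + 3" for i
  proof -
    from same_mod_3[OF that(1) less_imp_le[OF that(2)]] obtain j where "q + 3 = i + 3 * j" .
    then have "i \<le> q" using that(2) by (cases j) auto
    then show ?thesis using assms(3) by (intro tg) auto
  qed
  have z2: "taylor ?g $ i = 0" if "i mod 3 = 2 * q mod 3" "i < 2 * q" for i
  proof -
    from same_mod_3[OF that(1) less_imp_le[OF that(2)]] obtain j where "2 * q = i + 3 * j" .
    then have "i + 3 \<le> 2 * q" using that(2) by (cases j) auto
    then show ?thesis using assms(3) by (intro tg) auto
  qed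
  have mods: "(q + 3) mod 3 \<noteq> 0" using assms(2) by simp
  have "2 * (q + 3) = 2 * q + 3 * 2" by simp
  then have mods': "2 * q mod 3 = 2 * (q + 3) mod 3" by (metis mod_mult_self2)
  obtain a b c where abc: "smooth_germ a" "smooth_germ b" "smooth_germ c"
    "\<And>t. ?g t = a (t ^ 3) + t ^ (q + 3) * b (t ^ 3) + t ^ (2 * q) * c (t ^ 3)"
    "\<And>n. taylor a $ n = taylor ?g $ (3 * n)" "b 0 = taylor ?g $ (q + 3)" "c 0 = taylor ?g $ (2 * q)"
    using cubic_decomposition[OF g mods mods' z1 z2] by blast
  have "a 0 = 0" "deriv a 0 = 0"
    using abc(5)[of 0] abc(5)[of 1] tg[of 3] assms(3) by auto
  moreover have "?g t = a (t ^ 3) + (t ^ 3 * b (t ^ 3)) * t ^ q + c (t ^ 3) * (t ^ q)\<^sup>2" for t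
    unfolding abc(4)[of t] power_add power_even_eq by (simp add: mult_ac)
  ultimately show ?thesis using that abc(1-3) by blast
qed

lemma power_one_plus_expansion:
  fixes n :: nat
  obtains P :: "real \<Rightarrow> real" where "smooth_germ P" "\<And>w. (1 + w) ^ n = 1 + real n * w + w\<^sup>2 * P w"
proof -
  let ?f = "\<lambda>w::real. (1 + w) ^ n"
  have f: "smooth_germ ?f" by (intro smooth_germ_intros)
  have "(?f has_field_derivative n) (at 0)" by (auto intro!: derivative_eq_intros)
  then have d: "deriv ?f 0 = n" by (rule DERIV_imp_deriv)
  obtain P where P: "smooth_germ P" "\<And>t. ?f t = (\<Sum>i<2. taylor ?f $ i * t ^ i) + t\<^sup>2 * P t"
    using taylor_expansion[OF f, of 2] by blast
  have "(1 + w) ^ n = 1 + real n * w + w\<^sup>2 * P w" for w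
    using P(2)[of w] d by (simp add: eval_nat_numeral)
  then show ?thesis by (rule that[OF P(1)])
qed

text \<open>The term \<open>t\<^sup>2\<^sup>q\<^sup>-\<^sup>3\<close>, the largest exponent outside the semigroup generated by
  \<open>3\<close> and \<open>q\<close>, is removed by the substitution \<open>t \<mapsto> t + d t\<^sup>q\<^sup>-\<^sup>2 - d\<^sup>2 t\<^sup>2\<^sup>q\<^sup>-\<^sup>5\<close>
  with \<open>d = - C(0)/q\<close>. It creates the term \<open>3d t\<^sup>q\<close> in the first component, and the coefficient
  \<open>- d\<^sup>2\<close> is chosen so that no multiple of \<open>t\<^sup>2\<^sup>q\<^sup>-\<^sup>3\<close> appears there.\<close>

lemma A_equivalent_monomial:
  fixes C :: "real \<Rightarrow> real"
  assumes C: "smooth_germ C" and q: "4 \<le> q" "q mod 3 \<noteq> 0"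
  shows "A_equivalent (\<lambda>t. (t ^ 3, t ^ q + t ^ (2 * q - 3) * C (t ^ 3))) (\<lambda>t. (t ^ 3, t ^ q))"
proof -
  obtain r where r: "q = r + 4" using q(1) by (metis le_add_diff_inverse2)
  define d where "d = - C 0 / real q"
  have Cd: "C 0 = - (real q * d)" using q(1) by (simp add: d_def)
  \<comment> \<open>Here r = q - 4, so \<open>z\<close> is t^(q-3), and t (1 + w) is the announced
    substitution.\<close>
  define z where "z t = t ^ (r + 1)" for t :: real
  define w where "w t = z t * (d - d\<^sup>2 * z t)" for t
  define T where "T t = t * (1 + w t)" for t
  have z: "smooth_germ z" unfolding z_def by (intro smooth_germ_intros)
  have w: "smooth_germ w" unfolding w_def by (intro smooth_germ_intros z)
  have w0: "w 0 = 0" by (simp add: w_def z_def)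
  have sT: "smooth_germ T" unfolding T_def by (intro smooth_germ_intros w)
  have T0: "T 0 = 0" by (simp add: T_def)
  have s1: "smooth_germ (\<lambda>t. 1 + w t)" by (intro smooth_germ_intros w)
  have "deriv T 0 \<noteq> 0" using deriv_X_mult[OF s1] w0 by (simp add: T_def[abs_def])
  then have dT: "diffeo_germ T" by (rule diffeo_germ_real[OF sT T0])
  obtain P where P: "smooth_germ P" "\<And>w. (1 + w) ^ q = 1 + real q * w + w\<^sup>2 * P w"
    using power_one_plus_expansion[of q] by blast
  obtain Q' where Q': "smooth_germ Q'"
    "\<And>w. (1 + w) ^ (2 * q - 3) = 1 + real (2 * q - 3) * w + w\<^sup>2 * Q' w"
    using power_one_plus_expansion[of "2 * q - 3"] by blast
  define Q where "Q w = real (2 * q - 3) + w * Q' w" for w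
  have Q: "smooth_germ Q" "(1 + w) ^ (2 * q - 3) = 1 + w * Q w" for w
    unfolding Q_def Q'(2) by (intro smooth_germ_intros Q'(1)) (simp add: algebra_simps power2_eq_square)
  obtain C1 where C1: "smooth_germ C1" "\<And>t. C t = (\<Sum>i<1. taylor C $ i * t ^ i) + t ^ 1 * C1 t"
    using taylor_expansion[OF C] by blast
  have C1_eq: "C x = C 0 + x * C1 x" for x using C1(2)[of x] by simp
  have comp: "smooth_germ (\<lambda>t. F (w t))" "smooth_germ (\<lambda>t. F (T t ^ 3))" if "smooth_germ F" for F :: "real \<Rightarrow> real"
    by (rule smooth_germ_compose[OF that w w0],
        rule smooth_germ_compose[OF that smooth_germ_power[OF sT]], simp add: T0)
  define R1 where "R1 t = t ^ r * (- 6 * d ^ 3 + 3 * d ^ 4 * z t + (d - d\<^sup>2 * z t) ^ 3)" for t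
  have R1: "smooth_germ R1" unfolding R1_def by (intro smooth_germ_intros z)
  define R2 where "R2 t = t ^ r * (- (real q * d\<^sup>2) + (d - d\<^sup>2 * z t)\<^sup>2 * P (w t)
      + (d - d\<^sup>2 * z t) * Q (w t) * C (T t ^ 3)) + t\<^sup>2 * (1 + w t) ^ 3 * C1 (T t ^ 3)" for t
  have R2: "smooth_germ R2" unfolding R2_def by (intro smooth_germ_intros z w comp P(1) Q(1) C C1(1))
  have T3: "T t ^ 3 = t ^ 3 + 3 * d * t ^ q + t ^ (2 * q - 2) * R1 t" for t
  proof -
    \<comment> \<open>In 1 + 3w + 3w^2 + w^3 the terms in z^2 cancel: -3 d^2 from 3w against 3 d^2
      from 3w^2.\<close>
    have "T t ^ 3 = t ^ 3 * (1 + 3 * d * z t + z t ^ 3 * (- 6 * d ^ 3 + 3 * d ^ 4 * z t + (d - d\<^sup>2 * z t) ^ 3))"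
      unfolding T_def w_def by algebra
    also have "\<dots> = t ^ 3 + 3 * d * (t ^ 3 * z t)
        + (t ^ 3 * z t ^ 3) * (- 6 * d ^ 3 + 3 * d ^ 4 * z t + (d - d\<^sup>2 * z t) ^ 3)"
      by (simp add: algebra_simps)
    also have "t ^ 3 * z t = t ^ q"
      unfolding z_def r power_add[symmetric] by (rule arg_cong[of _ _ "\<lambda>n. t ^ n"]) simp
    also have "t ^ 3 * z t ^ 3 = t ^ (2 * q - 2) * (t ^ r)"
      by (simp add: z_def r power_add[symmetric] power_mult[symmetric] algebra_simps)
    finally show ?thesis by (simp add: R1_def)
  qed
  have Tq: "T t ^ q + T t ^ (2 * q - 3) * C (T t ^ 3) = t ^ q + t ^ (2 * q - 2) * R2 t" for t
  proof -
    have e: "t ^ q * z t = t ^ (2 * q - 3)" "t ^ (2 * q - 3) * z t = t ^ (2 * q - 2) * t ^ r"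
      unfolding z_def r power_add[symmetric] by (rule arg_cong[of _ _ "\<lambda>n. t ^ n"], simp)+
    have e': "t ^ (2 * q - 3) * t = t ^ (2 * q - 2)"
      unfolding power_Suc2[symmetric] by (rule arg_cong[of _ _ "\<lambda>n. t ^ n"]) (simp add: r)
    have c: "C (T t ^ 3) = - (real q * d) + t ^ 3 * (1 + w t) ^ 3 * C1 (T t ^ 3)"
      using C1_eq[of "T t ^ 3"] by (simp add: Cd T_def power_mult_distrib)
    have "T t ^ q + T t ^ (2 * q - 3) * C (T t ^ 3) =
       t ^ q * (1 + real q * w t + (w t)\<^sup>2 * P (w t)) + t ^ (2 * q - 3) * (1 + w t * Q (w t)) * C (T t ^ 3)"
      unfolding T_def[of t] power_mult_distrib by (simp add: P(2) Q(2))
    also have "\<dots> = t ^ q + (t ^ q * z t) * (real q * d - real q * d\<^sup>2 * z t + z t * (d - d\<^sup>2 * z t)\<^sup>2 * P (w t))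
        + t ^ (2 * q - 3) * C (T t ^ 3) + (t ^ (2 * q - 3) * z t) * ((d - d\<^sup>2 * z t) * Q (w t) * C (T t ^ 3))"
      by (simp add: w_def[of t] algebra_simps power2_eq_square)
    also have "\<dots> = t ^ q + (t ^ (2 * q - 3) * z t) * (- real q * d\<^sup>2 + (d - d\<^sup>2 * z t)\<^sup>2 * P (w t)
        + (d - d\<^sup>2 * z t) * Q (w t) * C (T t ^ 3)) + t ^ (2 * q - 3) * (real q * d + C (T t ^ 3))"
      unfolding e(1) by (simp add: algebra_simps)
    \<comment> \<open>By the choice of \<open>d\<close> the constant term of q d + C(T^3) is 0. A
      factor t^3 splits off, so this part starts at order 2q, beyond the gap.\<close>
    also have "t ^ (2 * q - 3) * (real q * d + C (T t ^ 3)) = (t ^ (2 * q - 3) * t) * (t\<^sup>2 * (1 + w t) ^ 3 * C1 (T t ^ 3))"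
      unfolding c by (simp add: power2_eq_square power3_eq_cube)
    finally show ?thesis unfolding e e' R2_def by (simp add: algebra_simps)
  qed
  obtain a b c where abc: "smooth_germ a" "smooth_germ b" "smooth_germ c" "a 0 = 0" "deriv a 0 = 0"
    "\<And>t. t ^ (2 * q - 2) * R1 t = a (t ^ 3) + (t ^ 3 * b (t ^ 3)) * t ^ q + c (t ^ 3) * (t ^ q)\<^sup>2"
    using high_order_decomposition[OF R1 q(2,1)] by blast
  obtain a' b' c' where abc': "smooth_germ a'" "smooth_germ b'" "smooth_germ c'" "a' 0 = 0" "deriv a' 0 = 0"
    "\<And>t. t ^ (2 * q - 2) * R2 t = a' (t ^ 3) + (t ^ 3 * b' (t ^ 3)) * t ^ q + c' (t ^ 3) * (t ^ q)\<^sup>2"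
    using high_order_decomposition[OF R2 q(2,1)] by blast
  let ?f = "\<lambda>t. (t ^ 3, t ^ q + t ^ (2 * q - 3) * C (t ^ 3))" and ?g = "\<lambda>t::real. (t ^ 3, t ^ q)"
  \<comment> \<open>The term 3 d t^q of the first component is 3 d times the second coordinate of
    (t^3, t^q), so a shear of the target produces it; the linear part of this map has determinant
    1.\<close>
  let ?\<psi> = "\<lambda>p. ((fst p + a (fst p)) + (3 * d + fst p * b (fst p)) * snd p + c (fst p) * (snd p)\<^sup>2,
      a' (fst p) + (1 + fst p * b' (fst p)) * snd p + c' (fst p) * (snd p)\<^sup>2)"
  have d\<psi>: "diffeo_germ ?\<psi>"
    by (rule diffeo_germ_quadratic[where \<alpha> = "\<lambda>x. x + a x" and \<beta> = "\<lambda>x. 3 * d + x * b x" and \<gamma> = c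
          and \<alpha>' = a' and \<beta>' = "\<lambda>x. 1 + x * b' x" and \<gamma>' = c'])
       (use abc(4,5) abc'(4,5) deriv_X_add[OF abc(1)] in \<open>auto intro!: smooth_germ_intros abc(1-3) abc'(1-3)\<close>)
  have eq: "eventually (\<lambda>t. ?f (T t) = ?\<psi> (?g t)) (nhds 0)"
  proof (rule always_eventually, rule allI)
    fix t show "?f (T t) = ?\<psi> (?g t)"
      using T3[of t] Tq[of t] abc(6)[of t] abc'(6)[of t] by (simp add: algebra_simps)
  qed
  have g: "smooth_map_germ ?g"
    by (rule smooth_map_germ_pair) (use q in \<open>auto intro!: smooth_germ_intros simp: zero_power\<close>)
  have "A_equivalent ?g (\<lambda>t. ?f (T t))" by (rule A_equivalent_left[OF g d\<psi> eq])
  moreover have f: "smooth_map_germ ?f"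
    by (rule smooth_map_germ_pair) (use q in \<open>auto intro!: smooth_germ_intros smooth_germ_cube C simp: zero_power\<close>)
  have "A_equivalent ?f (\<lambda>t. ?f (T t))" by (rule A_equivalent_right[OF f dT]) simp
  ultimately show ?thesis by (blast intro: A_equivalent_trans A_equivalent_sym)
qed

text \<open>For M = 2m the index \<open>M\<close> is not admissible, so \<open>c 0\<close> is tied
  to the coefficient of \<open>theta\<close> only when M < 2m.\<close>

lemma (in cubic_gap) phi3_prenormal:
  assumes \<kappa>: "smooth_germ \<kappa>" and gap: "gap (taylor (theta \<kappa>))"
  obtains b c :: "real \<Rightarrow> real" where "smooth_germ b" "smooth_germ c"
    "A_equivalent (phi3 \<kappa>) (\<lambda>t. (t ^ 3, t ^ (m + 3) * b (t ^ 3) + t ^ (M + 3) * c (t ^ 3)))"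
    "b 0 = taylor (theta \<kappa>) $ m / (2 * (real m + 3))"
    "M < 2 * m \<Longrightarrow> c 0 = taylor (theta \<kappa>) $ M / (2 * (real M + 3))"
proof -
  obtain h Y where h: "diffeo_germ h" and Y: "smooth_germ Y"
    and phi: "eventually (\<lambda>t. phi3 \<kappa> (h t) = (t ^ 3 / 6, Y t)) (nhds 0)"
    and Y0: "\<And>n. n < 3 \<Longrightarrow> taylor Y $ n = 0"
    and Yl: "\<And>l. adm l \<Longrightarrow> taylor Y $ (l + 3) = taylor (theta \<kappa>) $ l / (2 * (real l + 3))"
    using phi3_cubic_parameter[OF \<kappa> gap] by blast
  have z: "taylor Y $ i = 0" if "i mod 3 = (l + 3) mod 3" "i < l + 3" "l = m \<or> l = M" for i l
  proof (cases "i < 3")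
    case False
    define j where "j = i - 3"
    have j: "i = j + 3" "j mod 3 = l mod 3" "j < l" using False that by (auto simp: j_def mod_if le_mod_geq)
    have "forced j" using j that(3) by (auto simp: forced_def)
    then show ?thesis using Yl[of j] gapD[OF gap] forced_adm j(1) by simp
  qed (rule Y0)
  have zq: "taylor Y $ i = 0" if "i mod 3 = (m + 3) mod 3" "i < m + 3" for i
    by (rule z[OF that]) simp
  have zN: "taylor Y $ i = 0" if "i mod 3 = (M + 3) mod 3" "i < M + 3" for i
    by (rule z[OF that]) simp
  have "2 * (m + 3) = 2 * m + 3 * 2" by simp
  then have "2 * (m + 3) mod 3 = 2 * m mod 3" by (simp only: mod_mult_self2)
  then have mods: "(m + 3) mod 3 \<noteq> 0" "(M + 3) mod 3 = 2 * (m + 3) mod 3"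
    using m_mod M_mod by simp_all
  obtain a b c where abc: "smooth_germ a" "smooth_germ b" "smooth_germ c"
    "\<And>t. Y t = a (t ^ 3) + t ^ (m + 3) * b (t ^ 3) + t ^ (M + 3) * c (t ^ 3)"
    "\<And>n. taylor a $ n = taylor Y $ (3 * n)" "b 0 = taylor Y $ (m + 3)" "c 0 = taylor Y $ (M + 3)"
    using cubic_decomposition[OF Y mods zq zN] by blast
  have a0: "a 0 = 0" using abc(5)[of 0] Y0[of 0] by simp
  obtain \<xi> \<zeta> where phi3: "smooth_germ \<xi>" "smooth_germ \<zeta>"
    "\<And>s. phi3 \<kappa> s = (s ^ 3 * \<xi> s, s ^ 3 * \<zeta> s)"
    "\<And>n. taylor \<xi> $ n = taylor (\<lambda>s. cos (theta \<kappa> s)) $ n / (2 * (real n + 3))"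
    "\<And>n. taylor \<zeta> $ n = taylor (\<lambda>s. sin (theta \<kappa> s)) $ n / (2 * (real n + 3))"
    using phi3_components[OF \<kappa>] by blast
  have smphi: "smooth_map_germ (phi3 \<kappa>)"
    unfolding phi3(3)[abs_def]
    by (rule smooth_map_germ_pair) (auto intro!: smooth_germ_intros phi3(1,2))
  let ?f = "\<lambda>t. (t ^ 3 / 6, Y t)"
  have e1: "A_equivalent (phi3 \<kappa>) ?f"
    by (rule A_equivalent_right[OF smphi h]) (use phi in eventually_elim, simp)
  let ?\<psi> = "\<lambda>p. (6 * fst p + 0 * snd p + 0 * (snd p)\<^sup>2, - a (6 * fst p) + 1 * snd p + 0 * (snd p)\<^sup>2)"
  have s6: "smooth_germ (\<lambda>x::real. 6 * x)" by (intro smooth_germ_intros)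
  have sa6: "smooth_germ (\<lambda>x. a (6 * x))" by (rule smooth_germ_compose[OF abc(1) s6]) simp
  have d6: "deriv (\<lambda>x::real. 6 * x) 0 = 6" by (rule DERIV_imp_deriv) (auto intro!: derivative_eq_intros)
  have "diffeo_germ ?\<psi>"
    by (rule diffeo_germ_quadratic[where \<alpha> = "\<lambda>x. 6 * x" and \<beta> = "\<lambda>x. 0" and \<gamma> = "\<lambda>x. 0"
          and \<alpha>' = "\<lambda>x. - a (6 * x)" and \<beta>' = "\<lambda>x. 1" and \<gamma>' = "\<lambda>x. 0"])
       (use d6 a0 in \<open>auto intro!: smooth_germ_intros sa6\<close>)
  moreover have "smooth_map_germ ?f" using e1 by (simp add: A_equivalent_def)
  ultimately have e2: "A_equivalent ?f (\<lambda>t. (t ^ 3, t ^ (m + 3) * b (t ^ 3) + t ^ (M + 3) * c (t ^ 3)))"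
    by (intro A_equivalent_left[of ?f ?\<psi>]) (auto simp: abc(4))
  have am: "adm m" and aM: "M < 2 * m \<Longrightarrow> adm M" by (auto simp: adm_def)
  show ?thesis
    by (rule that[OF abc(2,3) A_equivalent_trans[OF e1 e2]])
       (use abc(6,7) Yl[OF am] Yl[OF aM] in simp_all)
qed

section \<open>Orders of functions along a curve\<close>

text \<open>The set of these \<open>n\<close> is the smooth analogue of the semigroup of values of a
  plane branch. What distinguishes the curves here are its elements not divisible by 3: every
  multiple of 3 occurs as soon as the first component is t^3.\<close>

definition order_along :: "(real \<Rightarrow> real \<times> real) \<Rightarrow> nat \<Rightarrow> bool" where
  "order_along f n \<longleftrightarrow> (\<exists>F :: real \<times> real \<Rightarrow> real. smooth_germ F \<and>
     (\<forall>i<n. taylor (\<lambda>t. F (f t)) $ i = 0) \<and> taylor (\<lambda>t. F (f t)) $ n \<noteq> 0)"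

text \<open>A function is transported by composition with \<open>\<psi>\<close>. The change of
  parameter has nonzero derivative at 0, so it only multiplies the lowest coefficient by a power of
  that derivative.\<close>

lemma order_along_A_equivalent:
  assumes "A_equivalent f g" "order_along f n"
  shows "order_along g n"
proof -
  obtain h \<psi> where f: "smooth_germ f" "f 0 = 0" and g: "smooth_germ g" "g 0 = 0"
    and h: "diffeo_germ h" and \<psi>: "diffeo_germ \<psi>"
    and eq: "eventually (\<lambda>t. f (h t) = \<psi> (g t)) (nhds 0)"
    using assms(1) unfolding A_equivalent_def smooth_map_germ_def by blast
  obtain F where F: "smooth_germ F" "\<And>i. i < n \<Longrightarrow> taylor (\<lambda>t. F (f t)) $ i = 0"
      "taylor (\<lambda>t. F (f t)) $ n \<noteq> 0"
    using assms(2) unfolding order_along_def by blast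
  have sFf: "smooth_germ (\<lambda>t. F (f t))" by (rule smooth_germ_compose[OF F(1) f])
  note sh = diffeo_germ_smooth[OF h] and h0 = diffeo_germ_zero[OF h]
  obtain h' where h': "diffeo_germ h'" "eventually (\<lambda>t. h' (h t) = t) (nhds 0)"
    using diffeo_germ_inverse[OF h] by blast
  have dh: "deriv h 0 \<noteq> 0"
  proof
    assume "deriv h 0 = 0"
    then have "taylor (\<lambda>t. h' (h t)) $ 1 = 0"
      unfolding taylor_compose[OF diffeo_germ_smooth[OF h'(1)] sh h0]
      by (simp add: fps_compose_nth eval_nat_numeral)
    moreover have "taylor (\<lambda>t. h' (h t)) = fps_X" using taylor_cong[OF h'(2)] by simp
    ultimately show False by simp
  qed
  have comp: "taylor (\<lambda>t. F (\<psi> (g t))) = taylor (\<lambda>t. F (f t)) oo taylor h"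
  proof -
    have "eventually (\<lambda>t. F (\<psi> (g t)) = F (f (h t))) (nhds 0)"
      using eq by eventually_elim simp
    from taylor_cong[OF this] show ?thesis using taylor_compose[OF sFf sh h0] by simp
  qed
  have th0: "taylor h $ 0 = 0" using h0 by simp
  have "taylor (\<lambda>t. F (\<psi> (g t))) $ i = 0" if "i < n" for i
    unfolding comp fps_compose_nth using F(2) that by (intro sum.neutral) auto
  moreover have "taylor (\<lambda>t. F (\<psi> (g t))) $ n \<noteq> 0"
  proof -
    have "(taylor (\<lambda>t. F (f t)) oo taylor h) $ n = (\<Sum>i\<in>{n}. taylor (\<lambda>t. F (f t)) $ i * (taylor h ^ i) $ n)"
      unfolding fps_compose_nth using F(2) by (intro sum.mono_neutral_right) auto
    then show ?thesis
      unfolding comp using F(3) dh startsby_zero_power_nth_same[OF th0, of n] by simp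
  qed
  moreover have "smooth_germ (\<lambda>p. F (\<psi> p))"
    by (rule smooth_germ_compose[OF F(1) diffeo_germ_smooth[OF \<psi>] diffeo_germ_zero[OF \<psi>]])
  ultimately show ?thesis
    unfolding order_along_def by (intro exI[of _ "\<lambda>p. F (\<psi> p)"]) simp
qed

text \<open>F(t^3, y) differs from F(t^3, 0) by O(y), hence by O(t^r), while F(t^3, 0) has only
  exponents divisible by 3.\<close>

lemma order_along_cube_ge:
  assumes w: "smooth_germ w" and n: "order_along (\<lambda>t. (t ^ 3, t ^ r * w t)) n" "\<not> 3 dvd n" and r: "0 < r"
  shows "r \<le> n"
proof (rule ccontr)
  assume "\<not> r \<le> n"
  let ?y = "\<lambda>t. t ^ r * w t"
  obtain F :: "real \<times> real \<Rightarrow> real" where F: "smooth_germ F" "taylor (\<lambda>t. F (t ^ 3, ?y t)) $ n \<noteq> 0"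
    using n(1) unfolding order_along_def by blast
  obtain U where U: "open U" "0 \<in> U" "smooth_on U F" using F(1) by (auto simp: smooth_germ_def)
  have y: "smooth_germ ?y" by (intro smooth_germ_intros w)
  have f: "smooth_germ (\<lambda>t. (t ^ 3, ?y t))" "(0 ^ 3, ?y 0) = (0 :: real \<times> real)"
    using r by (auto intro!: smooth_germ_intros y simp: zero_prod_def)
  have x0: "smooth_germ (\<lambda>x :: real. F (x, 0))"
    by (rule smooth_germ_compose[OF F(1), of "\<lambda>x. (x, 0)"]) (auto intro!: smooth_germ_intros simp: zero_prod_def)
  have s1: "smooth_germ (\<lambda>t. F (t ^ 3, ?y t))" by (rule smooth_germ_compose[OF F(1) f])
  have s2: "smooth_germ (\<lambda>t. F (t ^ 3, 0))" by (rule smooth_germ_cube[OF x0])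
  have tn: "taylor (\<lambda>t. F (t ^ 3, 0)) $ n = 0"
    using taylor_cube(2)[OF x0, of n] n(2) by simp
  have lip: "\<exists>K. eventually (\<lambda>t. \<bar>F (t ^ 3, ?y t) - F (t ^ 3, 0)\<bar> \<le> K * \<bar>?y t\<bar>) (nhds 0)"
  proof -
    let ?D = "\<lambda>p. frechet_derivative F (at p) (0, 1)"
    have cD: "continuous_on U ?D" by (rule smooth_on_continuous[OF smooth_on_frechet(2)[OF U(3)]])
    \<comment> \<open>On \<open>W\<close> the partial derivative in the second coordinate is bounded
      in absolute value by that at 0 plus 1; the mean value estimate along vertical segments gives
      the Lipschitz bound.\<close>
    define W where "W = U \<inter> ?D -` {- (\<bar>?D 0\<bar> + 1)<..<\<bar>?D 0\<bar> + 1}"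
    have W: "open W" "0 \<in> W" "W \<subseteq> U"
      using continuous_open_preimage[OF cD U(1), of "{- (\<bar>?D 0\<bar> + 1)<..<\<bar>?D 0\<bar> + 1}"] U(2)
      by (auto simp: W_def abs_if)
    obtain A B where AB: "open A" "open B" "(0::real) \<in> A" "(0::real) \<in> B" "A \<times> B \<subseteq> W"
      using open_prod_elim[OF W(1,2)] by (metis mem_Sigma_iff zero_prod_def)
    obtain e where e: "e > 0" "ball 0 e \<subseteq> B" using AB(2,4) open_contains_ball by blast
    have bound: "\<bar>F (x, z) - F (x, 0)\<bar> \<le> (\<bar>?D 0\<bar> + 1) * \<bar>z\<bar>" if "x \<in> A" "z \<in> ball 0 e" for x z
    proof -
      have inW: "(x, v) \<in> W" if "v \<in> ball 0 e" for v using that \<open>x \<in> A\<close> AB(5) e(2) by blast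
      have "norm (F (x, z) - F (x, 0)) \<le> (\<bar>?D 0\<bar> + 1) * norm (z - 0)"
      proof (rule field_differentiable_bound[of "ball 0 e" "\<lambda>z. F (x, z)" "\<lambda>z. ?D (x, z)"])
        fix v :: real assume v: "v \<in> ball 0 e"
        have dF: "(F has_derivative frechet_derivative F (at (x, v))) (at (x, v))"
          using smooth_on_frechet(1)[OF U(3)] inW[OF v] W(3) by blast
        have "((\<lambda>v. (x, v)) has_derivative (\<lambda>h. (0, h))) (at v)"
          by (intro has_derivative_Pair has_derivative_const has_derivative_ident)
        from has_derivative_compose[OF this dF]
        have "((\<lambda>v. F (x, v)) has_derivative (\<lambda>h. frechet_derivative F (at (x, v)) (0, h))) (at v)" .
        moreover have "(\<lambda>h. frechet_derivative F (at (x, v)) (0, h)) = (*) (?D (x, v))"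
        proof
          fix h :: real
          have "(0, h) = h *\<^sub>R (0 :: real, 1 :: real)" by simp
          then show "frechet_derivative F (at (x, v)) (0, h) = ?D (x, v) * h"
            using linear_cmul[OF has_derivative_linear[OF dF], of h "(0, 1)"]
            by (simp only: real_scaleR_def mult.commute)
        qed
        ultimately have "((\<lambda>v. F (x, v)) has_derivative (*) (?D (x, v))) (at v)" by (simp only:)
        then show "((\<lambda>v. F (x, v)) has_field_derivative ?D (x, v)) (at v within ball 0 e)"
          unfolding has_field_derivative_def by (rule has_derivative_at_withinI)
        show "norm (?D (x, v)) \<le> \<bar>?D 0\<bar> + 1" using inW[OF v] by (auto simp: W_def)
      qed (use that e(1) in auto)
      then show ?thesis by simp
    qed
    have "filterlim (\<lambda>t::real. t ^ 3) (nhds 0) (nhds 0)"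
      using smooth_germ_tendsto[OF smooth_germ_power[OF smooth_germ_ident], of 3] by simp
    from topological_tendstoD[OF this AB(1,3)]
    have 1: "eventually (\<lambda>t. t ^ 3 \<in> A) (nhds 0)" .
    have "eventually (\<lambda>t. ?y t \<in> ball 0 e) (nhds 0)"
      using topological_tendstoD[OF smooth_germ_tendsto[OF y], of "ball 0 e"] r e(1) by (simp add: zero_power)
    with 1 have "eventually (\<lambda>t. \<bar>F (t ^ 3, ?y t) - F (t ^ 3, 0)\<bar> \<le> (\<bar>?D 0\<bar> + 1) * \<bar>?y t\<bar>) (nhds 0)"
      by eventually_elim (rule bound)
    then show ?thesis by blast
  qed
  then obtain K where K: "eventually (\<lambda>t. \<bar>F (t ^ 3, ?y t) - F (t ^ 3, 0)\<bar> \<le> K * \<bar>?y t\<bar>) (nhds 0)"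
    by blast
  have "eventually (\<lambda>t. \<bar>w t\<bar> < \<bar>w 0\<bar> + 1) (nhds 0)"
    using order_tendstoD(2)[OF tendsto_rabs[OF smooth_germ_tendsto[OF w]], of "\<bar>w 0\<bar> + 1"] by simp
  with K have "eventually (\<lambda>t. \<bar>F (t ^ 3, ?y t) - F (t ^ 3, 0)\<bar> \<le> (\<bar>K\<bar> * (\<bar>w 0\<bar> + 1)) * \<bar>t\<bar> ^ r) (nhds 0)"
  proof eventually_elim
    case (elim t)
    have "K * \<bar>?y t\<bar> \<le> \<bar>K\<bar> * (\<bar>t\<bar> ^ r * (\<bar>w 0\<bar> + 1))"
      unfolding abs_mult power_abs using elim(2) by (intro mult_mono) auto
    then show ?case using elim(1) by (simp add: mult_ac)
  qed
  from taylor_bigo[OF smooth_germ_diff[OF s1 s2] this, of n] \<open>\<not> r \<le> n\<close>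
  have "taylor (\<lambda>t. F (t ^ 3, ?y t)) $ n = taylor (\<lambda>t. F (t ^ 3, 0)) $ n"
    by (simp add: taylor_diff s1 s2)
  then show False using F(2) tn by simp
qed

lemma order_along_cube_second:
  assumes w: "smooth_germ w" "w 0 \<noteq> 0"
  shows "order_along (\<lambda>t. (t ^ 3, t ^ r * w t)) r"
  unfolding order_along_def
  by (rule exI[of _ snd])
     (use w in \<open>auto simp: taylor_X_power_mult fps_X_power_mult_nth intro: smooth_germ_linear bounded_linear_snd\<close>)

section \<open>Recognition\<close>

text \<open>The coefficient at \<open>m\<close> is left open on purpose: the result serves both when
  it is the first nonzero one and when it vanishes as well.\<close>

lemma phi3_leading_term:
  assumes \<kappa>: "smooth_germ \<kappa>" and m: "m mod 3 \<noteq> 0"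
    and th: "\<And>i. i mod 3 \<noteq> 0 \<Longrightarrow> i < m \<Longrightarrow> theta_coeff \<kappa> i = 0"
  obtains w where "smooth_germ w" "A_equivalent (phi3 \<kappa>) (\<lambda>t. (t ^ 3, t ^ (m + 3) * w t))"
    "w 0 = 0 \<longleftrightarrow> theta_coeff \<kappa> m = 0"
proof -
  \<comment> \<open>\<open>M\<close> is the first index above \<open>m\<close> in the class of 2m.
    As M \<le> m + 2, a forced index in that class is at most M - 3 and hence below
    \<open>m\<close>, where the coefficients of \<open>theta\<close> vanish.\<close>
  define M where "M = (if m mod 3 = 1 then m + 1 else m + 2)"
  have double: "2 * m mod 3 = 2 * (m mod 3) mod 3" by (simp only: mod_mult_right_eq)
  have M: "M mod 3 = 2 * m mod 3 \<and> m < M \<and> M \<le> 2 * m \<and> M \<le> m + 2"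
  proof (cases "m mod 3 = 1")
    case True
    have "(m + 1) mod 3 = (m mod 3 + 1) mod 3" by (simp only: mod_add_left_eq)
    moreover have "1 \<le> m" using m by (cases m) simp_all
    ultimately show ?thesis using True double by (simp add: M_def)
  next
    case False
    then have 2: "m mod 3 = 2" using m by presburger
    have "(m + 2) mod 3 = (m mod 3 + 2) mod 3" by (simp only: mod_add_left_eq)
    moreover have "m \<noteq> 0" "m \<noteq> 1" using 2 by auto
    ultimately show ?thesis using 2 double by (simp add: M_def)
  qed
  interpret cubic_gap m M by unfold_locales (simp_all only: M m not_False_eq_True)
  have gap: "gap (taylor (theta \<kappa>))"
    unfolding gap_def
  proof (intro allI impI)
    fix n assume n: "forced n"
    have "n mod 3 \<noteq> 0" using n m_mod mods by (auto simp: forced_def)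
    moreover have "n < m"
    proof (cases "n mod 3 = M mod 3 \<and> n < M")
      case True
      then obtain j where "M = n + 3 * j" using same_mod_3[of n M] by auto
      then have "n + 3 \<le> M" using True by (cases j) auto
      then show ?thesis using M by linarith
    next
      case False
      then show ?thesis using n by (auto simp: forced_def)
    qed
    ultimately show "taylor (theta \<kappa>) $ n = 0" by (simp add: taylor_theta th)
  qed
  obtain b c where bc: "smooth_germ b" "smooth_germ c"
    "A_equivalent (phi3 \<kappa>) (\<lambda>t. (t ^ 3, t ^ (m + 3) * b (t ^ 3) + t ^ (M + 3) * c (t ^ 3)))"
    "b 0 = taylor (theta \<kappa>) $ m / (2 * (real m + 3))"
    "M < 2 * m \<Longrightarrow> c 0 = taylor (theta \<kappa>) $ M / (2 * (real M + 3))"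
    using phi3_prenormal[OF \<kappa> gap] by blast
  define d where "d = M - Suc m"
  have Md: "M + 3 = (m + 3) + Suc d" using m_less by (simp add: d_def)
  define w where "w t = b (t ^ 3) + t * (t ^ d * c (t ^ 3))" for t
  have w: "smooth_germ w" unfolding w_def by (intro smooth_germ_intros smooth_germ_cube bc)
  have eq: "(\<lambda>t. (t ^ 3, t ^ (m + 3) * b (t ^ 3) + t ^ (M + 3) * c (t ^ 3))) = (\<lambda>t. (t ^ 3, t ^ (m + 3) * w t))"
    unfolding w_def Md power_add[of _ "m + 3" "Suc d"] power_Suc[of _ d]
    by (simp only: distrib_left mult.assoc)
  have w0: "w 0 = 0 \<longleftrightarrow> theta_coeff \<kappa> m = 0"
    by (simp add: w_def bc(4) taylor_theta)
  show ?thesis using bc(3) unfolding eq by (rule that[OF w _ w0])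
qed

text \<open>With \<open>w 0 = 0\<close> a further factor t splits off the second component, so the
  orders not divisible by 3 start at m + 4 at the earliest.\<close>

lemma phi3_vanishing_leading_term:
  assumes \<kappa>: "smooth_germ \<kappa>" and m: "m mod 3 \<noteq> 0"
    and th: "\<And>i. i mod 3 \<noteq> 0 \<Longrightarrow> i < m \<Longrightarrow> theta_coeff \<kappa> i = 0" "theta_coeff \<kappa> m = 0"
  obtains v where "smooth_germ v" "A_equivalent (phi3 \<kappa>) (\<lambda>t. (t ^ 3, t ^ (m + 4) * v t))"
proof -
  obtain w where w: "smooth_germ w" "A_equivalent (phi3 \<kappa>) (\<lambda>t. (t ^ 3, t ^ (m + 3) * w t))"
    "w 0 = 0 \<longleftrightarrow> theta_coeff \<kappa> m = 0"
    using phi3_leading_term[OF \<kappa> m th(1)] by blast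
  have "taylor w $ i = 0" if "i < 1" for i
    using that w(3) th(2) by simp
  from smooth_factor[OF w(1) this] obtain v where v: "smooth_germ v" "\<And>t. w t = t ^ 1 * v t"
    "\<And>i. taylor v $ i = taylor w $ (i + 1)" by blast
  have "t ^ (m + 3) * w t = t ^ (m + 4) * v t" for t
  proof -
    have "m + 4 = Suc (m + 3)" by simp
    then have "t ^ (m + 4) = t ^ (m + 3) * t" by (simp only: power_Suc2)
    then show ?thesis unfolding v(2) by (simp only: power_one_right mult.assoc)
  qed
  with w(2) have "A_equivalent (phi3 \<kappa>) (\<lambda>t. (t ^ 3, t ^ (m + 4) * v t))" by (simp only:)
  then show ?thesis by (rule that[OF v(1)])
qed

text \<open>Orders not divisible by 3 along the given curve are at least m + 3. A first nonzero
  coefficient at i < m would produce the order i + 3; a zero coefficient at \<open>m\<close> would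
  exclude the order m + 3, which \<open>w 0 \<noteq> 0\<close> realises.\<close>

lemma theta_coeff_of_A_equivalent:
  assumes \<kappa>: "smooth_germ \<kappa>" and m: "m mod 3 \<noteq> 0"
    and g: "A_equivalent (phi3 \<kappa>) (\<lambda>t. (t ^ 3, t ^ (m + 3) * w t))" "smooth_germ w" "w 0 \<noteq> 0"
  shows "\<And>i. i mod 3 \<noteq> 0 \<Longrightarrow> i < m \<Longrightarrow> theta_coeff \<kappa> i = 0" and "theta_coeff \<kappa> m \<noteq> 0"
proof -
  have ge: "m + 3 \<le> n" if "order_along (phi3 \<kappa>) n" "\<not> 3 dvd n" for n
    using order_along_cube_ge[OF g(2) order_along_A_equivalent[OF g(1) that(1)] that(2)] by simp
  show *: "theta_coeff \<kappa> i = 0" if "i mod 3 \<noteq> 0" "i < m" for i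
    using that
  proof (induction i rule: less_induct)
    case (less i)
    show ?case
    proof (rule ccontr)
      assume ne: "theta_coeff \<kappa> i \<noteq> 0"
      have th: "theta_coeff \<kappa> j = 0" if "j mod 3 \<noteq> 0" "j < i" for j
        using less.IH[OF that(2,1)] less.prems(2) that(2) by simp
      obtain v where v: "smooth_germ v" "A_equivalent (phi3 \<kappa>) (\<lambda>t. (t ^ 3, t ^ (i + 3) * v t))"
        "v 0 = 0 \<longleftrightarrow> theta_coeff \<kappa> i = 0"
        using phi3_leading_term[OF \<kappa> less.prems(1) th] by blast
      have "order_along (phi3 \<kappa>) (i + 3)"
        by (rule order_along_A_equivalent[OF A_equivalent_sym[OF v(2)] order_along_cube_second])
           (use v ne in auto)
      moreover have "\<not> 3 dvd i + 3" using less.prems(1) by (simp add: dvd_eq_mod_eq_0)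
      ultimately show False using ge less.prems(2) by fastforce
    qed
  qed
  show "theta_coeff \<kappa> m \<noteq> 0"
  proof
    assume "theta_coeff \<kappa> m = 0"
    then obtain v where v: "smooth_germ v" "A_equivalent (phi3 \<kappa>) (\<lambda>t. (t ^ 3, t ^ (m + 4) * v t))"
      using phi3_vanishing_leading_term[OF \<kappa> m *] by blast
    have "order_along (\<lambda>t. (t ^ 3, t ^ (m + 4) * v t)) (m + 3)"
      by (rule order_along_A_equivalent[OF A_equivalent_trans[OF A_equivalent_sym[OF g(1)] v(2)]
          order_along_cube_second[OF g(2,3)]])
    moreover have "\<not> 3 dvd m + 3" using m by (simp add: dvd_eq_mod_eq_0)
    ultimately have "m + 4 \<le> m + 3" by (intro order_along_cube_ge[OF v(1)]) auto
    then show False by simp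
  qed
qed

section \<open>From the coefficients of \<open>theta\<close> to the normal forms\<close>

lemma phi3_normal_form:
  assumes \<kappa>: "smooth_germ \<kappa>" and m: "m mod 3 \<noteq> 0" and M: "M mod 3 = 2 * m mod 3" "m < M" "M \<le> 2 * m"
    and th: "\<And>i. i mod 3 = m mod 3 \<Longrightarrow> i < m \<Longrightarrow> theta_coeff \<kappa> i = 0"
      "\<And>i. i mod 3 = M mod 3 \<Longrightarrow> i < M \<Longrightarrow> theta_coeff \<kappa> i = 0"
    and ne: "theta_coeff \<kappa> m \<noteq> 0"
  obtains C where "smooth_germ C" "A_equivalent (phi3 \<kappa>) (\<lambda>t. (t ^ 3, t ^ (m + 3) + t ^ (M + 3) * C (t ^ 3)))"
    "M < 2 * m \<Longrightarrow> theta_coeff \<kappa> M \<noteq> 0 \<Longrightarrow> sgn (C 0) = sgn (theta_coeff \<kappa> M / theta_coeff \<kappa> m)"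
proof -
  interpret cubic_gap m M by unfold_locales (fact m M)+
  have gap: "gap (taylor (theta \<kappa>))" using th by (auto simp: gap_def forced_def taylor_theta)
  obtain b c where bc: "smooth_germ b" "smooth_germ c"
    "A_equivalent (phi3 \<kappa>) (\<lambda>t. (t ^ 3, t ^ (m + 3) * b (t ^ 3) + t ^ (M + 3) * c (t ^ 3)))"
    "b 0 = taylor (theta \<kappa>) $ m / (2 * (real m + 3))"
    "M < 2 * m \<Longrightarrow> c 0 = taylor (theta \<kappa>) $ M / (2 * (real M + 3))"
    using phi3_prenormal[OF \<kappa> gap] by blast
  have b0: "b 0 \<noteq> 0" using ne by (simp add: bc(4) taylor_theta)
  \<comment> \<open>The factors relating \<open>b 0\<close> and \<open>c 0\<close> to the
    coefficients of \<open>theta\<close> are positive and drop out of the sign of the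
    quotient.\<close>
  have pos: "sgn (fact n :: real) = 1" "sgn (2 * (real n + 3)) = 1" for n by (simp_all add: sgn_if)
  show ?thesis
  proof (rule that[of "\<lambda>x. c x / b x"])
    show "smooth_germ (\<lambda>x. c x / b x)" by (rule smooth_germ_divide[OF bc(2,1) b0])
    show "A_equivalent (phi3 \<kappa>) (\<lambda>t. (t ^ 3, t ^ (m + 3) + t ^ (M + 3) * (c (t ^ 3) / b (t ^ 3))))"
      by (rule A_equivalent_trans[OF bc(3) A_equivalent_divide_unit[OF bc(1,2) b0]]) auto
    show "sgn (c 0 / b 0) = sgn (theta_coeff \<kappa> M / theta_coeff \<kappa> m)" if "M < 2 * m"
      unfolding bc(4) bc(5)[OF that] taylor_theta sgn_divide pos by simp
  qed
qed

lemma phi3_binomial: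
  assumes \<kappa>: "smooth_germ \<kappa>" and m: "m mod 3 \<noteq> 0" and M: "M mod 3 = 2 * m mod 3" "m < M" "M < 2 * m"
    and th: "\<And>i. i mod 3 \<noteq> 0 \<Longrightarrow> i < m \<Longrightarrow> theta_coeff \<kappa> i = 0"
      "\<And>i. i mod 3 = M mod 3 \<Longrightarrow> m < i \<Longrightarrow> i < M \<Longrightarrow> theta_coeff \<kappa> i = 0"
    and ne: "theta_coeff \<kappa> m \<noteq> 0" "theta_coeff \<kappa> M \<noteq> 0"
    and \<epsilon>: "\<epsilon> = (if odd (M - m) then 1 else sgn (theta_coeff \<kappa> M / theta_coeff \<kappa> m))"
  shows "A_equivalent (phi3 \<kappa>) (\<lambda>t. (t ^ 3, t ^ (m + 3) + \<epsilon> * t ^ (M + 3)))"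
proof -
  have mods: "M mod 3 \<noteq> 0" "m mod 3 \<noteq> M mod 3" using double_mod_3[OF m] M(1) by simp_all
  have th': "theta_coeff \<kappa> i = 0" if "i mod 3 = M mod 3" "i < M" for i
    using th that mods by (metis linorder_neqE_nat)
  have th'': "theta_coeff \<kappa> i = 0" if "i mod 3 = m mod 3" "i < m" for i
    using th(1) that m by simp
  obtain C where C: "smooth_germ C" "A_equivalent (phi3 \<kappa>) (\<lambda>t. (t ^ 3, t ^ (m + 3) + t ^ (M + 3) * C (t ^ 3)))"
    and sgn: "M < 2 * m \<Longrightarrow> theta_coeff \<kappa> M \<noteq> 0 \<Longrightarrow> sgn (C 0) = sgn (theta_coeff \<kappa> M / theta_coeff \<kappa> m)"
    using phi3_normal_form[OF \<kappa> m M(1,2) less_imp_le[OF M(3)] th'' th' ne(1)] by blast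
  note sgn = sgn[OF M(3) ne(2)]
  have "C 0 \<noteq> 0" using sgn ne by (auto simp: sgn_if split: if_splits)
  then have "A_equivalent (\<lambda>t. (t ^ 3, t ^ (m + 3) + t ^ (M + 3) * C (t ^ 3)))
      (\<lambda>t. (t ^ 3, t ^ (m + 3) + \<epsilon> * t ^ (M + 3)))"
    using M(2) by (intro A_equivalent_binomial C(1)) (auto simp: \<epsilon> sgn)
  then show ?thesis by (rule A_equivalent_trans[OF C(2)])
qed

text \<open>With M = 2m the second exponent is 2m + 3 = 2q - 3, so
  \<open>A_equivalent_monomial\<close> removes it along with the rest of its class.\<close>

lemma phi3_monomial:
  assumes \<kappa>: "smooth_germ \<kappa>" and m: "m mod 3 \<noteq> 0"
    and th: "\<And>i. i mod 3 \<noteq> 0 \<Longrightarrow> i < m \<Longrightarrow> theta_coeff \<kappa> i = 0"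
      "\<And>i. i mod 3 = 2 * m mod 3 \<Longrightarrow> m < i \<Longrightarrow> i < 2 * m \<Longrightarrow> theta_coeff \<kappa> i = 0"
    and ne: "theta_coeff \<kappa> m \<noteq> 0"
  shows "A_equivalent (phi3 \<kappa>) (\<lambda>t. (t ^ 3, t ^ (m + 3)))"
proof -
  note mods = double_mod_3[OF m]
  have m0: "m < 2 * m" using m by (cases m) auto
  have th': "theta_coeff \<kappa> i = 0" if "i mod 3 = 2 * m mod 3" "i < 2 * m" for i
    using th that mods by (metis linorder_neqE_nat)
  have th'': "theta_coeff \<kappa> i = 0" if "i mod 3 = m mod 3" "i < m" for i
    using th(1) that m by simp
  obtain C where C: "smooth_germ C" "A_equivalent (phi3 \<kappa>) (\<lambda>t. (t ^ 3, t ^ (m + 3) + t ^ (2 * m + 3) * C (t ^ 3)))"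
    and "2 * m < 2 * m \<Longrightarrow> theta_coeff \<kappa> (2 * m) \<noteq> 0 \<Longrightarrow>
      sgn (C 0) = sgn (theta_coeff \<kappa> (2 * m) / theta_coeff \<kappa> m)"
    using phi3_normal_form[OF \<kappa> m refl m0 order_refl th'' th' ne] by blast
  have "4 \<le> m + 3" "(m + 3) mod 3 \<noteq> 0" using m0 m by simp_all
  note mono = A_equivalent_monomial[OF C(1) this]
  have "2 * (m + 3) - 3 = 2 * m + 3" by simp
  from A_equivalent_trans[OF C(2) mono[unfolded this]] show ?thesis .
qed

lemma theta_coeff_of_binomial:
  assumes \<kappa>: "smooth_germ \<kappa>" and m: "m mod 3 \<noteq> 0" and N: "m + 3 < N"
    and g: "A_equivalent (phi3 \<kappa>) (\<lambda>t. (t ^ 3, t ^ (m + 3) + \<epsilon> * t ^ N))"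
  shows "\<And>i. i mod 3 \<noteq> 0 \<Longrightarrow> i < m \<Longrightarrow> theta_coeff \<kappa> i = 0" and "theta_coeff \<kappa> m \<noteq> 0"
proof -
  obtain d where d: "N = m + 3 + Suc d" using less_imp_Suc_add[OF N] by (metis add_Suc_right)
  have eq: "(\<lambda>t. (t ^ 3, t ^ (m + 3) + \<epsilon> * t ^ N)) = (\<lambda>t. (t ^ 3, t ^ (m + 3) * (1 + \<epsilon> * t ^ Suc d)))"
    unfolding d power_add[of _ "m + 3" "Suc d"]
    by (simp only: distrib_left mult.left_commute[of \<epsilon>] mult_1_right)
  have w: "smooth_germ (\<lambda>t. 1 + \<epsilon> * t ^ Suc d)" "1 + \<epsilon> * 0 ^ Suc d \<noteq> 0"
    by (intro smooth_germ_intros) simp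
  note * = theta_coeff_of_A_equivalent[OF \<kappa> m g[unfolded eq] w]
  show "\<And>i. i mod 3 \<noteq> 0 \<Longrightarrow> i < m \<Longrightarrow> theta_coeff \<kappa> i = 0" and "theta_coeff \<kappa> m \<noteq> 0"
    by (rule *(1), assumption+) (rule *(2))
qed

text \<open>Common form of \<open>star_condition\<close>, where m = 3k - 2, and
  \<open>double_star_condition\<close>, where m = 3k - 1.\<close>

definition leading :: "(real \<Rightarrow> real) \<Rightarrow> nat \<Rightarrow> bool" where
  "leading \<kappa> m \<longleftrightarrow> (\<forall>i. i mod 3 \<noteq> 0 \<and> i < m \<longrightarrow> theta_coeff \<kappa> i = 0) \<and> theta_coeff \<kappa> m \<noteq> 0"

text \<open>Both series at once: \<open>(m, e)\<close> is \<open>(3k - 2, 3k - 1)\<close> for \<open>E\<^sub>6\<^sub>k\<close> and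
  \<open>(3k - 1, 3k + 1)\<close> for \<open>E\<^sub>6\<^sub>k\<^sub>+\<^sub>2\<close>, and \<open>e + 3p\<close> is the index of the second coefficient.\<close>

locale cubic_series =
  fixes e k m :: nat and \<kappa> :: "real \<Rightarrow> real"
  assumes \<kappa>: "smooth_germ \<kappa>" and m_mod: "m mod 3 \<noteq> 0" and e: "m < e" "e \<le> m + 2"
    and e_eq: "2 * m + 3 = e + 3 * k"
begin

lemma e_mod: "(e + 3 * p) mod 3 = 2 * m mod 3"
proof -
  have "(e + 3 * p) mod 3 = (e + 3 * k) mod 3" by simp
  also have "\<dots> = 2 * m mod 3" unfolding e_eq[symmetric] by simp
  finally show ?thesis .
qed

text \<open>Since m < e \<le> m + 2, the first index above \<open>m\<close> in the class of 2m is
  \<open>e\<close>; the second coefficients to be tested are thus those at e + 3j.\<close>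

lemma index_cases:
  assumes "i mod 3 = 2 * m mod 3" "m < i"
  obtains j where "i = e + 3 * j"
proof -
  have mod: "e mod 3 = i mod 3" using assms(1) e_mod[of 0] by simp
  have "e \<le> i"
  proof (rule ccontr)
    assume "\<not> e \<le> i"
    then have "e = i + 1" using assms(2) e by linarith
    then obtain j where "i + 1 = i + 3 * j" using same_mod_3[of i e] mod by auto
    then show False by simp
  qed
  from same_mod_3[OF mod this] obtain j where "i = e + 3 * j" .
  then show ?thesis by (rule that)
qed

text \<open>By \<open>e_eq\<close>, p + 2 \<le> k says that e + 3p < 2m, so the second index is
  still in the range where coefficients are read off \<open>theta\<close>.\<close>

lemma binomial_form:
  assumes l: "leading \<kappa> m" and p: "p + 2 \<le> k" "\<And>j. j < p \<Longrightarrow> theta_coeff \<kappa> (e + 3 * j) = 0"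
    and ne: "theta_coeff \<kappa> (e + 3 * p) \<noteq> 0"
    and \<epsilon>: "\<epsilon> = (if odd (e + 3 * p - m) then 1 else sgn (theta_coeff \<kappa> (e + 3 * p) / theta_coeff \<kappa> m))"
  shows "A_equivalent (phi3 \<kappa>) (\<lambda>t. (t ^ 3, t ^ (m + 3) + \<epsilon> * t ^ (e + 3 * p + 3)))"
proof (rule phi3_binomial[OF \<kappa> m_mod e_mod _ _ _ _ _ ne \<epsilon>])
  show "theta_coeff \<kappa> i = 0" if "i mod 3 = (e + 3 * p) mod 3" "m < i" "i < e + 3 * p" for i
  proof -
    have "i mod 3 = 2 * m mod 3" using that(1) e_mod[of p] by simp
    from index_cases[OF this that(2)] obtain j where "i = e + 3 * j" .
    then show ?thesis using p(2) that(3) by simp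
  qed
qed (use e e_eq p l in \<open>auto simp: leading_def\<close>)

lemma monomial_form:
  assumes l: "leading \<kappa> m" and p: "\<And>j. j + 2 \<le> k \<Longrightarrow> theta_coeff \<kappa> (e + 3 * j) = 0"
  shows "A_equivalent (phi3 \<kappa>) (\<lambda>t. (t ^ 3, t ^ (m + 3)))"
proof (rule phi3_monomial[OF \<kappa> m_mod])
  show "theta_coeff \<kappa> i = 0" if "i mod 3 = 2 * m mod 3" "m < i" "i < 2 * m" for i
  proof -
    from index_cases[OF that(1,2)] obtain j where "i = e + 3 * j" .
    then show ?thesis using p that(3) e_eq by simp
  qed
qed (use l in \<open>auto simp: leading_def\<close>)

lemma leading_of_normal_form:
  assumes "(\<exists>p \<epsilon>. A_equivalent (phi3 \<kappa>) (\<lambda>t. (t ^ 3, t ^ (m + 3) + \<epsilon> * t ^ (e + 3 * p + 3)))) \<or>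
    A_equivalent (phi3 \<kappa>) (\<lambda>t. (t ^ 3, t ^ (m + 3)))"
  shows "leading \<kappa> m"
  using assms
proof (elim disjE exE)
  fix p \<epsilon> assume A: "A_equivalent (phi3 \<kappa>) (\<lambda>t. (t ^ 3, t ^ (m + 3) + \<epsilon> * t ^ (e + 3 * p + 3)))"
  show ?thesis
    unfolding leading_def using theta_coeff_of_binomial[OF \<kappa> m_mod _ A] e(1) by simp
next
  assume A: "A_equivalent (phi3 \<kappa>) (\<lambda>t. (t ^ 3, t ^ (m + 3)))"
  show ?thesis
    unfolding leading_def
    using theta_coeff_of_A_equivalent[OF \<kappa> m_mod _ smooth_germ_const, of 1] A by simp
qed

lemma normal_form_cases:
  assumes "leading \<kappa> m"
  shows "(\<exists>p. p + 2 \<le> k \<and> (\<forall>j<p. theta_coeff \<kappa> (e + 3 * j) = 0) \<and> theta_coeff \<kappa> (e + 3 * p) \<noteq> 0) \<or>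
    (\<forall>j. j + 2 \<le> k \<longrightarrow> theta_coeff \<kappa> (e + 3 * j) = 0)"
proof (cases "\<exists>p. p + 2 \<le> k \<and> theta_coeff \<kappa> (e + 3 * p) \<noteq> 0")
  case True
  define P where "P p \<longleftrightarrow> p + 2 \<le> k \<and> theta_coeff \<kappa> (e + 3 * p) \<noteq> 0" for p
  define p where "p = (LEAST p. P p)"
  have p: "P p" unfolding p_def by (rule LeastI_ex) (use True in \<open>simp add: P_def\<close>)
  have "theta_coeff \<kappa> (e + 3 * j) = 0" if "j < p" for j
    using not_less_Least[of j P] that p unfolding p_def[symmetric] by (auto simp: P_def)
  then show ?thesis using p by (auto simp: P_def)
qed blast

end

theorem theorem3p4:
  fixes k :: nat and \<kappa> :: "real \<Rightarrow> real"
  assumes "k \<ge> 1" and "smooth_germ \<kappa>"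
  shows
    "(E6k_singularity k (phi3 \<kappa>) \<longleftrightarrow> star_condition k \<kappa>) \<and>
     (star_condition k \<kappa> \<longrightarrow>
        (\<forall>p. p + 2 \<le> k \<and>
           (\<forall>j<p. theta_coeff \<kappa> (3*(k+j)-1) = 0) \<and> theta_coeff \<kappa> (3*(k+p)-1) \<noteq> 0 \<longrightarrow>
           (\<exists>\<epsilon>. admissible_sign p \<epsilon> \<and>
              (odd p \<longrightarrow> \<epsilon> = sgn (theta_coeff \<kappa> (3*(k+p)-1) / theta_coeff \<kappa> (3*k-2))) \<and>
              A_equivalent (phi3 \<kappa>) (\<lambda>t. (t ^ 3, t ^ (3*k+1) + \<epsilon> * t ^ (3*(k+p)+2))))) \<and>
        ((\<forall>j. j + 2 \<le> k \<longrightarrow> theta_coeff \<kappa> (3*(k+j)-1) = 0) \<longrightarrow>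
           A_equivalent (phi3 \<kappa>) (\<lambda>t. (t ^ 3, t ^ (3*k+1))))) \<and>
     (E6k2_singularity k (phi3 \<kappa>) \<longleftrightarrow> double_star_condition k \<kappa>) \<and>
     (double_star_condition k \<kappa> \<longrightarrow>
        (\<forall>p. p + 2 \<le> k \<and>
           (\<forall>j<p. theta_coeff \<kappa> (3*(k+j)+1) = 0) \<and> theta_coeff \<kappa> (3*(k+p)+1) \<noteq> 0 \<longrightarrow>
           (\<exists>\<epsilon>. admissible_sign (p+1) \<epsilon> \<and>
              (odd (p+1) \<longrightarrow> \<epsilon> = sgn (theta_coeff \<kappa> (3*(k+p)+1) / theta_coeff \<kappa> (3*k-1))) \<and>
              A_equivalent (phi3 \<kappa>) (\<lambda>t. (t ^ 3, t ^ (3*k+2) + \<epsilon> * t ^ (3*(k+p)+4))))) \<and>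
        ((\<forall>j. j + 2 \<le> k \<longrightarrow> theta_coeff \<kappa> (3*(k+j)+1) = 0) \<longrightarrow>
           A_equivalent (phi3 \<kappa>) (\<lambda>t. (t ^ 3, t ^ (3*k+2)))))"
proof -
  have sgn_cases: "sgn (x / y) \<in> {1, -1}" if "x \<noteq> 0" "y \<noteq> 0" for x y :: real
    using that by (auto simp: sgn_if)
  \<comment> \<open>k \<ge> 1 makes the truncated differences exact.\<close>
  interpret I: cubic_series "3 * k - 1" k "3 * k - 2" \<kappa>
  proof
    obtain j where "k = Suc j" using assms(1) by (cases k) auto
    then have "3 * k - 2 = 1 + 3 * j" by simp
    then show "(3 * k - 2) mod 3 \<noteq> 0" by (simp only: mod_mult_self2) simp
  qed (use assms in auto)
  interpret II: cubic_series "3 * k + 1" k "3 * k - 1" \<kappa>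
  proof
    obtain j where "k = Suc j" using assms(1) by (cases k) auto
    then have "3 * k - 1 = 2 + 3 * j" by simp
    then show "(3 * k - 1) mod 3 \<noteq> 0" by (simp only: mod_mult_self2) simp
  qed (use assms in auto)
  \<comment> \<open>These bring the exponents into the shape of the statement. The last two
    equations give the differences of the exponents, whose parity decides whether a sign
    survives.\<close>
  have idx: "3 * k - 2 + 3 = 3 * k + 1" "3 * k - 1 + 3 = 3 * k + 2"
    "3 * k - 1 + 3 * p = 3 * (k + p) - 1" "3 * k - 1 + 3 * p + 3 = 3 * (k + p) + 2"
    "3 * (k + p) - 1 + 3 = 3 * (k + p) + 2"
    "3 * k + 1 + 3 * p = 3 * (k + p) + 1" "3 * (k + p) + 1 + 3 = 3 * (k + p) + 4"
    "3 * (k + p) - 1 - (3 * k - 2) = 3 * p + 1" "3 * (k + p) + 1 - (3 * k - 1) = 3 * p + 2" for p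
    using assms(1) by auto
  have pos: "1 \<le> i \<and> i mod 3 \<noteq> 0 \<and> i < n \<longleftrightarrow> i mod 3 \<noteq> 0 \<and> i < n" for i n :: nat
    by (cases i) auto
  have star: "star_condition k \<kappa> \<longleftrightarrow> leading \<kappa> (3 * k - 2)"
    "double_star_condition k \<kappa> \<longleftrightarrow> leading \<kappa> (3 * k - 1)"
    unfolding star_condition_def double_star_condition_def leading_def pos by (rule refl)+
  have ia: "\<exists>\<epsilon>. admissible_sign p \<epsilon> \<and>
      (odd p \<longrightarrow> \<epsilon> = sgn (theta_coeff \<kappa> (3*(k+p)-1) / theta_coeff \<kappa> (3*k-2))) \<and>
      A_equivalent (phi3 \<kappa>) (\<lambda>t. (t ^ 3, t ^ (3*k+1) + \<epsilon> * t ^ (3*(k+p)+2)))"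
    if "leading \<kappa> (3 * k - 2)" "p + 2 \<le> k" "\<forall>j<p. theta_coeff \<kappa> (3*(k+j)-1) = 0"
      "theta_coeff \<kappa> (3*(k+p)-1) \<noteq> 0" for p
  proof -
    \<comment> \<open>3p + 1 is odd exactly for even \<open>p\<close>, where the sign is normalised
      to 1.\<close>
    define \<epsilon> where "\<epsilon> = (if odd (3 * p + 1) then 1
      else sgn (theta_coeff \<kappa> (3*(k+p)-1) / theta_coeff \<kappa> (3*k-2)))"
    have "A_equivalent (phi3 \<kappa>) (\<lambda>t. (t ^ 3, t ^ (3*k+1) + \<epsilon> * t ^ (3*(k+p)+2)))"
      using I.binomial_form[of p \<epsilon>, unfolded idx] that by (simp add: \<epsilon>_def)
    moreover have "admissible_sign p \<epsilon>"
      using sgn_cases[OF that(4)] that(1) by (auto simp: admissible_sign_def \<epsilon>_def leading_def)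
    ultimately show ?thesis by (intro exI[of _ \<epsilon>]) (auto simp: \<epsilon>_def)
  qed
  have iia: "\<exists>\<epsilon>. admissible_sign (p+1) \<epsilon> \<and>
      (odd (p+1) \<longrightarrow> \<epsilon> = sgn (theta_coeff \<kappa> (3*(k+p)+1) / theta_coeff \<kappa> (3*k-1))) \<and>
      A_equivalent (phi3 \<kappa>) (\<lambda>t. (t ^ 3, t ^ (3*k+2) + \<epsilon> * t ^ (3*(k+p)+4)))"
    if "leading \<kappa> (3 * k - 1)" "p + 2 \<le> k" "\<forall>j<p. theta_coeff \<kappa> (3*(k+j)+1) = 0"
      "theta_coeff \<kappa> (3*(k+p)+1) \<noteq> 0" for p
  proof -
    \<comment> \<open>3p + 2 is odd exactly for odd \<open>p\<close>, that is for even p + 1: hence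
      the shifted index in the sign convention.\<close>
    define \<epsilon> where "\<epsilon> = (if odd (3 * p + 2) then 1
      else sgn (theta_coeff \<kappa> (3*(k+p)+1) / theta_coeff \<kappa> (3*k-1)))"
    have "A_equivalent (phi3 \<kappa>) (\<lambda>t. (t ^ 3, t ^ (3*k+2) + \<epsilon> * t ^ (3*(k+p)+4)))"
      using II.binomial_form[of p \<epsilon>, unfolded idx] that by (simp add: \<epsilon>_def)
    moreover have "admissible_sign (p+1) \<epsilon>"
      using sgn_cases[OF that(4)] that(1) by (auto simp: admissible_sign_def \<epsilon>_def leading_def)
    ultimately show ?thesis by (intro exI[of _ \<epsilon>]) (auto simp: \<epsilon>_def)
  qed
  have ib: "A_equivalent (phi3 \<kappa>) (\<lambda>t. (t ^ 3, t ^ (3*k+1)))"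
    if "leading \<kappa> (3 * k - 2)" "\<forall>j. j + 2 \<le> k \<longrightarrow> theta_coeff \<kappa> (3*(k+j)-1) = 0"
    using I.monomial_form[unfolded idx] that by blast
  have iib: "A_equivalent (phi3 \<kappa>) (\<lambda>t. (t ^ 3, t ^ (3*k+2)))"
    if "leading \<kappa> (3 * k - 1)" "\<forall>j. j + 2 \<le> k \<longrightarrow> theta_coeff \<kappa> (3*(k+j)+1) = 0"
    using II.monomial_form[unfolded idx] that by blast
  have "E6k_singularity k (phi3 \<kappa>) \<longleftrightarrow> leading \<kappa> (3 * k - 2)"
  proof
    assume "E6k_singularity k (phi3 \<kappa>)"
    then show "leading \<kappa> (3 * k - 2)"
      unfolding E6k_singularity_def by (intro I.leading_of_normal_form[unfolded idx]) blast
  next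
    assume l: "leading \<kappa> (3 * k - 2)"
    show "E6k_singularity k (phi3 \<kappa>)"
      using I.normal_form_cases[OF l, unfolded idx] ia[OF l] ib[OF l]
      unfolding E6k_singularity_def by meson
  qed
  moreover have "E6k2_singularity k (phi3 \<kappa>) \<longleftrightarrow> leading \<kappa> (3 * k - 1)"
  proof
    assume "E6k2_singularity k (phi3 \<kappa>)"
    then show "leading \<kappa> (3 * k - 1)"
      unfolding E6k2_singularity_def by (intro II.leading_of_normal_form[unfolded idx]) blast
  next
    assume l: "leading \<kappa> (3 * k - 1)"
    show "E6k2_singularity k (phi3 \<kappa>)"
      using II.normal_form_cases[OF l, unfolded idx] iia[OF l] iib[OF l]
      unfolding E6k2_singularity_def by meson
  qed
  ultimately show ?thesis
    unfolding star using ia ib iia iib by simp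
qed

end
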